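(* Let $\boldsymbol{\gamma}\in\mathbb{N}_0^2$ be a multi-index, $1\le p\le\infty$, $\mu\in\mathbb{N}$, let $\boldsymbol{P},\boldsymbol{Q}$ be finite sets of multi-indices with $\boldsymbol{0}\in\boldsymbol{Q}$ and $\boldsymbol{P}\subset\overline{\boldsymbol{Q}}$, and let $I: C^\mu(\Lambda)\to S(\hat M)\subset H^{\boldsymbol{P}+\boldsymbol{\gamma}}_p(\Lambda)$ be a linear operator. Put $j=\dim \boldsymbol{D}^{\boldsymbol{\gamma}}S(\hat M)$. Assume that there are linear functionals $F_i$, $i=1,\dots,j$, with $F_i\in\big(H^{\overline{\boldsymbol{Q}}}_p(\Lambda)\big)'$ (and also defined, linearly, on $\boldsymbol{D}^{\boldsymbol{\gamma}}S(\hat M)$) such that $$F_i(\boldsymbol{D}^{\boldsymbol{\gamma}} I u)=F_i(\boldsymbol{D}^{\boldsymbol{\gamma}}u),\quad i=1,\dots,j,\quad \text{for all } u\in C^\mu(\Lambda)\cap H^{\overline{\boldsymbol{Q}}+\boldsymbol{\gamma}}_p(\Lambda),$$ and such that for every $s\in S(\hat M)$: if $F_i(\boldsymbol{D}^{\boldsymbol{\gamma}}s)=0$ for all $i=1,\dots,j$, then $\boldsymbol{D}^{\boldsymbol{\gamma}}s=0$. Then there exists a constant $C$ independent of $u$ such that $$\|u-Iu\|_{\boldsymbol{P}+\boldsymbol{\gamma},p}\le C\left(|u|_{\overline{\boldsymbol{Q}}+\boldsymbol{\gamma},p}+\|q-Iq\|_{\boldsymbol{P}+\boldsymbol{\gamma},p}\right)\qquad\text{for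 all } u\in C^\mu(\Lambda)\cap H^{\overline{\boldsymbol{Q}}+\boldsymbol{\gamma}}_p(\Lambda),$$ where the polynomial $q\in(\boldsymbol{Q}+\boldsymbol{\gamma})(\Lambda)$ (depending on $u$) is uniquely determined by $$\int_\Lambda \boldsymbol{D}^{\boldsymbol{\alpha}+\boldsymbol{\gamma}}(u-q)\,d\boldsymbol{X}=0\qquad\text{for all }\boldsymbol{\alpha}\in\boldsymbol{Q}.$$
   Context: $\Lambda\subset\mathbb{R}^2$ is a reference domain (bounded, connected, Lipschitz), $\hat M=\{\hat T_i\}_{i=1}^{\ell}$ is a triangulation of $\Lambda$ (the reference macro-element), and $S(\hat M)$ is a finite-dimensional linear space of functions on $\Lambda$ whose restriction to each $\hat T_i$ is a polynomial. Multi-index notation: $\boldsymbol{X}^{\boldsymbol{\alpha}}=x^{\alpha_1}y^{\alpha_2}$, $\boldsymbol{D}^{\boldsymbol{\alpha}}=\partial_x^{\alpha_1}\partial_y^{\alpha_2}$. For a finite set $\boldsymbol{P}$ of multi-indices: $\boldsymbol{P}(\Lambda)=\mathrm{span}\{\boldsymbol{X}^{\boldsymbol{\alpha}}:\boldsymbol{\alpha}\in\boldsymbol{P}\}$; $\boldsymbol{P}+\boldsymbol{\gamma}=\{\boldsymbol{\alpha}+\boldsymbol{\gamma}:\boldsymbol{\alpha}\in\boldsymbol{P}\}$; the hull is $\overline{\boldsymbol{P}}=\boldsymbol{P}\cup\{\boldsymbol{\alpha}+\boldsymbol{e}_i:\boldsymbol{\alpha}\in\boldsymbol{P},\ i=1,2\}$,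 with $\boldsymbol{e}_1,\boldsymbol{e}_2$ the canonical basis. The (semi-)norms are $$\|v\|_{\boldsymbol{P},p}^p=\sum_{\boldsymbol{\alpha}\in\boldsymbol{P}}\|\boldsymbol{D}^{\boldsymbol{\alpha}}v\|_{L_p(\Lambda)}^p,\qquad |v|_{\overline{\boldsymbol{P}},p}^p=\sum_{\boldsymbol{\alpha}\in\overline{\boldsymbol{P}}\setminus\boldsymbol{P}}\|\boldsymbol{D}^{\boldsymbol{\alpha}}v\|_{L_p(\Lambda)}^p$$ (obvious modification for $p=\infty$), and $H^{\boldsymbol{P}}_p(\Lambda)=\{v\in L^1(\Lambda):\|v\|_{\boldsymbol{P},p}<\infty\}$. With a shift, $\|v\|_{\boldsymbol{P}+\boldsymbol{\gamma},p}=\|\boldsymbol{D}^{\boldsymbol{\gamma}}v\|_{\boldsymbol{P},p}$, $|v|_{\overline{\boldsymbol{Q}}+\boldsymbol{\gamma},p}=|\boldsymbol{D}^{\boldsymbol{\gamma}}v|_{\overline{\boldsymbol{Q}},p}$, and $H_p^{\overline{\boldsymbol{Q}}+\boldsymbol{\gamma}}(\Lambda)$ is the space of $v\in L^1(\Lambda)$ with $\|\boldsymbol{D}^{\boldsymbol{\gamma}}v\|_{\overline{\boldsymbol{Q}},p}<\infty$. Precisely, each $F_i$ is a linear functional on the sum space $H^{\overline{\boldsymbol{Q}}}_p(\Lambda)+\boldsymbol{D}^{\boldsymbol{\gamma}}S(\hat M)$ whose restriction to $H^{\overline{\boldsymbol{Q}}}_p(\Lambda)$ is bounded with respect to $\|\cdot\|_{\overline{\boldsymbol{Q}},p}$.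 *)

theory Defs
  imports "HOL-Probability.Essential_Supremum" "HOL-Library.Function_Algebras"
begin

type_synonym plane = "real \<times> real"
type_synonym multi_index = "nat \<times> nat"

text \<open>Pointwise real vector space structure on functions; it makes \<open>subspace\<close>, \<open>span\<close> and \<open>dim\<close>
  available for spaces of functions and of distributions.\<close>

instantiation "fun" :: (type, real_vector) real_vector
begin

definition scaleR_fun_def: "c *\<^sub>R f = (\<lambda>x. c *\<^sub>R f x)"

instance
  by standard (simp_all add: scaleR_fun_def fun_eq_iff scaleR_add_right scaleR_add_left)

end

definition lin_on :: "'a::real_vector set \<Rightarrow> ('a \<Rightarrow> 'b::real_vector) \<Rightarrow> bool" where
  "lin_on V f \<longleftrightarrow> (\<forall>u\<in>V. \<forall>v\<in>V. \<forall>a b. f (a *\<^sub>R u + b *\<^sub>R v) = a *\<^sub>R f u + b *\<^sub>R f v)"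

definition finite_dim_subspace :: "'a::real_vector set \<Rightarrow> bool" where
  "finite_dim_subspace S \<longleftrightarrow> subspace S \<and> (\<exists>B. finite B \<and> S \<subseteq> span B)"


section \<open>Domains, triangulations, polynomials\<close>

text \<open>Locally, in suitable Cartesian coordinates \<open>R\<close>, the set is the strict epigraph of a Lipschitz
  function. At a boundary point the graph then necessarily passes through that point.\<close>

definition lipschitz_boundary :: "plane set \<Rightarrow> bool" where
  "lipschitz_boundary U \<longleftrightarrow>
     (\<forall>x0\<in>frontier U. \<exists>r>0. \<exists>R h L. orthogonal_transformation (R :: plane \<Rightarrow> plane)
        \<and> L-lipschitz_on UNIV (h :: real \<Rightarrow> real)
        \<and> (\<forall>x\<in>ball x0 r. x \<in> U \<longleftrightarrow> h (fst (R x)) < snd (R x)))"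

definition reference_domain :: "plane set \<Rightarrow> bool" where
  "reference_domain U \<longleftrightarrow>
     open U \<and> U \<noteq> {} \<and> bounded U \<and> connected U \<and> lipschitz_boundary U"

definition triangulates :: "plane set set \<Rightarrow> plane set \<Rightarrow> bool" where
  "triangulates M U \<longleftrightarrow>
     triangulation M \<and> (\<forall>T\<in>M. 2 simplex T) \<and> \<Union>M = closure U"

definition monom2 :: "multi_index \<Rightarrow> plane \<Rightarrow> real" where
  "monom2 \<alpha> = (\<lambda>x. fst x ^ fst \<alpha> * snd x ^ snd \<alpha>)"

definition polys :: "multi_index set \<Rightarrow> (plane \<Rightarrow> real) set" where
  "polys P = span (monom2 ` P)"

text \<open>Since functions are considered up to null sets where they enter Lebesgue spaces, and may jump
  across edges, the polynomial representation is only required inside each triangle.\<close>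

definition piecewise_poly :: "plane set set \<Rightarrow> (plane \<Rightarrow> real) \<Rightarrow> bool" where
  "piecewise_poly M s \<longleftrightarrow> (\<forall>T\<in>M. \<exists>q\<in>polys UNIV. \<forall>x\<in>interior T. s x = q x)"

definition idx_shift :: "multi_index set \<Rightarrow> multi_index \<Rightarrow> multi_index set" where
  "idx_shift P \<gamma> = (\<lambda>\<alpha>. \<alpha> + \<gamma>) ` P"

definition idx_hull :: "multi_index set \<Rightarrow> multi_index set" where
  "idx_hull P = P \<union> {\<alpha> + e | \<alpha> e. \<alpha> \<in> P \<and> e \<in> {(1, 0), (0, 1)}}"


section \<open>Classical and distributional derivatives\<close>

definition pd :: "plane \<Rightarrow> (plane \<Rightarrow> real) \<Rightarrow> plane \<Rightarrow> real" where
  "pd e f = (\<lambda>x. frechet_derivative f (at x) e)"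

definition pderivs :: "multi_index \<Rightarrow> (plane \<Rightarrow> real) \<Rightarrow> plane \<Rightarrow> real" where
  "pderivs \<alpha> f = (pd (1, 0) ^^ fst \<alpha>) ((pd (0, 1) ^^ snd \<alpha>) f)"

text \<open>Meant for open \<open>U\<close>; values outside \<open>U\<close> are irrelevant.\<close>

primrec Ck :: "nat \<Rightarrow> plane set \<Rightarrow> (plane \<Rightarrow> real) set" where
  "Ck 0 U = {f. continuous_on U f}"
| "Ck (Suc k) U = {f. f differentiable_on U \<and> pd (1, 0) f \<in> Ck k U \<and> pd (0, 1) f \<in> Ck k U}"

definition test_funs :: "plane set \<Rightarrow> (plane \<Rightarrow> real) set" where
  "test_funs U = {\<phi>. (\<forall>k. \<phi> \<in> Ck k UNIV)
     \<and> compact (closure {x. \<phi> x \<noteq> 0}) \<and> closure {x. \<phi> x \<noteq> 0} \<subseteq> U}"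

definition L1 :: "plane set \<Rightarrow> (plane \<Rightarrow> real) set" where
  "L1 U = {v. integrable (lebesgue_on U) v}"

text \<open>Distributions are represented by their values on test functions, with the value \<open>0\<close> on all
  other functions, so that equality of distributions is equality in HOL.\<close>

type_synonym distribution = "(plane \<Rightarrow> real) \<Rightarrow> real"

definition dist_of :: "plane set \<Rightarrow> (plane \<Rightarrow> real) \<Rightarrow> distribution" where
  "dist_of U v = (\<lambda>\<phi>. if \<phi> \<in> test_funs U then (\<integral>x. v x * \<phi> x \<partial>lebesgue_on U) else 0)"

definition wderiv :: "plane set \<Rightarrow> multi_index \<Rightarrow> distribution \<Rightarrow> distribution" where
  "wderiv U \<alpha> T =
     (\<lambda>\<phi>. if \<phi> \<in> test_funs U then (-1) ^ (fst \<alpha> + snd \<alpha>) * T (pderivs \<alpha> \<phi>) else 0)"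

text \<open>The derivative of an integrable function, in the sense of distributions.\<close>

definition Dw :: "plane set \<Rightarrow> multi_index \<Rightarrow> (plane \<Rightarrow> real) \<Rightarrow> distribution" where
  "Dw U \<alpha> v = wderiv U \<alpha> (dist_of U v)"

definition is_regular :: "plane set \<Rightarrow> distribution \<Rightarrow> bool" where
  "is_regular U T \<longleftrightarrow> (\<exists>g\<in>L1 U. T = dist_of U g)"

text \<open>The density of a regular distribution is unique up to null sets.\<close>

definition density_of :: "plane set \<Rightarrow> distribution \<Rightarrow> plane \<Rightarrow> real" where
  "density_of U T = (SOME g. g \<in> L1 U \<and> T = dist_of U g)"

definition integral_over :: "plane set \<Rightarrow> distribution \<Rightarrow> real" where
  "integral_over U T = (\<integral>x. density_of U T x \<partial>lebesgue_on U)"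


section \<open>Norms and Sobolev spaces\<close>

text \<open>Real power on \<open>[0,\<infinity>]\<close>, used for positive exponents only.\<close>

definition epow :: "ennreal \<Rightarrow> real \<Rightarrow> ennreal" where
  "epow x r = (if x = \<infinity> then \<infinity> else ennreal (enn2real x powr r))"

definition Lp_norm :: "plane set \<Rightarrow> ennreal \<Rightarrow> (plane \<Rightarrow> real) \<Rightarrow> ennreal" where
  "Lp_norm U p g =
     (if p = \<infinity> then esssup (lebesgue_on U) (\<lambda>x. ennreal \<bar>g x\<bar>)
      else epow (\<integral>\<^sup>+x. ennreal (\<bar>g x\<bar> powr enn2real p) \<partial>lebesgue_on U) (1 / enn2real p))"

text \<open>On a bounded set every element of \<open>L\<^sub>p\<close>, \<open>p \<ge> 1\<close>, is integrable; hence a distribution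
  that is not given by an integrable function has infinite norm.\<close>

definition Lp_dnorm :: "plane set \<Rightarrow> ennreal \<Rightarrow> distribution \<Rightarrow> ennreal" where
  "Lp_dnorm U p T = (if is_regular U T then Lp_norm U p (density_of U T) else \<infinity>)"

definition sob_norm :: "plane set \<Rightarrow> ennreal \<Rightarrow> multi_index set \<Rightarrow> distribution \<Rightarrow> ennreal" where
  "sob_norm U p P T =
     (if p = \<infinity> then (SUP \<alpha>\<in>P. Lp_dnorm U p (wderiv U \<alpha> T))
      else epow (\<Sum>\<alpha>\<in>P. epow (Lp_dnorm U p (wderiv U \<alpha> T)) (enn2real p)) (1 / enn2real p))"

text \<open>The seminorm belonging to the hull of \<open>P\<close>.\<close>

definition sob_seminorm :: "plane set \<Rightarrow> ennreal \<Rightarrow> multi_index set \<Rightarrow> distribution \<Rightarrow> ennreal" where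
  "sob_seminorm U p P T = sob_norm U p (idx_hull P - P) T"

text \<open>The shifted variants: the norm with index set \<open>P + \<gamma>\<close>, the seminorm belonging to the shifted
  hull of \<open>P\<close>, and the space with index set \<open>P + \<gamma>\<close>.\<close>

definition sh_norm :: "plane set \<Rightarrow> ennreal \<Rightarrow> multi_index set \<Rightarrow> multi_index \<Rightarrow> (plane \<Rightarrow> real) \<Rightarrow> ennreal" where
  "sh_norm U p P \<gamma> v = sob_norm U p P (Dw U \<gamma> v)"

definition sh_seminorm :: "plane set \<Rightarrow> ennreal \<Rightarrow> multi_index set \<Rightarrow> multi_index \<Rightarrow> (plane \<Rightarrow> real) \<Rightarrow> ennreal" where
  "sh_seminorm U p P \<gamma> v = sob_seminorm U p P (Dw U \<gamma> v)"

definition sob_space :: "plane set \<Rightarrow> ennreal \<Rightarrow> multi_index set \<Rightarrow> (plane \<Rightarrow> real) set" where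
  "sob_space U p P = {v \<in> L1 U. sob_norm U p P (dist_of U v) < \<infinity>}"

definition sh_space :: "plane set \<Rightarrow> ennreal \<Rightarrow> multi_index set \<Rightarrow> multi_index \<Rightarrow> (plane \<Rightarrow> real) set" where
  "sh_space U p P \<gamma> = {v \<in> L1 U. sh_norm U p P \<gamma> v < \<infinity>}"

text \<open>The sum of \<open>sob_space U p P\<close> and \<open>W\<close> inside the space of distributions.\<close>

definition sum_space :: "plane set \<Rightarrow> ennreal \<Rightarrow> multi_index set \<Rightarrow> distribution set \<Rightarrow> distribution set" where
  "sum_space U p P W = {dist_of U w + T | w T. w \<in> sob_space U p P \<and> T \<in> W}"

definition bounded_on_sob ::
    "plane set \<Rightarrow> ennreal \<Rightarrow> multi_index set \<Rightarrow> (distribution \<Rightarrow> real) \<Rightarrow> bool" where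
  "bounded_on_sob U p P F \<longleftrightarrow>
     (\<exists>K::real. \<forall>w\<in>sob_space U p P. ennreal \<bar>F (dist_of U w)\<bar> \<le> ennreal K * sob_norm U p P (dist_of U w))"

text \<open>The moment conditions which single out the polynomial \<open>q\<close> for a given \<open>u\<close>.\<close>

definition moment_poly ::
    "plane set \<Rightarrow> multi_index set \<Rightarrow> multi_index \<Rightarrow> (plane \<Rightarrow> real) \<Rightarrow> (plane \<Rightarrow> real) \<Rightarrow> bool" where
  "moment_poly U Q \<gamma> u q \<longleftrightarrow>
     q \<in> polys (idx_shift Q \<gamma>) \<and> (\<forall>\<alpha>\<in>Q. integral_over U (Dw U (\<alpha> + \<gamma>) (u - q)) = 0)"

end

theory Submission
  imports Defs
begin

text \<open>
  The error is split as \<open>u - I u = (u - q) + (q - I q) - I (u - q)\<close>. The middle term occurs on the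
  right-hand side of the estimate. The \<open>\<gamma>\<close>-derivative of the last term lies in \<open>D\<^sup>\<gamma> S\<close>, on which the
  functionals \<open>F i\<close> separate points; so it is a linear combination of finitely many fixed elements of
  \<open>D\<^sup>\<gamma> S\<close> with the coefficients \<open>F i (D\<^sup>\<gamma> I (u - q)) = F i (D\<^sup>\<gamma> (u - q))\<close>, and these are
  bounded by the norm of \<open>D\<^sup>\<gamma> (u - q)\<close> over the hull of \<open>Q\<close> (\<open>interpolated_part_estimate\<close>).
  Everything therefore rests on bounding that norm of \<open>D\<^sup>\<gamma> (u - q)\<close> by the seminorm of \<open>D\<^sup>\<gamma> u\<close>
  (\<open>moment_remainder_estimate\<close>).

  The obvious argument would be that the means of all \<open>D\<^sup>\<alpha>\<close>, \<open>\<alpha> \<in> Q\<close>, of \<open>D\<^sup>\<gamma> (u - q)\<close> vanish, so that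
  the Poincare inequality, used from the highest derivatives downwards, bounds the norm by the
  seminorm of \<open>D\<^sup>\<gamma> (u - q)\<close>. But this seminorm need not equal that of \<open>D\<^sup>\<gamma> u\<close>: for
  \<open>Q = {(0,0), (2,0)}\<close> and \<open>\<gamma> = 0\<close> the polynomial may contain \<open>x\<^sup>2\<close>, while the first derivatives
  belong to the seminorm. The remedy is to look at the indices \<open>\<alpha>\<close> of the hull which lie above some
  index \<open>\<delta>\<close> of the hull outside \<open>Q\<close> (the set \<open>shadow Q\<close>). For such \<open>\<alpha>\<close> the distribution
  \<open>D\<^sup>\<alpha> T\<close> is a derivative of \<open>D\<^sup>\<delta> T\<close>, so that its value at a fixed test function of integral 1 is
  controlled by the seminorm of \<open>T\<close>. With this value in the place of the mean, the Poincare inequality and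
  the same descent bound all derivatives in the shadow by the seminorm (\<open>shadow_estimate\<close>). The moment
  conditions are a triangular system, in which the coefficient of \<open>q\<close> at \<open>\<beta>\<close> depends on the moments
  at indices above \<open>\<beta>\<close> only; hence the coefficients in the shadow are bounded by the seminorm
  as well, and no other coefficients enter the derivatives of \<open>D\<^sup>\<gamma> q\<close> that belong to the seminorm.

  The Poincare inequality is proved for integrable functions with weak gradient in \<open>L\<^sub>p\<close>,
  \<open>1 \<le> p \<le> \<infinity>\<close>. By mollification, for almost all pairs of points joined by a segment in the domain, the
  difference of the values is at most the length of the segment times the average size of the gradient on it
  (\<open>segment_inequality\<close>). Integration over pairs \<open>(x, y)\<close>, with \<open>y\<close> in a fixed ball, yields the
  inequality on every set visible from a ball (\<open>poincare_on_visible\<close>). A domain with Lipschitz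
  boundary is covered by finitely many such sets (\<open>lipschitz_boundary_patch\<close>), and connectedness
  allows one to glue the pieces (\<open>poincare_on_finite_cover\<close>). Only the existence of constants matters, so
  triangle inequalities with a factor 2 are enough, and Minkowski's inequality is avoided.
\<close>


section \<open>Smooth functions and test functions\<close>

lemma pd_eq: "(f has_derivative f') (at x) \<Longrightarrow> pd e f x = f' e"
  unfolding pd_def using frechet_derivative_at by fastforce

text \<open>Smoothness is proved coinductively: it is enough to find a set of functions that is closed under both
  partial derivatives.\<close>

lemma Ck_coinduct:
  assumes "f \<in> A"
    and "\<And>f. f \<in> A \<Longrightarrow> f differentiable_on U \<and> pd (1,0) f \<in> A \<and> pd (0,1) f \<in> A"
  shows "f \<in> Ck k U"
  using assms(1)
proof (induction k arbitrary: f)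
  case 0
  then show ?case using assms(2) differentiable_imp_continuous_on by auto
next
  case (Suc k)
  then show ?case using assms(2) by auto
qed

lemma pd_add:
  assumes "f differentiable (at x)" "g differentiable (at x)"
  shows "pd e (f + g) x = pd e f x + pd e g x"
proof -
  have "((f + g) has_derivative (\<lambda>h. frechet_derivative f (at x) h + frechet_derivative g (at x) h)) (at x)"
    unfolding plus_fun_def
    using assms by (intro has_derivative_add) (auto simp: frechet_derivative_works)
  then show ?thesis by (subst pd_eq) (auto simp: pd_def)
qed

lemma pd_scaleR:
  assumes "f differentiable (at x)"
  shows "pd e (c *\<^sub>R f) x = c * pd e f x"
proof -
  have "((c *\<^sub>R f) has_derivative (\<lambda>h. c *\<^sub>R frechet_derivative f (at x) h)) (at x)"
    unfolding scaleR_fun_def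
    using assms by (intro has_derivative_scaleR_right) (auto simp: frechet_derivative_works)
  then show ?thesis by (subst pd_eq) (auto simp: pd_def)
qed

lemma pd_zero: "pd e 0 = 0"
proof
  fix x
  have "((0 :: plane \<Rightarrow> real) has_derivative (\<lambda>h. 0)) (at x)"
    by (simp add: zero_fun_def)
  then show "pd e 0 x = 0 x" by (subst pd_eq) auto
qed

lemma differentiable_add_fun:
  "f differentiable F \<Longrightarrow> g differentiable F \<Longrightarrow> (f + g :: plane \<Rightarrow> real) differentiable F"
  unfolding plus_fun_def by (rule differentiable_add)

lemma differentiable_scaleR_fun:
  "f differentiable F \<Longrightarrow> (c *\<^sub>R f :: plane \<Rightarrow> real) differentiable F"
  using has_derivative_scaleR_right unfolding scaleR_fun_def differentiable_def by blast

text \<open>Linear combinations make the coinduction work for families such as monomials, whose derivatives are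
  again combinations of members of the family.\<close>

lemma smooth_span:
  assumes G: "\<And>g x. g \<in> G \<Longrightarrow> g differentiable (at x)"
    and dx: "\<And>g. g \<in> G \<Longrightarrow> pd (1,0) g \<in> span G"
    and dy: "\<And>g. g \<in> G \<Longrightarrow> pd (0,1) g \<in> span G"
    and f: "f \<in> span G"
  shows "f \<in> Ck k U"
proof -
  have *: "(\<forall>x. f differentiable (at x)) \<and> pd (1,0) f \<in> span G \<and> pd (0,1) f \<in> span G"
    if "f \<in> span G" for f
    using that
  proof (induction rule: span_induct_alt)
    case base
    have "(0 :: plane \<Rightarrow> real) differentiable (at x)" for x
      by (simp add: zero_fun_def)
    then show ?case unfolding pd_zero using span_zero[of G] by blast
  next
    case (step c g h)
    have gd: "\<forall>x. g differentiable (at x)" using G step by auto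
    have "pd e (c *\<^sub>R g + h) = c *\<^sub>R pd e g + pd e h" for e
      using gd step(2) by (auto simp: fun_eq_iff pd_add differentiable_scaleR_fun pd_scaleR scaleR_fun_def[of c "pd e g"])
    then have pd: "pd e (c *\<^sub>R g + h) \<in> span G" if "pd e g \<in> span G" "pd e h \<in> span G" for e
      by (metis that span_add span_scale)
    have "(c *\<^sub>R g + h) differentiable (at x)" for x
      using gd step(2) differentiable_add_fun differentiable_scaleR_fun by blast
    then show ?case using pd dx[OF step(1)] dy[OF step(1)] step(2) by blast
  qed
  show ?thesis
    by (rule Ck_coinduct[OF f])
       (use * in \<open>auto simp: differentiable_on_def intro: differentiable_at_withinI\<close>)
qed

definition smooth :: "(plane \<Rightarrow> real) \<Rightarrow> bool" where
  "smooth f \<longleftrightarrow> (\<forall>k. f \<in> Ck k UNIV)"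

lemma smooth_pd:
  assumes "smooth f"
  shows "smooth (pd (1,0) f)" "smooth (pd (0,1) f)"
proof -
  have "f \<in> Ck (Suc k) UNIV" for k
    using assms unfolding smooth_def by blast
  then show "smooth (pd (1,0) f)" "smooth (pd (0,1) f)"
    unfolding smooth_def by simp_all
qed

lemma smooth_differentiable:
  assumes "smooth f"
  shows "f differentiable (at x)"
proof -
  have "f \<in> Ck (Suc 0) UNIV"
    using assms unfolding smooth_def by blast
  then show ?thesis by (cases x) (simp add: differentiable_on_def)
qed

lemma smooth_continuous:
  assumes "smooth f"
  shows "continuous_on UNIV f"
proof -
  have "f \<in> Ck 0 UNIV"
    using assms unfolding smooth_def by blast
  then show ?thesis by simp
qed

lemma smooth_funpow_pd:
  "smooth f \<Longrightarrow> smooth ((pd (1,0) ^^ n) f)" "smooth f \<Longrightarrow> smooth ((pd (0,1) ^^ n) f)"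
  by (induction n) (auto intro: smooth_pd)

lemma smooth_has_derivative:
  assumes "smooth f"
  shows "(f has_derivative (\<lambda>h. fst h * pd (1,0) f x + snd h * pd (0,1) f x)) (at x)"
proof -
  let ?D = "frechet_derivative f (at x)"
  have D: "(f has_derivative ?D) (at x)"
    using smooth_differentiable[OF assms] by (simp add: frechet_derivative_works)
  then interpret linear ?D by (rule has_derivative_linear)
  have "?D = (\<lambda>h. fst h * pd (1,0) f x + snd h * pd (0,1) f x)"
  proof
    fix h :: plane
    have "h = fst h *\<^sub>R (1,0) + snd h *\<^sub>R (0,1)" by (auto simp: prod_eq_iff)
    then have "?D h = ?D (fst h *\<^sub>R (1,0) + snd h *\<^sub>R (0,1))" by simp
    then show "?D h = fst h * pd (1,0) f x + snd h * pd (0,1) f x"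
      by (simp only: add scale pd_def real_scaleR_def)
  qed
  with D show ?thesis by simp
qed

lemma smooth_partial_x:
  assumes "smooth f"
  shows "((\<lambda>s. f (s, b)) has_real_derivative pd (1,0) f (a, b)) (at a within A)"
proof -
  have "((\<lambda>s. (s, b)) has_derivative (\<lambda>h. (h, 0))) (at a within A)"
    by (auto intro!: derivative_eq_intros)
  from has_derivative_compose[OF this smooth_has_derivative[OF assms]]
  show ?thesis by (simp add: has_field_derivative_def mult_commute_abs)
qed

lemma smooth_partial_y:
  assumes "smooth f"
  shows "((\<lambda>s. f (a, s)) has_real_derivative pd (0,1) f (a, b)) (at b within A)"
proof -
  have "((\<lambda>s. (a, s)) has_derivative (\<lambda>h. (0, h))) (at b within A)"
    by (auto intro!: derivative_eq_intros)
  from has_derivative_compose[OF this smooth_has_derivative[OF assms]]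
  show ?thesis by (simp add: has_field_derivative_def mult_commute_abs)
qed

text \<open>Symmetry of second derivatives: \<open>f\<close> is the integral of its \<open>y\<close>-derivative along vertical lines;
  differentiating under the integral sign in \<open>x\<close> and then in the upper limit \<open>y\<close> gives the claim.\<close>

lemma smooth_pd_commute:
  assumes f: "smooth f"
  shows "pd (1,0) (pd (0,1) f) = pd (0,1) (pd (1,0) f)"
proof
  fix p :: plane
  obtain a b where p: "p = (a, b)" by (cases p)
  let ?fy = "pd (0,1) f" and ?fx = "pd (1,0) f" and ?fyx = "pd (1,0) (pd (0,1) f)"
  note s = smooth_pd[OF f]
  have ftc: "f (x, y) = f (x, b - 1) + integral {b-1..y} (\<lambda>t. ?fy (x, t))" if "y \<ge> b - 1" for x y
  proof -
    have "((\<lambda>t. ?fy (x, t)) has_integral f (x, y) - f (x, b - 1)) {b-1..y}"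
      using that smooth_partial_y[OF f]
      by (intro fundamental_theorem_of_calculus)
         (auto simp: has_real_derivative_iff_has_vector_derivative[symmetric])
    then show ?thesis by (simp add: integral_unique)
  qed
  have fx: "?fx (a, y) = ?fx (a, b - 1) + integral {b-1..y} (\<lambda>t. ?fyx (a, t))" if "y \<ge> b - 1" for y
  proof -
    have "((\<lambda>x. integral (cbox (b-1) y) (\<lambda>t. ?fy (x, t))) has_field_derivative
        integral (cbox (b-1) y) (\<lambda>t. ?fyx (a, t))) (at a within UNIV)"
    proof (rule leibniz_rule_field_derivative)
      show "((\<lambda>x. ?fy (x, t)) has_field_derivative ?fyx (x, t)) (at x within UNIV)" for x t
        using smooth_partial_x[OF s(2)] by simp
      show "(\<lambda>t. ?fy (x, t)) integrable_on cbox (b-1) y" for x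
        by (intro integrable_continuous continuous_on_compose2[OF smooth_continuous[OF s(2)]] continuous_intros) auto
      show "continuous_on (UNIV \<times> cbox (b-1) y) (\<lambda>(x, t). ?fyx (x, t))"
        using smooth_continuous[OF smooth_pd(1)[OF s(2)]] by (auto intro: continuous_on_subset)
    qed auto
    then have "((\<lambda>x. f (x, b - 1) + integral (cbox (b-1) y) (\<lambda>t. ?fy (x, t))) has_field_derivative
        ?fx (a, b-1) + integral (cbox (b-1) y) (\<lambda>t. ?fyx (a, t))) (at a)"
      using smooth_partial_x[OF f] by (auto intro!: DERIV_add)
    moreover have "(\<lambda>x. f (x, b - 1) + integral (cbox (b-1) y) (\<lambda>t. ?fy (x, t))) = (\<lambda>x. f (x, y))"
      using ftc[OF that] by (auto simp: fun_eq_iff)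
    ultimately show ?thesis
      using smooth_partial_x[OF f, of y a UNIV] by (auto dest: DERIV_unique)
  qed
  have c: "continuous_on {b-1..b+1} (\<lambda>t. ?fyx (a, t))"
    by (intro continuous_on_compose2[OF smooth_continuous[OF smooth_pd(1)[OF s(2)]]] continuous_intros) auto
  have "((\<lambda>y. ?fx (a, b - 1) + integral {b-1..y} (\<lambda>t. ?fyx (a, t))) has_real_derivative ?fyx (a, b)) (at b within {b-1..b+1})"
    using DERIV_add[OF DERIV_const integral_has_real_derivative[OF c]] by simp
  then have "((\<lambda>y. ?fx (a, y)) has_real_derivative ?fyx (a, b)) (at b within {b-1..b+1})"
  proof (rule has_field_derivative_transform_within[of _ _ _ _ 1])
    show "?fx (a, b - 1) + integral {b-1..y} (\<lambda>t. ?fyx (a, t)) = ?fx (a, y)" if "y \<in> {b-1..b+1}" for y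
      by (rule fx[symmetric]) (use that in auto)
  qed auto
  then have "((\<lambda>y. ?fx (a, y)) has_real_derivative ?fyx (a, b)) (at b)"
    by (subst (asm) at_within_interior) auto
  then show "pd (1,0) (pd (0,1) f) p = pd (0,1) (pd (1,0) f) p"
    using smooth_partial_y[OF s(1), of a b UNIV] p by (auto dest: DERIV_unique)
qed

lemma smooth_pd_funpow_commute:
  assumes "smooth f"
  shows "(pd (0,1) ^^ m) ((pd (1,0) ^^ n) f) = (pd (1,0) ^^ n) ((pd (0,1) ^^ m) f)"
proof -
  have 1: "pd (0,1) ((pd (1,0) ^^ n) f) = (pd (1,0) ^^ n) (pd (0,1) f)" if "smooth f" for f
    using that
  proof (induction n)
    case (Suc n)
    then show ?case
      using smooth_pd_commute[OF smooth_funpow_pd(1)[OF Suc.prems, of n]] by simp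
  qed simp
  show ?thesis using assms
  proof (induction m)
    case (Suc m)
    then show ?case using 1[OF smooth_funpow_pd(2)[OF assms]] by simp
  qed simp
qed

lemma pderivs_pderivs:
  assumes "smooth f"
  shows "pderivs \<alpha> (pderivs \<beta> f) = pderivs (\<alpha> + \<beta>) f"
  using smooth_pd_funpow_commute[OF smooth_funpow_pd(2)[OF assms, of "snd \<beta>"], of "snd \<alpha>" "fst \<beta>"]
  by (simp add: pderivs_def funpow_add)

lemma smooth_pderivs: "smooth f \<Longrightarrow> smooth (pderivs \<alpha> f)"
  by (simp add: pderivs_def smooth_funpow_pd)

lemma test_funs_iff:
  "\<phi> \<in> test_funs U \<longleftrightarrow> smooth \<phi> \<and> compact (closure {x. \<phi> x \<noteq> 0}) \<and> closure {x. \<phi> x \<noteq> 0} \<subseteq> U"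
  by (auto simp: test_funs_def smooth_def)

lemma support_pd:
  fixes f :: "plane \<Rightarrow> real"
  shows "closure {x. pd e f x \<noteq> 0} \<subseteq> closure {x. f x \<noteq> 0}"
proof (rule closure_minimal)
  have "pd e f x = 0" if x: "x \<notin> closure {x. f x \<noteq> 0}" for x
  proof -
    have "((\<lambda>_. 0) has_derivative (\<lambda>h. 0)) (at x)" by simp
    then have "(f has_derivative (\<lambda>h. 0)) (at x)"
    proof (rule has_derivative_transform_within_open)
      show "open (- closure {x. f x \<noteq> 0})" by (intro open_Compl closed_closure)
      show "0 = f z" if "z \<in> - closure {x. f x \<noteq> 0}" for z
        using that closure_subset[of "{x. f x \<noteq> 0}"] by (metis (mono_tags, lifting) ComplD mem_Collect_eq subsetD)
    qed (use x in simp)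
    then show ?thesis by (rule pd_eq)
  qed
  then show "{x. pd e f x \<noteq> 0} \<subseteq> closure {x. f x \<noteq> 0}" by blast
qed simp

lemma compact_support_pd:
  fixes f :: "plane \<Rightarrow> real"
  shows
  "compact (closure {x. f x \<noteq> 0}) \<Longrightarrow> compact (closure {x. pd e f x \<noteq> 0})"
  by (metis support_pd bounded_subset closed_closure compact_eq_bounded_closed)

lemma test_funs_pd:
  assumes "\<phi> \<in> test_funs U"
  shows "pd (1,0) \<phi> \<in> test_funs U" "pd (0,1) \<phi> \<in> test_funs U"
  using assms compact_support_pd smooth_pd subset_trans[OF support_pd]
  unfolding test_funs_iff by blast+

lemma test_funs_pderivs: "\<phi> \<in> test_funs U \<Longrightarrow> pderivs \<alpha> \<phi> \<in> test_funs U"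
proof -
  have "(pd (1,0) ^^ n) \<psi> \<in> test_funs U" "(pd (0,1) ^^ n) \<psi> \<in> test_funs U" if "\<psi> \<in> test_funs U" for n \<psi>
    using that by (induction n) (auto intro: test_funs_pd)
  then show "\<phi> \<in> test_funs U \<Longrightarrow> pderivs \<alpha> \<phi> \<in> test_funs U" by (simp add: pderivs_def)
qed

lemma test_funs_outside:
  assumes "\<phi> \<in> test_funs U" "x \<notin> U"
  shows "\<phi> x = 0"
  using assms closure_subset[of "{x. \<phi> x \<noteq> 0}"] unfolding test_funs_iff by blast

lemma test_funs_bounded:
  assumes "\<phi> \<in> test_funs U"
  obtains B where "B \<ge> 0" "\<And>x. \<bar>\<phi> x\<bar> \<le> B"
proof -
  let ?K = "closure {x. \<phi> x \<noteq> 0}"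
  have "compact ?K" "continuous_on ?K \<phi>"
    using assms smooth_continuous continuous_on_subset unfolding test_funs_iff by blast+
  then have "bounded (\<phi> ` ?K)"
    by (intro compact_imp_bounded compact_continuous_image)
  then obtain B where B: "\<And>x. x \<in> ?K \<Longrightarrow> \<bar>\<phi> x\<bar> \<le> B"
    unfolding bounded_iff by fastforce
  have "\<bar>\<phi> x\<bar> \<le> max B 0" for x
  proof (cases "\<phi> x = 0")
    case False
    then have "x \<in> ?K" using closure_subset[of "{x. \<phi> x \<noteq> 0}"] by blast
    then show ?thesis using B[of x] by simp
  qed auto
  then show ?thesis by (rule that[rotated]) auto
qed

lemma test_funs_measurable [measurable_dest]: "\<phi> \<in> test_funs U \<Longrightarrow> \<phi> \<in> borel_measurable borel"
  by (auto simp: test_funs_iff intro!: borel_measurable_continuous_onI smooth_continuous)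


section \<open>Mollifiers\<close>

lemma pd_translate:
  assumes "smooth f"
  shows "pd (1,0) (\<lambda>w. f (w - z)) = (\<lambda>w. pd (1,0) f (w - z))"
    and "pd (0,1) (\<lambda>w. f (w - z)) = (\<lambda>w. pd (0,1) f (w - z))"
    and "(\<lambda>w. f (w - z)) differentiable (at x)"
proof -
  have d: "((\<lambda>w. f (w - z)) has_derivative
      (\<lambda>h. fst h * pd (1,0) f (x - z) + snd h * pd (0,1) f (x - z))) (at x)" for x
    by (rule has_derivative_compose[OF _ smooth_has_derivative[OF assms]])
       (auto intro!: derivative_eq_intros)
  then show "pd (1,0) (\<lambda>w. f (w - z)) = (\<lambda>w. pd (1,0) f (w - z))"
    "pd (0,1) (\<lambda>w. f (w - z)) = (\<lambda>w. pd (0,1) f (w - z))"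
    using pd_eq[OF d] by (simp_all add: fun_eq_iff)
  show "(\<lambda>w. f (w - z)) differentiable (at x)"
    using d unfolding differentiable_def by blast
qed

lemma smooth_translate:
  assumes "smooth f"
  shows "smooth (\<lambda>w. f (w - z))"
  unfolding smooth_def
proof
  fix k
  show "(\<lambda>w. f (w - z)) \<in> Ck k UNIV"
  proof (rule Ck_coinduct[of _ "{\<lambda>w. g (w - z) | g. smooth g}"])
    fix f assume "f \<in> {\<lambda>w. g (w - z) | g. smooth g}"
    then obtain g where g: "f = (\<lambda>w. g (w - z))" "smooth g" by blast
    show "f differentiable_on UNIV \<and> pd (1,0) f \<in> {\<lambda>w. g (w - z) | g. smooth g}
        \<and> pd (0,1) f \<in> {\<lambda>w. g (w - z) | g. smooth g}"
      unfolding g(1) pd_translate(1,2)[OF g(2)] differentiable_on_def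
      using pd_translate(3)[OF g(2)] smooth_pd[OF g(2)] by blast
  qed (use assms in blast)
qed

text \<open>The functions \<open>s\<^sup>-\<^sup>n exp (-1/s)\<close>, extended by 0 to \<open>s \<le> 0\<close>; they are closed under differentiation up to
  linear combinations, which is why all \<open>n\<close> are considered together.\<close>

definition flat :: "nat \<Rightarrow> real \<Rightarrow> real" where
  "flat n s = (if s > 0 then (1 / s) ^ n * exp (- (1 / s)) else 0)"

lemma flat_tendsto_0: "(flat n \<longlongrightarrow> 0) (at 0)"
proof (rule filterlim_split_at)
  show "(flat n \<longlongrightarrow> 0) (at_left 0)"
    by (rule tendsto_eventually)
       (auto simp: flat_def eventually_at_left_field intro!: exI[of _ "-1"])
  have "((\<lambda>x::real. x ^ n / exp x) \<longlongrightarrow> 0) at_top" by (rule tendsto_power_div_exp_0)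
  from filterlim_compose[OF this filterlim_inverse_at_top_right]
  have "((\<lambda>s::real. inverse s ^ n / exp (inverse s)) \<longlongrightarrow> 0) (at_right 0)" .
  moreover have "eventually (\<lambda>s. inverse s ^ n / exp (inverse s) = flat n s) (at_right 0)"
    by (auto simp: eventually_at_right_field flat_def exp_minus divide_simps intro!: exI[of _ 1])
  ultimately show "(flat n \<longlongrightarrow> 0) (at_right 0)"
    by (rule Lim_transform_eventually)
qed

lemma flat_has_derivative:
  "(flat n has_real_derivative flat (n + 2) s - real n * flat (n + 1) s) (at s)"
proof -
  consider "s > 0" | "s < 0" | "s = 0" by linarith
  then show ?thesis
  proof cases
    case 1
    have inv: "((\<lambda>s. 1 / s) has_real_derivative - ((1 / s)\<^sup>2)) (at s)"
      using 1 by (auto intro!: derivative_eq_intros simp: power2_eq_square)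
    have "((\<lambda>r. r ^ n * exp (- r)) has_real_derivative
        real n * r ^ (n - 1) * exp (- r) - r ^ n * exp (- r)) (at r)" for r :: real
      by (auto intro!: derivative_eq_intros)
    note d = DERIV_chain2[OF this inv]
    have "(real n * r ^ (n - 1) * exp (- r) - r ^ n * exp (- r)) * - (r\<^sup>2)
        = r ^ (n + 2) * exp (- r) - real n * (r ^ (n + 1) * exp (- r))" for r :: real
      by (cases n) (simp_all add: algebra_simps power2_eq_square)
    with d have "((\<lambda>s. (1 / s) ^ n * exp (- (1 / s))) has_real_derivative
        flat (n + 2) s - real n * flat (n + 1) s) (at s)"
      using 1 by (simp add: flat_def)
    then show ?thesis
      by (rule has_field_derivative_transform_within_open[of _ _ _ "{0<..}"])
         (use 1 in \<open>auto simp: flat_def\<close>)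
  next
    case 2
    have "((\<lambda>s. 0) has_real_derivative flat (n + 2) s - real n * flat (n + 1) s) (at s)"
      using 2 by (simp add: flat_def)
    then show ?thesis
      by (rule has_field_derivative_transform_within_open[of _ _ _ "{..<0}"])
         (use 2 in \<open>auto simp: flat_def\<close>)
  next
    case 3
    have "((\<lambda>h. (flat n (0 + h) - flat n 0) / h) \<longlongrightarrow> 0) (at 0)"
      by (rule Lim_transform_eventually[OF flat_tendsto_0[of "n + 1"]])
         (auto simp: eventually_at flat_def intro!: exI[of _ 1])
    then show ?thesis using 3 by (simp add: DERIV_def flat_def)
  qed
qed

definition bump1 :: "real \<Rightarrow> nat \<Rightarrow> nat \<Rightarrow> real \<Rightarrow> real" where
  "bump1 e a b s = flat a (e + s) * flat b (e - s)"

lemma bump1_has_derivative: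
  "(bump1 e a b has_real_derivative
     bump1 e (a + 2) b s - real a * bump1 e (a + 1) b s
     - bump1 e a (b + 2) s + real b * bump1 e a (b + 1) s) (at s)"
proof -
  have 1: "((\<lambda>s. flat a (e + s)) has_real_derivative
      (flat (a + 2) (e + s) - real a * flat (a + 1) (e + s)) * 1) (at s)"
    by (rule DERIV_chain2[OF flat_has_derivative]) (auto intro!: derivative_eq_intros)
  have 2: "((\<lambda>s. flat b (e - s)) has_real_derivative
      (flat (b + 2) (e - s) - real b * flat (b + 1) (e - s)) * (-1)) (at s)"
    by (rule DERIV_chain2[OF flat_has_derivative]) (auto intro!: derivative_eq_intros)
  show ?thesis
    using DERIV_mult[OF 1 2] unfolding bump1_def[abs_def] by (simp add: algebra_simps)
qed

definition bump2 :: "real \<Rightarrow> nat \<Rightarrow> nat \<Rightarrow> nat \<Rightarrow> nat \<Rightarrow> plane \<Rightarrow> real" where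
  "bump2 e a b c d z = bump1 e a b (fst z) * bump1 e c d (snd z)"

definition bump2s :: "real \<Rightarrow> (plane \<Rightarrow> real) set" where
  "bump2s e = {bump2 e a b c d | a b c d. True}"

lemma has_derivative_product:
  fixes f g :: "real \<Rightarrow> real"
  assumes "(f has_real_derivative f') (at (fst z))" "(g has_real_derivative g') (at (snd z))"
  shows "((\<lambda>z. f (fst z) * g (snd z)) has_derivative
    (\<lambda>h. fst h * (f' * g (snd z)) + snd h * (f (fst z) * g'))) (at z)"
proof -
  have 1: "((\<lambda>z. f (fst z)) has_derivative (\<lambda>h. f' * fst h)) (at z)"
    using has_derivative_compose[OF has_derivative_fst[OF has_derivative_ident]] assms(1)
    unfolding has_field_derivative_def by blast
  have 2: "((\<lambda>z. g (snd z)) has_derivative (\<lambda>h. g' * snd h)) (at z)"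
    using has_derivative_compose[OF has_derivative_snd[OF has_derivative_ident]] assms(2)
    unfolding has_field_derivative_def by blast
  show ?thesis
    using has_derivative_mult[OF 1 2] by (simp add: algebra_simps)
qed

lemma smooth_bump2: "smooth (bump2 e a b c d)"
  unfolding smooth_def
proof
  fix k
  let ?G = "bump2s e"
  have mem: "bump2 e a b c d \<in> span ?G" for a b c d
    by (rule span_base) (auto simp: bump2s_def)
  have d: "(bump2 e a b c d has_derivative
      (\<lambda>h. fst h * ((bump1 e (a + 2) b (fst z) - real a * bump1 e (a + 1) b (fst z)
     - bump1 e a (b + 2) (fst z) + real b * bump1 e a (b + 1) (fst z)) * bump1 e c d (snd z))
      + snd h * (bump1 e a b (fst z) * (bump1 e (c + 2) d (snd z) - real c * bump1 e (c + 1) d (snd z)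
     - bump1 e c (d + 2) (snd z) + real d * bump1 e c (d + 1) (snd z))))) (at z)" for a b c d z
    unfolding bump2_def[abs_def] by (rule has_derivative_product[OF bump1_has_derivative bump1_has_derivative])
  have x: "pd (1,0) (bump2 e a b c d) = bump2 e (a + 2) b c d - real a *\<^sub>R bump2 e (a + 1) b c d
     - bump2 e a (b + 2) c d + real b *\<^sub>R bump2 e a (b + 1) c d" for a b c d
    by (rule ext, subst pd_eq[OF d]) (simp add: scaleR_fun_def bump2_def algebra_simps)
  have y: "pd (0,1) (bump2 e a b c d) = bump2 e a b (c + 2) d - real c *\<^sub>R bump2 e a b (c + 1) d
     - bump2 e a b c (d + 2) + real d *\<^sub>R bump2 e a b c (d + 1)" for a b c d
    by (rule ext, subst pd_eq[OF d]) (simp add: scaleR_fun_def bump2_def algebra_simps)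
  show "bump2 e a b c d \<in> Ck k UNIV"
  proof (rule smooth_span[of ?G])
    fix g assume "g \<in> ?G"
    then obtain a b c d where g: "g = bump2 e a b c d" by (auto simp: bump2s_def)
    show "g differentiable at x" for x
      unfolding g differentiable_def using d by blast
    show "pd (1,0) g \<in> span ?G" "pd (0,1) g \<in> span ?G"
      unfolding g x y by (intro span_add span_diff span_scale mem)+
  qed (rule mem)
qed

lemma smooth_scaleR:
  assumes "smooth f"
  shows "smooth (\<lambda>x. c * f x)"
  unfolding smooth_def
proof
  fix k
  have pd: "pd e (\<lambda>x. c * g x) = (\<lambda>x. c * pd e g x)" if "smooth g" for e g
    using pd_scaleR[OF smooth_differentiable[OF that], of e c] by (simp add: fun_eq_iff scaleR_fun_def)
  show "(\<lambda>x. c * f x) \<in> Ck k UNIV"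
  proof (rule Ck_coinduct[of _ "{\<lambda>x. c * g x | g. smooth g}"])
    fix f assume "f \<in> {\<lambda>x. c * g x | g. smooth g}"
    then obtain g where g: "f = (\<lambda>x. c * g x)" "smooth g" by blast
    have "f differentiable (at x)" for x
      using differentiable_scaleR_fun[OF smooth_differentiable[OF g(2)], of c]
      unfolding g(1) scaleR_fun_def by simp
    then show "f differentiable_on UNIV \<and> pd (1,0) f \<in> {\<lambda>x. c * g x | g. smooth g}
        \<and> pd (0,1) f \<in> {\<lambda>x. c * g x | g. smooth g}"
      unfolding differentiable_on_def using smooth_pd[OF g(2)] pd[OF g(2)] g(1) by blast
  qed (use assms in blast)
qed

lemma test_funs_integrable:
  assumes "\<phi> \<in> test_funs U"
  shows "integrable lborel \<phi>"
proof -
  let ?K = "closure {x. \<phi> x \<noteq> 0}"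
  have "compact ?K" "continuous_on ?K \<phi>"
    using assms smooth_continuous continuous_on_subset unfolding test_funs_iff by blast+
  then have "integrable lborel (\<lambda>x. indicator ?K x *\<^sub>R \<phi> x)"
    by (rule borel_integrable_compact)
  moreover have "(\<lambda>x. indicator ?K x *\<^sub>R \<phi> x) = \<phi>"
  proof
    show "indicator ?K x *\<^sub>R \<phi> x = \<phi> x" for x
      using closure_subset[of "{x. \<phi> x \<noteq> 0}"] by (cases "\<phi> x = 0") (auto simp: indicator_def)
  qed
  ultimately show ?thesis by simp
qed

lemma integrable_mult_bounded:
  fixes f h :: "'a \<Rightarrow> real"
  assumes "integrable M f" "h \<in> borel_measurable M" "\<And>x. \<bar>h x\<bar> \<le> B"
  shows "integrable M (\<lambda>x. f x * h x)"
proof (rule Bochner_Integration.integrable_bound)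
  show "integrable M (\<lambda>x. B * f x)" using assms(1) by simp
  have "\<bar>f x\<bar> * \<bar>h x\<bar> \<le> \<bar>B * f x\<bar>" for x
  proof -
    have "\<bar>f x\<bar> * \<bar>h x\<bar> \<le> \<bar>f x\<bar> * \<bar>B\<bar>" using assms(3)[of x] by (intro mult_left_mono) auto
    then show ?thesis by (simp add: abs_mult mult.commute)
  qed
  then show "AE x in M. norm (f x * h x) \<le> norm (B * f x)" by (simp add: abs_mult)
  show "(\<lambda>x. f x * h x) \<in> borel_measurable M" using assms(1,2) by measurable
qed

lemma integrable_mult_test:
  assumes "integrable lborel f" "\<phi> \<in> test_funs U"
  shows "integrable lborel (\<lambda>x. f x * \<phi> x)"
proof -
  obtain B where B: "\<And>x. \<bar>\<phi> x\<bar> \<le> B"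
    using test_funs_bounded[OF assms(2)] by blast
  have "\<phi> \<in> borel_measurable lborel"
    using test_funs_measurable[OF assms(2)] by simp
  then show ?thesis
    by (rule integrable_mult_bounded[OF assms(1) _ B])
qed

text \<open>The side length of the supporting square is \<open>e\<close>, so that the support lies in the disc of radius \<open>e\<close>.\<close>

definition bump :: "real \<Rightarrow> plane \<Rightarrow> real" where
  "bump e = bump2 (e/2) 0 0 0 0"

lemma bump_nonneg: "bump e z \<ge> 0"
  by (simp add: bump_def bump2_def bump1_def flat_def)

lemma bump_support: "bump e z \<noteq> 0 \<Longrightarrow> norm z < e"
  using norm_Pair_le[of "fst z" "snd z"]
  by (auto simp: bump_def bump2_def bump1_def flat_def split: if_splits)

lemma bump_pos: "\<bar>fst z\<bar> < e/2 \<Longrightarrow> \<bar>snd z\<bar> < e/2 \<Longrightarrow> bump e z > 0"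
  by (auto simp: bump_def bump2_def bump1_def flat_def)

lemma bump_translate_test:
  assumes "cball z e \<subseteq> U"
  shows "(\<lambda>w. c * bump e (w - z)) \<in> test_funs U"
proof -
  let ?f = "\<lambda>w. c * bump e (w - z)"
  have sub: "closure {w. ?f w \<noteq> 0} \<subseteq> cball z e"
  proof (rule closure_minimal)
    show "{w. ?f w \<noteq> 0} \<subseteq> cball z e"
    proof
      fix w assume "w \<in> {w. ?f w \<noteq> 0}"
      then have "bump e (w - z) \<noteq> 0" by simp
      then show "w \<in> cball z e"
        using bump_support[of e "w - z"] by (simp add: dist_norm norm_minus_commute)
    qed
  qed simp
  have "smooth ?f"
    unfolding bump_def by (intro smooth_scaleR smooth_translate smooth_bump2)
  then show ?thesis
    using sub assms bounded_subset[OF bounded_cball sub] unfolding test_funs_iff compact_eq_bounded_closed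
    by blast
qed

lemma bump_integrable: "integrable lborel (bump e)"
  using test_funs_integrable[OF bump_translate_test[of 0 e UNIV 1]] by simp

lemma bump_integral_pos:
  assumes "e > 0"
  shows "integral\<^sup>L lborel (bump e) > 0"
proof -
  have ge: "integral\<^sup>L lborel (bump e) \<ge> 0"
    by (rule integral_nonneg_AE) (simp add: bump_nonneg)
  have "integral\<^sup>L lborel (bump e) \<noteq> 0"
  proof
    assume "integral\<^sup>L lborel (bump e) = 0"
    then have ae: "AE z in lborel. bump e z = 0"
      using integral_nonneg_eq_0_iff_AE[OF bump_integrable] bump_nonneg by simp
    have nz: "bump e z \<noteq> 0" if "z \<in> ball 0 (e/2)" for z
    proof -
      have "\<bar>fst z\<bar> \<le> norm z" "\<bar>snd z\<bar> \<le> norm z"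
        using norm_fst_le[of "fst z" "snd z"] norm_snd_le[of "snd z" "fst z"] by auto
      then show ?thesis using that bump_pos[of z e] by auto
    qed
    have "AE z in lborel. z \<notin> ball (0::plane) (e/2)"
      using ae by eventually_elim (use nz in blast)
    then have "ball (0::plane) (e/2) \<in> null_sets lborel"
      by (subst (asm) AE_iff_null_sets[symmetric]) auto
    then have "negligible (ball (0::plane) (e/2))"
      by (simp add: negligible_iff_null_sets null_sets_completionI)
    then show False using open_not_negligible[of "ball (0::plane) (e/2)"] assms by auto
  qed
  with ge show ?thesis by simp
qed

definition moll :: "real \<Rightarrow> plane \<Rightarrow> real" where
  "moll e z = inverse (integral\<^sup>L lborel (bump e)) * bump e z"

lemma moll_test: "cball z e \<subseteq> U \<Longrightarrow> (\<lambda>w. moll e (w - z)) \<in> test_funs U"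
  unfolding moll_def by (rule bump_translate_test)

lemma moll_smooth: "smooth (moll e)"
  unfolding moll_def[abs_def] bump_def by (intro smooth_scaleR smooth_bump2)

lemma moll_nonneg: "moll e z \<ge> 0"
  unfolding moll_def by (intro mult_nonneg_nonneg bump_nonneg) (simp add: integral_nonneg_AE bump_nonneg)

lemma moll_support: "moll e z \<noteq> 0 \<Longrightarrow> norm z < e"
  unfolding moll_def using bump_support by auto

lemma moll_measurable [measurable]: "moll e \<in> borel_measurable borel"
  by (intro borel_measurable_continuous_onI smooth_continuous moll_smooth)

lemma moll_integral: "e > 0 \<Longrightarrow> integral\<^sup>L lborel (moll e) = 1" "integrable lborel (moll e)"
  using bump_integral_pos[of e] bump_integrable[of e] by (auto simp: moll_def[abs_def])


section \<open>Mollification converges in the mean\<close>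

lemma tendsto_ennreal_0I:
  fixes a :: "nat \<Rightarrow> ennreal"
  assumes "\<And>e::real. e > 0 \<Longrightarrow> eventually (\<lambda>n. a n \<le> ennreal e) sequentially"
  shows "a \<longlonglongrightarrow> 0"
proof (rule order_tendstoI)
  fix b :: ennreal assume "0 < b"
  then obtain c where c: "0 < c" "c < b" using dense by blast
  then have "c < top" using less_top_ennreal order_less_le_trans top_greatest by blast
  then have "c = ennreal (enn2real c)" "enn2real c > 0"
    using c by (auto simp: enn2real_positive_iff)
  then have "eventually (\<lambda>n. a n \<le> c) sequentially" using assms[of "enn2real c"] by simp
  then show "eventually (\<lambda>n. a n < b) sequentially"
    by (rule eventually_mono) (use c in auto)
qed auto

lemma nn_integral_translate:
  fixes c :: "'a::euclidean_space"
  assumes [measurable]: "f \<in> borel_measurable borel"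
  shows "(\<integral>\<^sup>+x. f (x + c) \<partial>lborel) = (\<integral>\<^sup>+x. f x \<partial>lborel)"
proof -
  have "(\<integral>\<^sup>+x. f x \<partial>lborel) = (\<integral>\<^sup>+x. f x \<partial>distr lborel borel ((+) c))"
    by (simp add: lborel_distr_plus)
  also have "\<dots> = (\<integral>\<^sup>+x. f (x + c) \<partial>lborel)"
    by (subst nn_integral_distr) (auto simp: add.commute)
  finally show ?thesis by simp
qed

lemma integral_translate:
  fixes c :: "'a::euclidean_space" and f :: "'a \<Rightarrow> real"
  assumes [measurable]: "f \<in> borel_measurable borel"
  shows "(\<integral>x. f (x + c) \<partial>lborel) = (\<integral>x. f x \<partial>lborel)"
proof -
  have "(\<integral>x. f x \<partial>lborel) = (\<integral>x. f x \<partial>distr lborel borel ((+) c))"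
    by (simp add: lborel_distr_plus)
  also have "\<dots> = (\<integral>x. f (x + c) \<partial>lborel)"
    by (subst integral_distr) (auto simp: add.commute)
  finally show ?thesis by simp
qed

text \<open>The mean modulus of continuity of \<open>f\<close> with respect to translation by \<open>w\<close>.\<close>

definition shift_diff :: "('a::euclidean_space \<Rightarrow> real) \<Rightarrow> 'a \<Rightarrow> ennreal" where
  "shift_diff f w = (\<integral>\<^sup>+x. ennreal \<bar>f (x + w) - f x\<bar> \<partial>lborel)"

definition shift_cont :: "('a::euclidean_space \<Rightarrow> real) \<Rightarrow> bool" where
  "shift_cont f \<longleftrightarrow> (\<forall>w. w \<longlonglongrightarrow> 0 \<longrightarrow> (\<lambda>n. shift_diff f (w n)) \<longlonglongrightarrow> 0)"

lemma shift_diff_approx: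
  assumes [measurable]: "f \<in> borel_measurable borel" "g \<in> borel_measurable borel"
  shows "shift_diff f w \<le> shift_diff g w + 2 * (\<integral>\<^sup>+x. ennreal \<bar>f x - g x\<bar> \<partial>lborel)"
proof -
  have "shift_diff f w \<le> (\<integral>\<^sup>+x. ennreal \<bar>g (x + w) - g x\<bar> + (ennreal \<bar>f (x + w) - g (x + w)\<bar>
      + ennreal \<bar>f x - g x\<bar>) \<partial>lborel)"
    unfolding shift_diff_def
    by (intro nn_integral_mono) (auto simp flip: ennreal_plus intro!: ennreal_leI)
  also have "\<dots> = shift_diff g w + ((\<integral>\<^sup>+x. ennreal \<bar>f (x + w) - g (x + w)\<bar> \<partial>lborel)
      + (\<integral>\<^sup>+x. ennreal \<bar>f x - g x\<bar> \<partial>lborel))"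
    unfolding shift_diff_def by (subst nn_integral_add nn_integral_add; simp)+
  also have "(\<integral>\<^sup>+x. ennreal \<bar>f (x + w) - g (x + w)\<bar> \<partial>lborel) = (\<integral>\<^sup>+x. ennreal \<bar>f x - g x\<bar> \<partial>lborel)"
    by (rule nn_integral_translate[of "\<lambda>x. ennreal \<bar>f x - g x\<bar>"]) simp
  finally show ?thesis by (simp add: mult_2)
qed

lemma shift_cont_approx:
  assumes [measurable]: "f \<in> borel_measurable borel"
    and "\<And>e::real. e > 0 \<Longrightarrow> \<exists>g\<in>borel_measurable borel. shift_cont g
           \<and> (\<integral>\<^sup>+x. ennreal \<bar>f x - g x\<bar> \<partial>lborel) \<le> ennreal e"
  shows "shift_cont f"
  unfolding shift_cont_def
proof (intro allI impI tendsto_ennreal_0I)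
  fix w :: "nat \<Rightarrow> 'a" and e :: real assume w: "w \<longlonglongrightarrow> 0" and e: "e > 0"
  obtain g where g: "g \<in> borel_measurable borel" "shift_cont g"
    "(\<integral>\<^sup>+x. ennreal \<bar>f x - g x\<bar> \<partial>lborel) \<le> ennreal (e/4)"
    using assms(2)[of "e/4"] e by auto
  have "eventually (\<lambda>n. shift_diff g (w n) < ennreal (e/2)) sequentially"
    using g(2) w e unfolding shift_cont_def by (intro order_tendstoD) auto
  then show "eventually (\<lambda>n. shift_diff f (w n) \<le> ennreal e) sequentially"
  proof eventually_elim
    case (elim n)
    have "shift_diff f (w n) \<le> shift_diff g (w n) + 2 * (\<integral>\<^sup>+x. ennreal \<bar>f x - g x\<bar> \<partial>lborel)"
      by (rule shift_diff_approx) (use g in auto)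
    also have "\<dots> \<le> ennreal (e/2) + 2 * ennreal (e/4)"
      using elim g(3) by (intro add_mono mult_left_mono) auto
    also have "\<dots> = ennreal e"
    proof -
      have "2 * ennreal (e/4) = ennreal (e/2)" using ennreal_mult[of 2 "e/4"] e by simp
      then show ?thesis using e by (simp flip: ennreal_plus)
    qed
    finally show ?case .
  qed
qed

text \<open>Where \<open>x\<close> lies in the open set, so does \<open>x + w n\<close> eventually; dominated convergence then handles the
  points that leave the set, and a translation those that enter it.\<close>

lemma shift_cont_open:
  fixes O1 :: "'a::euclidean_space set"
  assumes O1: "open O1" and fin: "emeasure lborel O1 < \<infinity>"
  shows "shift_cont (indicator O1)"
  unfolding shift_cont_def
proof (intro allI impI)
  have [measurable]: "O1 \<in> sets borel" using O1 by simp
  have lim: "(\<lambda>n. \<integral>\<^sup>+x. norm (indicator O1 x - indicator O1 x * indicator O1 (x + w n) :: real) \<partial>lborel) \<longlonglongrightarrow> 0"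
    if w: "w \<longlonglongrightarrow> 0" for w
  proof (rule nn_integral_dominated_convergence_norm[where w="indicator O1"])
    show "(\<integral>\<^sup>+ x. ennreal (indicator O1 x) \<partial>lborel) < \<infinity>"
      using fin by (simp add: ennreal_indicator)
    show "AE x in lborel. (\<lambda>n. indicator O1 x * indicator O1 (x + w n)) \<longlonglongrightarrow> (indicator O1 x :: real)"
    proof (rule AE_I2)
      fix x
      show "(\<lambda>n. indicator O1 x * indicator O1 (x + w n)) \<longlonglongrightarrow> (indicator O1 x :: real)"
      proof (cases "x \<in> O1")
        case True
        have "(\<lambda>n. x + w n) \<longlonglongrightarrow> x + 0" by (intro tendsto_intros w)
        then have "eventually (\<lambda>n. x + w n \<in> O1) sequentially"
          using topological_tendstoD[OF _ O1] True by simp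
        then have "eventually (\<lambda>n. indicator O1 x * indicator O1 (x + w n) = (indicator O1 x :: real)) sequentially"
          by eventually_elim simp
        then show ?thesis by (rule tendsto_eventually)
      qed simp
    qed
  qed (auto simp: indicator_def)
  fix w :: "nat \<Rightarrow> 'a" assume w: "w \<longlonglongrightarrow> 0"
  have eq: "shift_diff (indicator O1) (w n) =
     (\<integral>\<^sup>+x. norm (indicator O1 x - indicator O1 x * indicator O1 (x + w n) :: real) \<partial>lborel)
     + (\<integral>\<^sup>+x. norm (indicator O1 x - indicator O1 x * indicator O1 (x + - w n) :: real) \<partial>lborel)" for n
  proof -
    have "(\<integral>\<^sup>+x. norm (indicator O1 x - indicator O1 x * indicator O1 (x + - w n) :: real) \<partial>lborel)
       = (\<integral>\<^sup>+x. norm (indicator O1 (x + w n) - indicator O1 (x + w n) * indicator O1 ((x + w n) + - w n) :: real) \<partial>lborel)"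
      by (rule nn_integral_translate[symmetric]) simp
    then show ?thesis unfolding shift_diff_def
      by (simp only:) (subst nn_integral_add[symmetric], simp, simp, rule nn_integral_cong, auto simp: indicator_def)
  qed
  have "(\<lambda>n. (\<integral>\<^sup>+x. norm (indicator O1 x - indicator O1 x * indicator O1 (x + w n) :: real) \<partial>lborel)
     + (\<integral>\<^sup>+x. norm (indicator O1 x - indicator O1 x * indicator O1 (x + - w n) :: real) \<partial>lborel)) \<longlonglongrightarrow> 0 + 0"
    by (intro tendsto_add lim w) (use tendsto_minus[OF w] in simp)
  then show "(\<lambda>n. shift_diff (indicator O1) (w n)) \<longlonglongrightarrow> 0"
    unfolding eq by simp
qed

text \<open>By outer regularity a set of finite measure is close in measure to an open set.\<close>

lemma shift_cont_indicator:
  fixes A :: "'a::euclidean_space set"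
  assumes [measurable]: "A \<in> sets borel" and fin: "emeasure lborel A < \<infinity>"
  shows "shift_cont (indicator A)"
proof (rule shift_cont_approx)
  fix e :: real assume e: "e > 0"
  obtain U where U: "open U" "A \<subseteq> U" "emeasure lborel (U - A) < e"
    using outer_regular_lborel[OF assms(1) e] by blast
  have [measurable]: "U \<in> sets borel" using U by simp
  have "emeasure lborel U = emeasure lborel A + emeasure lborel (U - A)"
    using U by (subst plus_emeasure) (auto simp: Un_absorb1)
  also have "\<dots> < \<infinity>" using fin U(3) by (auto simp: less_top intro: order_less_trans)
  finally have "shift_cont (indicator U)" by (intro shift_cont_open U)
  moreover have "(\<integral>\<^sup>+x. ennreal \<bar>indicator A x - indicator U x\<bar> \<partial>lborel) = emeasure lborel (U - A)"
  proof -
    have "(\<integral>\<^sup>+x. ennreal \<bar>indicator A x - indicator U x\<bar> \<partial>lborel) = (\<integral>\<^sup>+x. indicator (U - A) x \<partial>lborel)"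
      using U by (intro nn_integral_cong) (auto simp: indicator_def)
    then show ?thesis by simp
  qed
  ultimately show "\<exists>g\<in>borel_measurable borel. shift_cont g \<and> (\<integral>\<^sup>+x. ennreal \<bar>indicator A x - g x\<bar> \<partial>lborel) \<le> ennreal e"
    using U(3) by (intro bexI[of _ "indicator U"]) auto
qed simp

lemma shift_cont_scale:
  assumes [measurable]: "f \<in> borel_measurable borel" and "shift_cont f"
  shows "shift_cont (\<lambda>x. f x * c)"
  unfolding shift_cont_def
proof (intro allI impI)
  fix w :: "nat \<Rightarrow> 'a" assume w: "w \<longlonglongrightarrow> 0"
  have "shift_diff (\<lambda>x. f x * c) v = ennreal \<bar>c\<bar> * shift_diff f v" for v
    unfolding shift_diff_def
    by (subst nn_integral_cmult[symmetric]) (auto simp: ennreal_mult[symmetric] abs_mult[symmetric] algebra_simps)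
  moreover have "(\<lambda>n. ennreal \<bar>c\<bar> * shift_diff f (w n)) \<longlonglongrightarrow> ennreal \<bar>c\<bar> * 0"
    using assms(2) w unfolding shift_cont_def by (intro ennreal_tendsto_cmult) auto
  ultimately show "(\<lambda>n. shift_diff (\<lambda>x. f x * c) (w n)) \<longlonglongrightarrow> 0" by simp
qed

lemma shift_cont_add:
  assumes [measurable]: "f \<in> borel_measurable borel" "g \<in> borel_measurable borel"
    and "shift_cont f" "shift_cont g"
  shows "shift_cont (\<lambda>x. f x + g x)"
  unfolding shift_cont_def
proof (intro allI impI)
  fix w :: "nat \<Rightarrow> 'a" assume w: "w \<longlonglongrightarrow> 0"
  have le: "shift_diff (\<lambda>x. f x + g x) v \<le> shift_diff f v + shift_diff g v" for v
    unfolding shift_diff_def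
    by (subst nn_integral_add[symmetric]) (auto simp flip: ennreal_plus intro!: nn_integral_mono ennreal_leI)
  have "(\<lambda>n. shift_diff f (w n) + shift_diff g (w n)) \<longlonglongrightarrow> 0 + 0"
    using assms w unfolding shift_cont_def by (intro tendsto_add) auto
  then have "(\<lambda>n. shift_diff f (w n) + shift_diff g (w n)) \<longlonglongrightarrow> 0" by simp
  then show "(\<lambda>n. shift_diff (\<lambda>x. f x + g x) (w n)) \<longlonglongrightarrow> 0"
    by (rule tendsto_sandwich[OF _ _ tendsto_const, rotated 2]) (auto simp: le)
qed

lemma shift_cont_integrable:
  fixes f :: "'a::euclidean_space \<Rightarrow> real"
  assumes "integrable lborel f"
  shows "shift_cont f"
  using assms
proof (induction rule: integrable_induct)
  case (base A c)
  then show ?case using shift_cont_scale[OF _ shift_cont_indicator, of A c] by simp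
next
  case (add f g)
  then show ?case by (intro shift_cont_add) auto
next
  case (lim f s)
  have [measurable]: "f \<in> borel_measurable borel" "\<And>i. s i \<in> borel_measurable borel"
    using lim by auto
  have "(\<lambda>i. \<integral>\<^sup>+x. norm (f x - s i x) \<partial>lborel) \<longlonglongrightarrow> 0"
  proof (rule nn_integral_dominated_convergence_norm[where w="\<lambda>x. 2 * norm (f x)"])
    show "(\<integral>\<^sup>+ x. ennreal (2 * norm (f x)) \<partial>lborel) < \<infinity>"
      using lim.hyps(4) by (simp add: integrable_iff_bounded nn_integral_cmult ennreal_mult ennreal_mult_less_top)
  qed (use lim in auto)
  then have "eventually (\<lambda>i. (\<integral>\<^sup>+x. norm (f x - s i x) \<partial>lborel) < ennreal e) sequentially" if "e > 0" for e
    using that by (intro order_tendstoD) auto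
  note ev = this
  show ?case
  proof (rule shift_cont_approx)
    fix e :: real assume "e > 0"
    then obtain i where "(\<integral>\<^sup>+x. norm (f x - s i x) \<partial>lborel) < ennreal e"
      using eventually_happens'[OF _ ev] by auto
    then show "\<exists>g\<in>borel_measurable borel. shift_cont g \<and> (\<integral>\<^sup>+x. ennreal \<bar>f x - g x\<bar> \<partial>lborel) \<le> ennreal e"
      using lim.IH by (intro bexI[of _ "s i"]) auto
  qed simp
qed

definition mollify :: "real \<Rightarrow> (plane \<Rightarrow> real) \<Rightarrow> plane \<Rightarrow> real" where
  "mollify e f x = (\<integral>w. f w * moll e (w - x) \<partial>lborel)"

lemma moll_bounded: obtains B where "\<And>z. \<bar>moll e z\<bar> \<le> B"
  using test_funs_bounded[OF moll_test[of 0 e UNIV]] unfolding diff_zero by blast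

lemma mollify_measurable [measurable]:
  assumes [measurable]: "f \<in> borel_measurable borel"
  shows "mollify e f \<in> borel_measurable borel"
  unfolding mollify_def[abs_def] by measurable

lemma mollify_diff_le:
  fixes f :: "plane \<Rightarrow> real"
  assumes f: "integrable lborel f" and e: "e > 0"
  shows "ennreal \<bar>mollify e f x - f x\<bar> \<le> (\<integral>\<^sup>+v. ennreal (\<bar>f (v + x) - f x\<bar> * moll e v) \<partial>lborel)"
proof -
  have [measurable]: "f \<in> borel_measurable borel" using f by auto
  obtain B where B: "\<And>z. \<bar>moll e z\<bar> \<le> B" using moll_bounded by blast
  have "integrable lborel (\<lambda>v. f (v + x))"
    using f nn_integral_translate[of "\<lambda>v. ennreal (norm (f v))" x]
    by (simp add: integrable_iff_bounded)
  then have i1: "integrable lborel (\<lambda>v. f (v + x) * moll e v)"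
    by (rule integrable_mult_bounded[OF _ _ B]) simp
  have i2: "integrable lborel (\<lambda>v. f x * moll e v)"
    using moll_integral(2) by simp
  have "mollify e f x = (\<integral>v. f (v + x) * moll e v \<partial>lborel)"
    unfolding mollify_def using integral_translate[of "\<lambda>w. f w * moll e (w - x)" x] by simp
  moreover have "f x = (\<integral>v. f x * moll e v \<partial>lborel)"
    using moll_integral(1)[OF e] by simp
  ultimately have "mollify e f x - f x = (\<integral>v. f (v + x) * moll e v - f x * moll e v \<partial>lborel)"
    using i1 i2 by (simp add: Bochner_Integration.integral_diff)
  also have "ennreal (norm \<dots>) \<le> (\<integral>\<^sup>+v. ennreal (norm (f (v + x) * moll e v - f x * moll e v)) \<partial>lborel)"
    using i1 i2 by (intro integral_norm_bound_ennreal) auto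
  also have "\<dots> = (\<integral>\<^sup>+v. ennreal (\<bar>f (v + x) - f x\<bar> * moll e v) \<partial>lborel)"
    by (simp add: left_diff_distrib[symmetric] abs_mult moll_nonneg)
  finally show ?thesis by simp
qed

text \<open>By Tonelli, the distance is an average of the translation moduli \<open>shift_diff f v\<close> over the support of
  the mollifier.\<close>

lemma mollify_tendsto:
  fixes f :: "plane \<Rightarrow> real"
  assumes f: "integrable lborel f"
  shows "(\<lambda>n. \<integral>\<^sup>+x. ennreal \<bar>mollify (1 / real (Suc n)) f x - f x\<bar> \<partial>lborel) \<longlonglongrightarrow> 0"
proof (rule tendsto_ennreal_0I)
  have [measurable]: "f \<in> borel_measurable borel" using f by auto
  fix e :: real assume e: "e > 0"
  have "\<exists>N. \<forall>v. norm v < 1 / real (Suc N) \<longrightarrow> shift_diff f v \<le> ennreal e"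
  proof (rule ccontr)
    assume "\<nexists>N. \<forall>v. norm v < 1 / real (Suc N) \<longrightarrow> shift_diff f v \<le> ennreal e"
    then obtain v where v: "\<And>N. norm (v N) < 1 / real (Suc N)" "\<And>N. shift_diff f (v N) > ennreal e"
      by (metis not_le)
    have "v \<longlonglongrightarrow> 0"
      by (rule Lim_null_comparison[OF _ lim_inverse_n'[THEN LIMSEQ_Suc]])
         (use v(1) in \<open>auto intro!: always_eventually less_imp_le\<close>)
    then have "(\<lambda>n. shift_diff f (v n)) \<longlonglongrightarrow> 0"
      using shift_cont_integrable[OF f] unfolding shift_cont_def by blast
    then have "eventually (\<lambda>n. shift_diff f (v n) < ennreal e) sequentially"
      using e by (intro order_tendstoD) auto
    then obtain n where "shift_diff f (v n) < ennreal e" by (auto dest!: eventually_happens)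
    then show False using v(2)[of n] by simp
  qed
  then obtain N where N: "\<And>v. norm v < 1 / real (Suc N) \<Longrightarrow> shift_diff f v \<le> ennreal e" by blast
  show "eventually (\<lambda>n. (\<integral>\<^sup>+x. ennreal \<bar>mollify (1 / real (Suc n)) f x - f x\<bar> \<partial>lborel) \<le> ennreal e) sequentially"
    using eventually_ge_at_top[of N]
  proof eventually_elim
    case (elim n)
    let ?r = "1 / real (Suc n)"
    have r: "?r > 0" "?r \<le> 1 / real (Suc N)" using elim by (auto simp: divide_simps)
    have "(\<integral>\<^sup>+x. ennreal \<bar>mollify ?r f x - f x\<bar> \<partial>lborel)
        \<le> (\<integral>\<^sup>+x. \<integral>\<^sup>+v. ennreal (\<bar>f (v + x) - f x\<bar> * moll ?r v) \<partial>lborel \<partial>lborel)"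
      by (intro nn_integral_mono mollify_diff_le f r)
    also have "\<dots> = (\<integral>\<^sup>+v. \<integral>\<^sup>+x. ennreal (\<bar>f (v + x) - f x\<bar> * moll ?r v) \<partial>lborel \<partial>lborel)"
      by (rule lborel_pair.Fubini') measurable
    also have "\<dots> = (\<integral>\<^sup>+v. ennreal (moll ?r v) * shift_diff f v \<partial>lborel)"
      unfolding shift_diff_def
      by (intro nn_integral_cong, subst nn_integral_cmult[symmetric])
         (auto simp: ennreal_mult moll_nonneg mult.commute add.commute)
    also have "\<dots> \<le> (\<integral>\<^sup>+v. ennreal (moll ?r v) * ennreal e \<partial>lborel)"
    proof (rule nn_integral_mono)
      fix v
      show "ennreal (moll ?r v) * shift_diff f v \<le> ennreal (moll ?r v) * ennreal e"
      proof (cases "moll ?r v = 0")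
        case False
        then show ?thesis using moll_support[OF False] r(2) N[of v] by (intro mult_left_mono) auto
      qed simp
    qed
    also have "\<dots> = (\<integral>\<^sup>+v. ennreal (moll ?r v) \<partial>lborel) * ennreal e"
      by (rule nn_integral_multc) simp
    also have "(\<integral>\<^sup>+v. ennreal (moll ?r v) \<partial>lborel) = 1"
      using nn_integral_eq_integral[OF moll_integral(2)[of ?r]] moll_integral(1)[OF r(1)]
      by (simp add: moll_nonneg)
    finally show ?case by simp
  qed
qed


section \<open>Functions with integrable weak gradient along segments\<close>

text \<open>Functions on the whole plane are used throughout; only their restrictions to \<open>U\<close> enter, because test
  functions vanish outside \<open>U\<close>.\<close>

definition weak_grad :: "plane set \<Rightarrow> (plane \<Rightarrow> real) \<Rightarrow> (plane \<Rightarrow> real) \<Rightarrow> (plane \<Rightarrow> real) \<Rightarrow> bool" where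
  "weak_grad U g g1 g2 \<longleftrightarrow> (\<forall>\<phi>\<in>test_funs U.
     (\<integral>x. g x * pd (1,0) \<phi> x \<partial>lborel) = - (\<integral>x. g1 x * \<phi> x \<partial>lborel) \<and>
     (\<integral>x. g x * pd (0,1) \<phi> x \<partial>lborel) = - (\<integral>x. g2 x * \<phi> x \<partial>lborel))"

lemma moll_smooth_bound:
  obtains B where "\<And>z. \<bar>pd (1,0) (moll e) z\<bar> \<le> B" "\<And>z. \<bar>pd (0,1) (moll e) z\<bar> \<le> B"
proof -
  have t: "moll e \<in> test_funs UNIV" using moll_test[of 0 e UNIV] by simp
  obtain B1 where "B1 \<ge> 0" and B1: "\<And>z. \<bar>pd (1,0) (moll e) z\<bar> \<le> B1"
    by (rule test_funs_bounded[OF test_funs_pd(1)[OF t]]) (rule that)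
  obtain B2 where "B2 \<ge> 0" and B2: "\<And>z. \<bar>pd (0,1) (moll e) z\<bar> \<le> B2"
    by (rule test_funs_bounded[OF test_funs_pd(2)[OF t]]) (rule that)
  show ?thesis
  proof (rule that)
    show "\<bar>pd (1,0) (moll e) z\<bar> \<le> max B1 B2" for z using B1[of z] by simp
    show "\<bar>pd (0,1) (moll e) z\<bar> \<le> max B1 B2" for z using B2[of z] by simp
  qed
qed

lemma pd_moll_measurable [measurable]:
  "pd (1,0) (moll e) \<in> borel_measurable borel" "pd (0,1) (moll e) \<in> borel_measurable borel"
  by (intro borel_measurable_continuous_onI smooth_continuous smooth_pd moll_smooth)+

text \<open>The fundamental theorem of calculus along the segment, applied to the translated mollifier rather than to
  the mollified function; Fubini and the definition of the weak derivative do the rest.\<close>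

lemma mollify_along_segment:
  assumes g: "integrable lborel g" and wg: "weak_grad U g g1 g2"
    and U: "\<And>t. 0 \<le> t \<Longrightarrow> t \<le> 1 \<Longrightarrow> cball (y + t *\<^sub>R (x - y)) r \<subseteq> U"
  shows "mollify r g x - mollify r g y =
    (\<integral>t. (fst (x - y) * mollify r g1 (y + t *\<^sub>R (x - y)) + snd (x - y) * mollify r g2 (y + t *\<^sub>R (x - y)))
       * indicator {0..1} t \<partial>lborel)"
proof -
  define d where "d = x - y"
  define z where "z t = y + t *\<^sub>R d" for t
  define h where "h w t = - (fst d * pd (1,0) (moll r) (w - z t) + snd d * pd (0,1) (moll r) (w - z t))" for w t
  have [measurable]: "g \<in> borel_measurable borel" using g by auto
  have z_meas [measurable]: "z \<in> borel_measurable borel"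
    unfolding z_def[abs_def] by (intro borel_measurable_continuous_onI continuous_intros)
  obtain B where B: "\<And>z. \<bar>pd (1,0) (moll r) z\<bar> \<le> B" "\<And>z. \<bar>pd (0,1) (moll r) z\<bar> \<le> B"
    by (rule moll_smooth_bound) (rule that)
  have ftc: "(\<integral>t. h w t * indicator {0..1} t \<partial>lborel) = moll r (w - x) - moll r (w - y)" for w
  proof -
    have "((\<lambda>t. moll r (w - z t)) has_real_derivative h w t) (at t)" for t
    proof -
      have zd: "((\<lambda>t. w - z t) has_derivative (\<lambda>s. - (s *\<^sub>R d))) (at t)"
        unfolding z_def by (auto intro!: derivative_eq_intros)
      show ?thesis
        using has_derivative_compose[OF zd smooth_has_derivative[OF moll_smooth[of r]]]
        unfolding has_field_derivative_def h_def
        by (rule has_derivative_eq_rhs) (auto simp: fun_eq_iff algebra_simps)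
    qed
    moreover have "isCont (h w) t" for t
    proof -
      have "continuous_on UNIV (h w)"
        unfolding h_def[abs_def] z_def
        by (intro continuous_intros continuous_on_compose2[OF smooth_continuous[OF smooth_pd(1)[OF moll_smooth]]]
              continuous_on_compose2[OF smooth_continuous[OF smooth_pd(2)[OF moll_smooth]]]) auto
      then show ?thesis by (simp add: continuous_on_eq_continuous_at)
    qed
    ultimately have "(\<integral>t. h w t * indicator {0..1} t \<partial>lborel) = moll r (w - z 1) - moll r (w - z 0)"
      by (intro integral_FTC_Icc_real) auto
    then show ?thesis by (simp add: z_def d_def)
  qed
  have hB: "\<bar>h w t\<bar> \<le> (\<bar>fst d\<bar> + \<bar>snd d\<bar>) * B" for w t
  proof -
    have "\<bar>h w t\<bar> \<le> \<bar>fst d\<bar> * \<bar>pd (1,0) (moll r) (w - z t)\<bar> + \<bar>snd d\<bar> * \<bar>pd (0,1) (moll r) (w - z t)\<bar>"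
      unfolding h_def abs_minus_cancel by (intro order_trans[OF abs_triangle_ineq]) (simp add: abs_mult)
    also have "\<dots> \<le> \<bar>fst d\<bar> * B + \<bar>snd d\<bar> * B" by (intro add_mono mult_left_mono B) auto
    finally show ?thesis by (simp add: algebra_simps)
  qed
  have h_meas [measurable]: "(\<lambda>(w, t). h w t) \<in> borel_measurable (borel \<Otimes>\<^sub>M borel)"
    unfolding h_def by measurable
  have int: "integrable (lborel \<Otimes>\<^sub>M lborel) (\<lambda>(w, t). g w * (h w t * indicator {0..1} t))"
  proof (rule integrableI_bounded)
    let ?M = "(\<bar>fst d\<bar> + \<bar>snd d\<bar>) * B"
    have "(\<integral>\<^sup>+p. ennreal (norm (case p of (w, t) \<Rightarrow> g w * (h w t * indicator {0..1} t))) \<partial>(lborel \<Otimes>\<^sub>M lborel))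
        = (\<integral>\<^sup>+w. \<integral>\<^sup>+t. ennreal (\<bar>g w\<bar> * (\<bar>h w t\<bar> * indicator {0..1} t)) \<partial>lborel \<partial>lborel)"
      by (subst lborel.nn_integral_fst[symmetric]) (auto simp: abs_mult)
    also have "\<dots> \<le> (\<integral>\<^sup>+w. \<integral>\<^sup>+t. ennreal (\<bar>g w\<bar> * ?M) * indicator {0..1::real} t \<partial>lborel \<partial>lborel)"
      by (intro nn_integral_mono) (auto simp: indicator_def intro!: ennreal_leI mult_left_mono hB)
    also have "\<dots> = (\<integral>\<^sup>+w. ennreal (\<bar>g w\<bar> * ?M) \<partial>lborel)"
      by (subst nn_integral_cmult_indicator) simp_all
    also have "\<dots> < \<infinity>"
    proof -
      have "?M \<ge> 0" using B(1)[of 0] by auto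
      moreover have "(\<integral>\<^sup>+w. ennreal \<bar>g w\<bar> \<partial>lborel) < top"
        using g by (simp add: integrable_iff_bounded)
      ultimately show ?thesis
        by (simp add: ennreal_mult nn_integral_multc ennreal_mult_less_top del: mult_eq_0_iff)
    qed
    finally show "(\<integral>\<^sup>+p. ennreal (norm (case p of (w, t) \<Rightarrow> g w * (h w t * indicator {0..1} t))) \<partial>(lborel \<Otimes>\<^sub>M lborel)) < \<infinity>" .
  qed measurable
  have gm: "integrable lborel (\<lambda>w. g w * moll r (w - v))" for v
    using integrable_mult_test[OF g moll_test[of v r UNIV]] by simp
  have "mollify r g x - mollify r g y = (\<integral>w. g w * moll r (w - x) - g w * moll r (w - y) \<partial>lborel)"
    unfolding mollify_def using gm by (simp add: Bochner_Integration.integral_diff)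
  also have "\<dots> = (\<integral>w. (\<integral>t. g w * (h w t * indicator {0..1} t) \<partial>lborel) \<partial>lborel)"
    by (simp add: ftc right_diff_distrib)
  also have "\<dots> = (\<integral>t. (\<integral>w. g w * (h w t * indicator {0..1} t) \<partial>lborel) \<partial>lborel)"
    by (rule lborel_pair.Fubini_integral[OF int, symmetric])
  also have "\<dots> = (\<integral>t. (fst d * mollify r g1 (z t) + snd d * mollify r g2 (z t)) * indicator {0..1} t \<partial>lborel)"
  proof (rule Bochner_Integration.integral_cong[OF refl])
    fix t :: real
    show "(\<integral>w. g w * (h w t * indicator {0..1} t) \<partial>lborel) =
        (fst d * mollify r g1 (z t) + snd d * mollify r g2 (z t)) * indicator {0..1} t"
    proof (cases "t \<in> {0..1}")
      case True
      let ?\<phi> = "\<lambda>w. moll r (w - z t)"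
      have \<phi>: "?\<phi> \<in> test_funs U"
        using U[of t] True by (intro moll_test) (auto simp: z_def d_def)
      have p: "pd (1,0) ?\<phi> = (\<lambda>w. pd (1,0) (moll r) (w - z t))" "pd (0,1) ?\<phi> = (\<lambda>w. pd (0,1) (moll r) (w - z t))"
        by (rule pd_translate[OF moll_smooth])+
      have i: "integrable lborel (\<lambda>w. g w * pd (1,0) ?\<phi> w)" "integrable lborel (\<lambda>w. g w * pd (0,1) ?\<phi> w)"
        by (rule integrable_mult_test[OF g test_funs_pd(1)[OF \<phi>]] integrable_mult_test[OF g test_funs_pd(2)[OF \<phi>]])+
      have "(\<integral>w. g w * (h w t * indicator {0..1} t) \<partial>lborel)
          = (\<integral>w. (- fst d) * (g w * pd (1,0) ?\<phi> w) + (- snd d) * (g w * pd (0,1) ?\<phi> w) \<partial>lborel)"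
        using True by (intro Bochner_Integration.integral_cong) (auto simp: h_def p algebra_simps)
      also have "\<dots> = (- fst d) * (\<integral>w. g w * pd (1,0) ?\<phi> w \<partial>lborel) + (- snd d) * (\<integral>w. g w * pd (0,1) ?\<phi> w \<partial>lborel)"
        using i by (subst Bochner_Integration.integral_add) (simp_all del: mult_minus_left)
      also have "\<dots> = fst d * mollify r g1 (z t) + snd d * mollify r g2 (z t)"
        using wg \<phi> unfolding weak_grad_def mollify_def by simp
      finally show ?thesis using True by simp
    qed simp
  qed
  finally show ?thesis by (simp add: z_def d_def)
qed

definition seg_avg :: "(plane \<Rightarrow> ennreal) \<Rightarrow> plane \<Rightarrow> plane \<Rightarrow> ennreal" where
  "seg_avg F x y = (\<integral>\<^sup>+t. F (y + t *\<^sub>R (x - y)) * indicator {0..1} t \<partial>lborel)"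

lemma seg_avg_measurable [measurable (raw)]:
  assumes [measurable]: "F \<in> borel_measurable borel" "a \<in> M \<rightarrow>\<^sub>M borel" "b \<in> M \<rightarrow>\<^sub>M borel"
  shows "(\<lambda>p. seg_avg F (a p) (b p)) \<in> borel_measurable M"
  unfolding seg_avg_def by measurable

text \<open>The Jacobian of the substitution is \<open>c\<^sup>2 \<ge> 1/4\<close>.\<close>

lemma nn_integral_affine_le:
  fixes F :: "plane \<Rightarrow> ennreal"
  assumes [measurable]: "F \<in> borel_measurable borel" and c: "\<bar>c\<bar> \<ge> 1/2"
  shows "(\<integral>\<^sup>+x. F (v + c *\<^sub>R x) \<partial>lborel) \<le> 4 * (\<integral>\<^sup>+x. F x \<partial>lborel)"
proof -
  have c0: "c \<noteq> 0" using c by auto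
  have "(\<integral>\<^sup>+x. F x \<partial>lborel) = ennreal (\<bar>c\<bar>\<^sup>2) * (\<integral>\<^sup>+x. F (v + c *\<^sub>R x) \<partial>lborel)"
    by (subst lborel_affine[OF c0, of v])
       (simp add: nn_integral_density nn_integral_distr nn_integral_cmult power2_eq_square)
  moreover have "1 \<le> 4 * ennreal (\<bar>c\<bar>\<^sup>2)"
  proof -
    have "(1/2)\<^sup>2 \<le> \<bar>c\<bar>\<^sup>2" using c by (intro power_mono) auto
    then have "1 \<le> 4 * \<bar>c\<bar>\<^sup>2" by (simp add: power2_eq_square)
    then have "ennreal 1 \<le> ennreal (4 * \<bar>c\<bar>\<^sup>2)" by (rule ennreal_leI)
    moreover have "ennreal (4 * \<bar>c\<bar>\<^sup>2) = 4 * ennreal (\<bar>c\<bar>\<^sup>2)"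
      using ennreal_mult[of 4 "\<bar>c\<bar>\<^sup>2"] by simp
    ultimately show ?thesis by (simp only: ennreal_1)
  qed
  ultimately show ?thesis
    using mult_right_mono[of 1 "4 * ennreal (\<bar>c\<bar>\<^sup>2)" "\<integral>\<^sup>+x. F (v + c *\<^sub>R x) \<partial>lborel"]
    by (simp add: mult.assoc)
qed

text \<open>For a parameter \<open>t \<ge> 1/2\<close> one substitutes \<open>z = y + t (x - y)\<close> for \<open>x\<close>, otherwise for \<open>y\<close>; in this way
  the Jacobian stays bounded below, and no singular kernel arises.\<close>

lemma seg_avg_integral_le:
  fixes F :: "plane \<Rightarrow> ennreal"
  assumes [measurable]: "F \<in> borel_measurable borel" "X \<in> sets borel"
  shows "(\<integral>\<^sup>+y. \<integral>\<^sup>+x. seg_avg F x y * indicator X x * indicator X y \<partial>lborel \<partial>lborel)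
    \<le> 4 * emeasure lborel X * (\<integral>\<^sup>+x. F x \<partial>lborel)"
proof -
  let ?I = "indicator X :: plane \<Rightarrow> ennreal"
  let ?J = "indicator {0..1} :: real \<Rightarrow> ennreal"
  have fixed: "(\<integral>\<^sup>+y. \<integral>\<^sup>+x. F (y + t *\<^sub>R (x - y)) * ?I x * ?I y \<partial>lborel \<partial>lborel)
      \<le> 4 * emeasure lborel X * (\<integral>\<^sup>+x. F x \<partial>lborel)" if "t \<in> {0..1}" for t
  proof (cases "t \<ge> 1/2")
    case True
    have "(\<integral>\<^sup>+y. \<integral>\<^sup>+x. F (y + t *\<^sub>R (x - y)) * ?I x * ?I y \<partial>lborel \<partial>lborel)
      \<le> (\<integral>\<^sup>+y. \<integral>\<^sup>+x. F ((y - t *\<^sub>R y) + t *\<^sub>R x) * ?I y \<partial>lborel \<partial>lborel)"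
      by (intro nn_integral_mono) (auto simp: indicator_def algebra_simps)
    also have "\<dots> = (\<integral>\<^sup>+y. (\<integral>\<^sup>+x. F ((y - t *\<^sub>R y) + t *\<^sub>R x) \<partial>lborel) * ?I y \<partial>lborel)"
      by (subst nn_integral_multc) simp_all
    also have "\<dots> \<le> (\<integral>\<^sup>+y. 4 * (\<integral>\<^sup>+x. F x \<partial>lborel) * ?I y \<partial>lborel)"
      using True by (intro nn_integral_mono mult_right_mono nn_integral_affine_le) auto
    also have "\<dots> = 4 * emeasure lborel X * (\<integral>\<^sup>+x. F x \<partial>lborel)"
      by (subst nn_integral_cmult_indicator) (simp_all add: ac_simps)
    finally show ?thesis .
  next
    case False
    have "(\<integral>\<^sup>+y. \<integral>\<^sup>+x. F (y + t *\<^sub>R (x - y)) * ?I x * ?I y \<partial>lborel \<partial>lborel)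
      = (\<integral>\<^sup>+x. \<integral>\<^sup>+y. F (y + t *\<^sub>R (x - y)) * ?I x * ?I y \<partial>lborel \<partial>lborel)"
      by (rule lborel_pair.Fubini') measurable
    also have "\<dots> \<le> (\<integral>\<^sup>+x. \<integral>\<^sup>+y. F (t *\<^sub>R x + (1 - t) *\<^sub>R y) * ?I x \<partial>lborel \<partial>lborel)"
      by (intro nn_integral_mono) (auto simp: indicator_def algebra_simps)
    also have "\<dots> = (\<integral>\<^sup>+x. (\<integral>\<^sup>+y. F (t *\<^sub>R x + (1 - t) *\<^sub>R y) \<partial>lborel) * ?I x \<partial>lborel)"
      by (subst nn_integral_multc) simp_all
    also have "\<dots> \<le> (\<integral>\<^sup>+x. 4 * (\<integral>\<^sup>+x. F x \<partial>lborel) * ?I x \<partial>lborel)"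
      using False by (intro nn_integral_mono mult_right_mono nn_integral_affine_le) auto
    also have "\<dots> = 4 * emeasure lborel X * (\<integral>\<^sup>+x. F x \<partial>lborel)"
      by (subst nn_integral_cmult_indicator) (simp_all add: ac_simps)
    finally show ?thesis .
  qed
  have "(\<integral>\<^sup>+y. \<integral>\<^sup>+x. seg_avg F x y * ?I x * ?I y \<partial>lborel \<partial>lborel)
      = (\<integral>\<^sup>+y. \<integral>\<^sup>+x. \<integral>\<^sup>+t. F (y + t *\<^sub>R (x - y)) * ?I x * ?I y * ?J t \<partial>lborel \<partial>lborel \<partial>lborel)"
  proof (intro nn_integral_cong)
    fix x y
    have "seg_avg F x y * ?I x * ?I y = (\<integral>\<^sup>+t. F (y + t *\<^sub>R (x - y)) * ?J t \<partial>lborel) * (?I x * ?I y)"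
      by (simp add: seg_avg_def mult.assoc)
    also have "\<dots> = (\<integral>\<^sup>+t. F (y + t *\<^sub>R (x - y)) * ?J t * (?I x * ?I y) \<partial>lborel)"
      by (rule nn_integral_multc[symmetric]) simp
    finally show "seg_avg F x y * ?I x * ?I y = (\<integral>\<^sup>+t. F (y + t *\<^sub>R (x - y)) * ?I x * ?I y * ?J t \<partial>lborel)"
      by (simp add: ac_simps)
  qed
  also have "\<dots> = (\<integral>\<^sup>+y. \<integral>\<^sup>+t. \<integral>\<^sup>+x. F (y + t *\<^sub>R (x - y)) * ?I x * ?I y * ?J t \<partial>lborel \<partial>lborel \<partial>lborel)"
    by (intro nn_integral_cong lborel_pair.Fubini') measurable
  also have "\<dots> = (\<integral>\<^sup>+t. \<integral>\<^sup>+y. \<integral>\<^sup>+x. F (y + t *\<^sub>R (x - y)) * ?I x * ?I y * ?J t \<partial>lborel \<partial>lborel \<partial>lborel)"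
    by (rule lborel_pair.Fubini') measurable
  also have "\<dots> = (\<integral>\<^sup>+t. (\<integral>\<^sup>+y. \<integral>\<^sup>+x. F (y + t *\<^sub>R (x - y)) * ?I x * ?I y \<partial>lborel \<partial>lborel) * ?J t \<partial>lborel)"
    by (intro nn_integral_cong) (auto simp: indicator_def)
  also have "\<dots> \<le> (\<integral>\<^sup>+t. 4 * emeasure lborel X * (\<integral>\<^sup>+x. F x \<partial>lborel) * ?J t \<partial>lborel)"
    by (intro nn_integral_mono) (use fixed in \<open>auto simp: indicator_def\<close>)
  also have "\<dots> = 4 * emeasure lborel X * (\<integral>\<^sup>+x. F x \<partial>lborel)"
    by (simp add: nn_integral_cmult_indicator)
  finally show ?thesis .
qed

lemma seg_avg_mono: "(\<And>z. F z \<le> G z) \<Longrightarrow> seg_avg F x y \<le> seg_avg G x y"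
  unfolding seg_avg_def by (intro nn_integral_mono mult_right_mono) auto

lemma seg_avg_add:
  assumes [measurable]: "F \<in> borel_measurable borel" "G \<in> borel_measurable borel"
  shows "seg_avg (\<lambda>z. F z + G z) x y = seg_avg F x y + seg_avg G x y"
  unfolding seg_avg_def by (subst nn_integral_add[symmetric]) (auto simp: distrib_right)

lemma abs_coord_le_norm:
  fixes z :: plane
  shows "\<bar>fst z\<bar> \<le> norm z" "\<bar>snd z\<bar> \<le> norm z"
  using norm_fst_le[of "fst z" "snd z"] norm_snd_le[of "snd z" "fst z"] by simp_all

text \<open>All error terms of the mollification are collected in one summand, whose integral over bounded sets of
  pairs tends to 0.\<close>

lemma mollify_segment_le:
  assumes g: "integrable lborel g" and wg: "weak_grad U g g1 g2"
    and m [measurable]: "g1 \<in> borel_measurable borel" "g2 \<in> borel_measurable borel"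
    and U: "\<And>t. 0 \<le> t \<Longrightarrow> t \<le> 1 \<Longrightarrow> cball (y + t *\<^sub>R (x - y)) r \<subseteq> U"
  shows "ennreal \<bar>g x - g y\<bar> \<le> ennreal (norm (x - y)) * seg_avg (\<lambda>z. ennreal (\<bar>g1 z\<bar> + \<bar>g2 z\<bar>)) x y
    + (ennreal \<bar>mollify r g x - g x\<bar> + ennreal \<bar>mollify r g y - g y\<bar>
      + ennreal (norm (x - y)) * seg_avg (\<lambda>z. ennreal (\<bar>mollify r g1 z - g1 z\<bar> + \<bar>mollify r g2 z - g2 z\<bar>)) x y)"
proof -
  let ?d = "x - y" and ?z = "\<lambda>t. y + t *\<^sub>R (x - y)"
  let ?f = "\<lambda>t. (fst ?d * mollify r g1 (?z t) + snd ?d * mollify r g2 (?z t)) * indicator {0..1} t"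
  let ?G = "\<lambda>z. ennreal (\<bar>g1 z\<bar> + \<bar>g2 z\<bar>)"
  let ?E = "\<lambda>z. ennreal (\<bar>mollify r g1 z - g1 z\<bar> + \<bar>mollify r g2 z - g2 z\<bar>)"
  have "ennreal \<bar>mollify r g x - mollify r g y\<bar> \<le> (\<integral>\<^sup>+t. ennreal \<bar>?f t\<bar> \<partial>lborel)"
  proof -
    have eq: "mollify r g x - mollify r g y = (\<integral>t. ?f t \<partial>lborel)"
      by (rule mollify_along_segment[OF g wg]) (rule U)
    have "ennreal (norm (\<integral>t. ?f t \<partial>lborel)) \<le> (\<integral>\<^sup>+t. ennreal (norm (?f t)) \<partial>lborel)"
    proof (cases "integrable lborel ?f")
      case True
      then show ?thesis by (rule integral_norm_bound_ennreal)
    next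
      case False
      have "(\<integral>t. ?f t \<partial>lborel) = 0" by (rule not_integrable_integral_eq[OF False])
      then show ?thesis by simp
    qed
    then show ?thesis unfolding eq real_norm_def .
  qed
  also have "\<dots> \<le> (\<integral>\<^sup>+t. ennreal (norm ?d) * (ennreal (\<bar>mollify r g1 (?z t)\<bar> + \<bar>mollify r g2 (?z t)\<bar>) * indicator {0..1} t) \<partial>lborel)"
  proof (rule nn_integral_mono)
    fix t :: real
    have "\<bar>fst ?d\<bar> \<le> norm ?d" "\<bar>snd ?d\<bar> \<le> norm ?d"
      by (rule abs_coord_le_norm)+
    then have "\<bar>fst ?d * mollify r g1 (?z t) + snd ?d * mollify r g2 (?z t)\<bar>
        \<le> norm ?d * \<bar>mollify r g1 (?z t)\<bar> + norm ?d * \<bar>mollify r g2 (?z t)\<bar>"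
      by (intro order_trans[OF abs_triangle_ineq] add_mono) (auto simp: abs_mult intro!: mult_right_mono)
    then have "ennreal \<bar>fst ?d * mollify r g1 (?z t) + snd ?d * mollify r g2 (?z t)\<bar>
        \<le> ennreal (norm ?d * (\<bar>mollify r g1 (?z t)\<bar> + \<bar>mollify r g2 (?z t)\<bar>))"
      by (intro ennreal_leI) (simp add: distrib_left)
    also have "\<dots> = ennreal (norm ?d) * ennreal (\<bar>mollify r g1 (?z t)\<bar> + \<bar>mollify r g2 (?z t)\<bar>)"
      by (rule ennreal_mult) auto
    finally show "ennreal \<bar>?f t\<bar> \<le> ennreal (norm ?d) * (ennreal (\<bar>mollify r g1 (?z t)\<bar> + \<bar>mollify r g2 (?z t)\<bar>) * indicator {0..1} t)"
      by (cases "t \<in> {0..1}") simp_all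
  qed
  also have "\<dots> = ennreal (norm ?d) * seg_avg (\<lambda>z. ennreal (\<bar>mollify r g1 z\<bar> + \<bar>mollify r g2 z\<bar>)) x y"
    unfolding seg_avg_def by (rule nn_integral_cmult) measurable
  also have "\<dots> \<le> ennreal (norm ?d) * seg_avg (\<lambda>z. ?G z + ?E z) x y"
    by (intro mult_left_mono seg_avg_mono) (auto simp flip: ennreal_plus intro!: ennreal_leI)
  also have "\<dots> = ennreal (norm ?d) * seg_avg ?G x y + ennreal (norm ?d) * seg_avg ?E x y"
    by (subst seg_avg_add) (auto simp: distrib_left)
  finally have 1: "ennreal \<bar>mollify r g x - mollify r g y\<bar>
      \<le> ennreal (norm ?d) * seg_avg ?G x y + ennreal (norm ?d) * seg_avg ?E x y" .
  have "ennreal \<bar>g x - g y\<bar> \<le> ennreal \<bar>mollify r g x - mollify r g y\<bar>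
      + (ennreal \<bar>mollify r g x - g x\<bar> + ennreal \<bar>mollify r g y - g y\<bar>)"
    by (auto simp flip: ennreal_plus intro!: ennreal_leI)
  also have "\<dots> \<le> (ennreal (norm ?d) * seg_avg ?G x y + ennreal (norm ?d) * seg_avg ?E x y)
      + (ennreal \<bar>mollify r g x - g x\<bar> + ennreal \<bar>mollify r g y - g y\<bar>)"
    by (intro add_right_mono 1)
  finally show ?thesis by (simp add: ac_simps)
qed

lemma ennreal_null_sequence_le:
  fixes a :: "nat \<Rightarrow> ennreal"
  assumes "eventually (\<lambda>n. c \<le> A + a n) sequentially" "liminf a = 0"
  shows "c \<le> A"
proof (cases "A = top")
  case False
  \<comment> \<open>Extended subtraction needs \<open>A\<close> to be finite: \<open>top - top\<close> is \<open>top\<close>.\<close>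
  have "eventually (\<lambda>n. c - A \<le> a n) sequentially"
    using assms(1) by eventually_elim (use False in \<open>auto simp: ennreal_minus_le_iff\<close>)
  then have "c - A \<le> 0" using Liminf_bounded[of "c - A" a sequentially] assms(2) by simp
  then show ?thesis unfolding ennreal_minus_le_iff by simp
qed simp

lemma nn_integral_three_terms:
  assumes [measurable]: "f \<in> borel_measurable M" "g \<in> borel_measurable M" "h \<in> borel_measurable M"
  shows "(\<integral>\<^sup>+x. f x * a + (b * g x + c * h x) \<partial>M)
    = (\<integral>\<^sup>+x. f x \<partial>M) * a + (b * (\<integral>\<^sup>+x. g x \<partial>M) + c * (\<integral>\<^sup>+x. h x \<partial>M))"
  by (simp add: nn_integral_add nn_integral_cmult nn_integral_multc)

text \<open>The error terms of \<open>mollify_segment_le\<close> tend to 0 in the mean; by Fatou their lower limit vanishes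
  almost everywhere, so they disappear without passing to a subsequence.\<close>

lemma segment_inequality:
  assumes U: "open U" and g: "integrable lborel g" "integrable lborel g1" "integrable lborel g2"
    and wg: "weak_grad U g g1 g2"
  shows "AE y in lborel. AE x in lborel. closed_segment y x \<subseteq> U \<longrightarrow>
    ennreal \<bar>g x - g y\<bar> \<le> ennreal (norm (x - y)) * seg_avg (\<lambda>z. ennreal (\<bar>g1 z\<bar> + \<bar>g2 z\<bar>)) x y"
proof -
  have [measurable]: "g \<in> borel_measurable borel" "g1 \<in> borel_measurable borel" "g2 \<in> borel_measurable borel"
    using g by auto
  define r where "r n = 1 / real (Suc n)" for n
  define err where "err n f x = ennreal \<bar>mollify (r n) f x - f x\<bar>" for n f x
  have [measurable]: "f \<in> borel_measurable borel \<Longrightarrow> err n f \<in> borel_measurable borel" for n f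
    unfolding err_def by measurable
  have err0: "(\<lambda>n. \<integral>\<^sup>+x. err n f x \<partial>lborel) \<longlonglongrightarrow> 0" if "integrable lborel f" for f
    unfolding err_def r_def by (rule mollify_tendsto[OF that])
  have seg: "closed_segment y x = (\<lambda>t. y + t *\<^sub>R (x - y)) ` {0..1}" for x y :: plane
    by (auto simp: closed_segment_def algebra_simps)
  have local: "AE y in lborel. AE x in lborel. x \<in> ball 0 R \<longrightarrow> y \<in> ball 0 R \<longrightarrow> closed_segment y x \<subseteq> U \<longrightarrow>
    ennreal \<bar>g x - g y\<bar> \<le> ennreal (norm (x - y)) * seg_avg (\<lambda>z. ennreal (\<bar>g1 z\<bar> + \<bar>g2 z\<bar>)) x y" for R :: real
  proof (cases "R > 0")
    case R: True
    let ?X = "ball (0::plane) R"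
    let ?I = "indicator ?X :: plane \<Rightarrow> ennreal"
    let ?m = "emeasure lborel ?X"
    \<comment> \<open>On pairs of points of the ball, the length of the segment is at most \<open>2 * R\<close>.\<close>
    define e where "e n x y = err n g x + err n g y + ennreal (2 * R) * seg_avg (\<lambda>z. err n g1 z + err n g2 z) x y" for n x y
    have [measurable]: "?X \<in> sets borel" by simp
    have [measurable]: "(\<lambda>p. e n (snd p) (fst p)) \<in> borel_measurable (lborel \<Otimes>\<^sub>M lborel)" for n
      unfolding e_def by measurable
    have e_meas [measurable]: "(\<lambda>p. e n (snd p) (fst p) * ?I (snd p) * ?I (fst p))
        \<in> borel_measurable (lborel \<Otimes>\<^sub>M lborel)" for n
      by measurable
    have int_e: "(\<integral>\<^sup>+y. \<integral>\<^sup>+x. e n x y * ?I x * ?I y \<partial>lborel \<partial>lborel)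
      \<le> 2 * ?m * (\<integral>\<^sup>+x. err n g x \<partial>lborel) + ennreal (2 * R) * (4 * ?m * ((\<integral>\<^sup>+x. err n g1 x \<partial>lborel) + (\<integral>\<^sup>+x. err n g2 x \<partial>lborel)))" for n
    proof -
      let ?S = "seg_avg (\<lambda>z. err n g1 z + err n g2 z)"
      have [measurable]: "?X \<in> sets borel" by simp
      have [measurable]: "(\<lambda>x. ?S x y) \<in> borel_measurable borel" for y
        by (rule seg_avg_measurable) measurable
      have [measurable]: "(\<lambda>p. ?S (snd p) (fst p)) \<in> borel_measurable (borel \<Otimes>\<^sub>M borel)"
        by (rule seg_avg_measurable) measurable
      have [measurable]: "(\<lambda>y. \<integral>\<^sup>+x. ?S x y * ?I x * ?I y \<partial>lborel) \<in> borel_measurable borel"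
        by measurable
      have "(\<integral>\<^sup>+y. \<integral>\<^sup>+x. e n x y * ?I x * ?I y \<partial>lborel \<partial>lborel)
        \<le> (\<integral>\<^sup>+y. \<integral>\<^sup>+x. err n g x * ?I y + (err n g y * ?I x + ennreal (2 * R) * (?S x y * ?I x * ?I y)) \<partial>lborel \<partial>lborel)"
        by (intro nn_integral_mono) (auto simp: e_def indicator_def)
      also have "\<dots> = (\<integral>\<^sup>+y. (\<integral>\<^sup>+x. err n g x \<partial>lborel) * ?I y + (err n g y * (\<integral>\<^sup>+x. ?I x \<partial>lborel)
           + ennreal (2 * R) * (\<integral>\<^sup>+x. ?S x y * ?I x * ?I y \<partial>lborel)) \<partial>lborel)"
        by (intro nn_integral_cong nn_integral_three_terms) simp_all
      also have "\<dots> = (\<integral>\<^sup>+y. err n g y * ?m + ((\<integral>\<^sup>+x. err n g x \<partial>lborel) * ?I y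
           + ennreal (2 * R) * (\<integral>\<^sup>+x. ?S x y * ?I x * ?I y \<partial>lborel)) \<partial>lborel)"
        by (intro nn_integral_cong) (simp add: ac_simps)
      also have "\<dots> = (\<integral>\<^sup>+x. err n g x \<partial>lborel) * ?m + ((\<integral>\<^sup>+x. err n g x \<partial>lborel) * ?m
           + ennreal (2 * R) * (\<integral>\<^sup>+y. \<integral>\<^sup>+x. ?S x y * ?I x * ?I y \<partial>lborel \<partial>lborel))"
        by (subst nn_integral_three_terms) simp_all
      also have "\<dots> \<le> (\<integral>\<^sup>+x. err n g x \<partial>lborel) * ?m + ((\<integral>\<^sup>+x. err n g x \<partial>lborel) * ?m
           + ennreal (2 * R) * (4 * ?m * (\<integral>\<^sup>+x. err n g1 x + err n g2 x \<partial>lborel)))"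
        by (intro add_left_mono mult_left_mono seg_avg_integral_le) auto
      also have "(\<integral>\<^sup>+x. err n g1 x + err n g2 x \<partial>lborel) = (\<integral>\<^sup>+x. err n g1 x \<partial>lborel) + (\<integral>\<^sup>+x. err n g2 x \<partial>lborel)"
        by (rule nn_integral_add) measurable
      finally show ?thesis by (simp add: algebra_simps mult_2)
    qed
    have m: "?m < top" using emeasure_bounded_finite[OF bounded_ball] by simp
    have "(\<lambda>n. 2 * ?m * (\<integral>\<^sup>+x. err n g x \<partial>lborel) + ennreal (2 * R) * (4 * ?m * ((\<integral>\<^sup>+x. err n g1 x \<partial>lborel) + (\<integral>\<^sup>+x. err n g2 x \<partial>lborel))))
        \<longlonglongrightarrow> 2 * ?m * 0 + ennreal (2 * R) * (4 * ?m * (0 + 0))"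
      using m by (intro tendsto_add ennreal_tendsto_cmult err0 g) (auto simp: ennreal_mult_less_top)
    then have lim: "(\<lambda>n. 2 * ?m * (\<integral>\<^sup>+x. err n g x \<partial>lborel) + ennreal (2 * R) * (4 * ?m * ((\<integral>\<^sup>+x. err n g1 x \<partial>lborel) + (\<integral>\<^sup>+x. err n g2 x \<partial>lborel))))
        \<longlonglongrightarrow> 0" by simp
    have prod: "(\<integral>\<^sup>+p. e n (snd p) (fst p) * ?I (snd p) * ?I (fst p) \<partial>(lborel \<Otimes>\<^sub>M lborel))
       = (\<integral>\<^sup>+y. \<integral>\<^sup>+x. e n x y * ?I x * ?I y \<partial>lborel \<partial>lborel)" for n
      by (subst lborel.nn_integral_fst[symmetric]) auto
    have "(\<lambda>n. \<integral>\<^sup>+p. e n (snd p) (fst p) * ?I (snd p) * ?I (fst p) \<partial>(lborel \<Otimes>\<^sub>M lborel)) \<longlonglongrightarrow> 0"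
      by (rule tendsto_sandwich[OF _ _ tendsto_const lim]) (auto simp: prod int_e intro!: always_eventually)
    then have "liminf (\<lambda>n. \<integral>\<^sup>+p. e n (snd p) (fst p) * ?I (snd p) * ?I (fst p) \<partial>(lborel \<Otimes>\<^sub>M lborel)) = 0"
      by (intro lim_imp_Liminf) auto
    then have "(\<integral>\<^sup>+p. liminf (\<lambda>n. e n (snd p) (fst p) * ?I (snd p) * ?I (fst p)) \<partial>(lborel \<Otimes>\<^sub>M lborel)) = 0"
      using nn_integral_liminf[of "\<lambda>n p. e n (snd p) (fst p) * ?I (snd p) * ?I (fst p)" "lborel \<Otimes>\<^sub>M lborel"] by simp
    then have "AE p in lborel \<Otimes>\<^sub>M lborel. liminf (\<lambda>n. e n (snd p) (fst p) * ?I (snd p) * ?I (fst p)) = 0"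
      by (subst (asm) nn_integral_0_iff_AE) auto
    from lborel_pair.AE_pair[OF this]
    have ae: "AE y in lborel. AE x in lborel. liminf (\<lambda>n. e n x y * ?I x * ?I y) = 0" by simp
    have pointwise: "ennreal \<bar>g x - g y\<bar> \<le> ennreal (norm (x - y)) * seg_avg (\<lambda>z. ennreal (\<bar>g1 z\<bar> + \<bar>g2 z\<bar>)) x y"
      if l: "liminf (\<lambda>n. e n x y * ?I x * ?I y) = 0" and xy: "x \<in> ?X" "y \<in> ?X" and s: "closed_segment y x \<subseteq> U" for x y
    proof (rule ennreal_null_sequence_le)
      show "liminf (\<lambda>n. e n x y) = 0" using l xy by simp
      obtain \<epsilon> where \<epsilon>: "\<epsilon> > 0" "(\<Union>z\<in>closed_segment y x. cball z \<epsilon>) \<subseteq> U"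
        using compact_subset_open_imp_cball_epsilon_subset[OF compact_segment U s] by blast
      obtain N where N: "1 / real (Suc N) < \<epsilon>" using \<epsilon>(1) nat_approx_posE by blast
      have nrm: "norm (x - y) \<le> 2 * R" using xy norm_triangle_ineq4[of x y] by auto
      show "eventually (\<lambda>n. ennreal \<bar>g x - g y\<bar> \<le> ennreal (norm (x - y)) * seg_avg (\<lambda>z. ennreal (\<bar>g1 z\<bar> + \<bar>g2 z\<bar>)) x y + e n x y) sequentially"
        using eventually_ge_at_top[of N]
      proof eventually_elim
        case (elim n)
        have "r n \<le> 1 / real (Suc N)" using elim by (simp add: r_def divide_simps)
        then have rn: "r n \<le> \<epsilon>" using N by simp
        have "cball (y + t *\<^sub>R (x - y)) (r n) \<subseteq> U" if "0 \<le> t" "t \<le> 1" for t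
        proof -
          have "y + t *\<^sub>R (x - y) \<in> closed_segment y x" unfolding seg using that by auto
          moreover have "cball (y + t *\<^sub>R (x - y)) (r n) \<subseteq> cball (y + t *\<^sub>R (x - y)) \<epsilon>"
            by (rule subset_cball[OF rn])
          ultimately show ?thesis using \<epsilon>(2) by blast
        qed
        from mollify_segment_le[OF g(1) wg _ _ this]
        have "ennreal \<bar>g x - g y\<bar> \<le> ennreal (norm (x - y)) * seg_avg (\<lambda>z. ennreal (\<bar>g1 z\<bar> + \<bar>g2 z\<bar>)) x y
          + (err n g x + err n g y + ennreal (norm (x - y)) * seg_avg (\<lambda>z. err n g1 z + err n g2 z) x y)"
          unfolding err_def by simp
        also have "\<dots> \<le> ennreal (norm (x - y)) * seg_avg (\<lambda>z. ennreal (\<bar>g1 z\<bar> + \<bar>g2 z\<bar>)) x y + e n x y"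
          unfolding e_def using nrm by (intro add_left_mono mult_right_mono ennreal_leI) auto
        finally show ?case .
      qed
    qed
    from ae show ?thesis
    proof eventually_elim
      case (elim y)
      then show ?case by eventually_elim (use pointwise in blast)
    qed
  next
    case False
    then have e: "x \<in> ball (0::plane) R \<longleftrightarrow> False" for x
    proof -
      have "\<not> norm x < R" using False norm_ge_zero[of x] by linarith
      then show ?thesis by simp
    qed
    show ?thesis unfolding e by simp
  qed
  have "AE y in lborel. \<forall>k::nat. AE x in lborel. x \<in> ball 0 (real k) \<longrightarrow> y \<in> ball 0 (real k) \<longrightarrow> closed_segment y x \<subseteq> U \<longrightarrow>
    ennreal \<bar>g x - g y\<bar> \<le> ennreal (norm (x - y)) * seg_avg (\<lambda>z. ennreal (\<bar>g1 z\<bar> + \<bar>g2 z\<bar>)) x y"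
    unfolding AE_all_countable using local by blast
  then show ?thesis
  proof eventually_elim
    case (elim y)
    then have "AE x in lborel. \<forall>k::nat. x \<in> ball 0 (real k) \<longrightarrow> y \<in> ball 0 (real k) \<longrightarrow> closed_segment y x \<subseteq> U \<longrightarrow>
      ennreal \<bar>g x - g y\<bar> \<le> ennreal (norm (x - y)) * seg_avg (\<lambda>z. ennreal (\<bar>g1 z\<bar> + \<bar>g2 z\<bar>)) x y"
      unfolding AE_all_countable .
    then show ?case
    proof eventually_elim
      case (elim x)
      obtain k :: nat where "real k > max (norm x) (norm y)" using reals_Archimedean2 by blast
      then show ?case using elim by auto
    qed
  qed
qed


section \<open>Integrability exponents\<close>

text \<open>The graph of \<open>s powr q\<close> lies above its tangent at \<open>a\<close>; this is Young's inequality.\<close>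

lemma powr_sub_tangent:
  fixes a s q :: real
  assumes "q \<ge> 1" "a \<ge> 0" "s \<ge> 0"
  shows "a powr q + q * a powr (q - 1) * s \<le> s powr q + q * a powr q"
proof (cases "a = 0 \<or> s = 0")
  case True
  have "a powr q \<le> q * a powr q" using assms mult_right_mono[of 1 q "a powr q"] by simp
  then show ?thesis using True by auto
next
  case False
  then have pos: "a > 0" "s > 0" using assms by auto
  have "(s powr q) powr (1/q) * (a powr q) powr (1 - 1/q) \<le> (1/q) * s powr q + (1 - 1/q) * a powr q"
    using assms pos by (intro Youngs_inequality_0) auto
  moreover have "(s powr q) powr (1/q) = s" "(a powr q) powr (1 - 1/q) = a powr (q - 1)"
    using assms pos by (auto simp: powr_powr right_diff_distrib)
  ultimately have "s * a powr (q - 1) \<le> (1/q) * s powr q + (1 - 1/q) * a powr q" by simp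
  then have "q * (s * a powr (q - 1)) \<le> q * ((1/q) * s powr q + (1 - 1/q) * a powr q)"
    using assms by (intro mult_left_mono) auto
  also have "\<dots> = s powr q + (q - 1) * a powr q"
    using assms by (simp add: field_simps)
  finally show ?thesis by (simp add: algebra_simps)
qed

lemma powr_superadd:
  fixes a b q :: real
  assumes "q \<ge> 1" "a \<ge> 0" "b \<ge> 0"
  shows "a powr q + b powr q \<le> (a + b) powr q"
proof -
  have *: "x powr q \<le> x * (a + b) powr (q - 1)" if "x \<ge> 0" "x \<le> a + b" for x
  proof -
    have "x powr q = x * x powr (q - 1)"
      using that powr_mult_base[of x "q - 1"] by simp
    also have "\<dots> \<le> x * (a + b) powr (q - 1)"
      using that assms by (intro mult_left_mono powr_mono2) auto
    finally show ?thesis .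
  qed
  have "a powr q + b powr q \<le> (a + b) * (a + b) powr (q - 1)"
    using *[of a] *[of b] assms by (simp add: distrib_right)
  then show ?thesis using assms powr_mult_base[of "a + b" "q - 1"] by simp
qed

lemma powr_add_le:
  fixes x y q :: real
  assumes "q \<ge> 1"
  shows "\<bar>x + y\<bar> powr q \<le> 2 powr q * (\<bar>x\<bar> powr q + \<bar>y\<bar> powr q)"
proof -
  have "\<bar>x + y\<bar> powr q \<le> (2 * max \<bar>x\<bar> \<bar>y\<bar>) powr q"
    using assms by (intro powr_mono2) auto
  also have "\<dots> = 2 powr q * max \<bar>x\<bar> \<bar>y\<bar> powr q" by (simp add: powr_mult)
  also have "\<dots> \<le> 2 powr q * (\<bar>x\<bar> powr q + \<bar>y\<bar> powr q)"
    by (intro mult_left_mono) (auto simp: max_def)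
  finally show ?thesis .
qed

lemma powr_ge_self:
  fixes t q :: real
  assumes "q \<ge> 1" "t \<ge> 0"
  shows "t \<le> 1 + t powr q"
proof (cases "t \<le> 1")
  case True
  then show ?thesis by (intro order_trans[OF True]) simp
next
  case False
  then have "t powr 1 \<le> t powr q" using assms by (intro powr_mono) auto
  then show ?thesis using False by simp
qed

lemma epow_ennreal: "s \<ge> 0 \<Longrightarrow> epow (ennreal s) r = ennreal (s powr r)"
  by (simp add: epow_def)

lemma epow_top [simp]: "epow top r = top"
  by (simp add: epow_def)

lemma epow_measurable [measurable (raw)]:
  assumes [measurable]: "f \<in> borel_measurable M"
  shows "(\<lambda>x. epow (f x) r) \<in> borel_measurable M"
  unfolding epow_def by measurable

lemma epow_mono:
  assumes "x \<le> y" "r \<ge> 0"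
  shows "epow x r \<le> epow y r"
proof (cases "y = top")
  case False
  then obtain b where b: "y = ennreal b" "b \<ge> 0" by (cases y) auto
  then obtain a where a: "x = ennreal a" "a \<ge> 0" using assms(1) by (cases x) (auto simp: top_unique)
  show ?thesis using a b assms by (auto simp: epow_ennreal intro!: ennreal_leI powr_mono2)
qed simp

text \<open>Jensen's inequality for the power function, by integrating the tangent inequality at the mean. Infinite
  integrals are included.\<close>

lemma nn_integral_epow_jensen:
  assumes M: "emeasure M (space M) = 1" and q: "q \<ge> 1" and [measurable]: "f \<in> borel_measurable M"
  shows "epow (\<integral>\<^sup>+x. f x \<partial>M) q \<le> (\<integral>\<^sup>+x. epow (f x) q \<partial>M)"
proof (cases "(\<integral>\<^sup>+x. f x \<partial>M) = top")
  case True
  have "f x \<le> 1 + epow (f x) q" for x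
  proof (cases "f x")
    case (real r)
    then have "ennreal r \<le> ennreal (1 + r powr q)"
      using powr_ge_self[OF q] by (intro ennreal_leI) auto
    then show ?thesis using real by (simp add: epow_ennreal)
  qed simp
  then have "(\<integral>\<^sup>+x. f x \<partial>M) \<le> (\<integral>\<^sup>+x. 1 + epow (f x) q \<partial>M)"
    by (intro nn_integral_mono)
  also have "\<dots> = 1 + (\<integral>\<^sup>+x. epow (f x) q \<partial>M)"
    by (subst nn_integral_add) (auto simp: M)
  finally have "(\<integral>\<^sup>+x. epow (f x) q \<partial>M) = top" using True by (simp add: top_unique)
  then show ?thesis by simp
next
  case False
  then obtain a where a: "(\<integral>\<^sup>+x. f x \<partial>M) = ennreal a" "a \<ge> 0" by (cases "\<integral>\<^sup>+x. f x \<partial>M") auto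
  let ?c = "ennreal (q * a powr (q - 1))"
  have "ennreal (a powr q) + ?c * f x \<le> epow (f x) q + ennreal (q * a powr q)" for x
  proof (cases "f x")
    case (real r)
    have "ennreal (a powr q) + ?c * ennreal r = ennreal (a powr q + q * a powr (q - 1) * r)"
      using real q by (subst ennreal_mult[symmetric]) auto
    also have "\<dots> \<le> ennreal (r powr q + q * a powr q)"
      using real q a by (intro ennreal_leI powr_sub_tangent) auto
    also have "\<dots> = epow (f x) q + ennreal (q * a powr q)"
      using real q by (simp add: epow_ennreal)
    finally show ?thesis using real by simp
  qed simp
  then have "(\<integral>\<^sup>+x. ennreal (a powr q) + ?c * f x \<partial>M) \<le> (\<integral>\<^sup>+x. epow (f x) q + ennreal (q * a powr q) \<partial>M)"
    by (intro nn_integral_mono)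
  then have "ennreal (a powr q) + ?c * ennreal a \<le> (\<integral>\<^sup>+x. epow (f x) q \<partial>M) + ennreal (q * a powr q)"
    by (simp add: nn_integral_add nn_integral_cmult M a)
  moreover have "?c * ennreal a = ennreal (q * a powr q)"
    using q a powr_mult_base[of a "q - 1"] by (simp add: ennreal_mult[symmetric] mult.assoc mult.commute)
  ultimately have "ennreal (q * a powr q) + ennreal (a powr q) \<le> ennreal (q * a powr q) + (\<integral>\<^sup>+x. epow (f x) q \<partial>M)"
    by (simp only: add.commute)
  then have "ennreal (a powr q) \<le> (\<integral>\<^sup>+x. epow (f x) q \<partial>M)"
    by (subst (asm) ennreal_add_left_cancel_le) auto
  then show ?thesis using a by (simp add: epow_ennreal)
qed

text \<open>\<open>K\<close> is an upper bound for the norm of \<open>f\<close> in \<open>L\<^sub>p(A)\<close>. With real bounds the estimates avoid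
  the case distinctions of extended arithmetic.\<close>

definition Lp_bd :: "ennreal \<Rightarrow> plane set \<Rightarrow> (plane \<Rightarrow> real) \<Rightarrow> real \<Rightarrow> bool" where
  "Lp_bd p A f K \<longleftrightarrow> (if p = \<infinity> then AE x in lborel. x \<in> A \<longrightarrow> \<bar>f x\<bar> \<le> K
     else (\<integral>\<^sup>+x. ennreal (\<bar>f x\<bar> powr enn2real p) * indicator A x \<partial>lborel) \<le> ennreal (K powr enn2real p))"

lemma Lp_bd_infinity: "Lp_bd \<infinity> A f K \<longleftrightarrow> (AE x in lborel. x \<in> A \<longrightarrow> \<bar>f x\<bar> \<le> K)"
  by (simp add: Lp_bd_def)

lemma Lp_bd_finite: "p \<noteq> \<infinity> \<Longrightarrow> Lp_bd p A f K \<longleftrightarrow>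
   (\<integral>\<^sup>+x. ennreal (\<bar>f x\<bar> powr enn2real p) * indicator A x \<partial>lborel) \<le> ennreal (K powr enn2real p)"
  by (simp add: Lp_bd_def)

lemma enn2real_ge_1: "1 \<le> p \<Longrightarrow> p \<noteq> \<infinity> \<Longrightarrow> 1 \<le> enn2real p"
  by (cases p) (auto simp flip: ennreal_1)

lemma Lp_bd_mono:
  assumes f: "Lp_bd p B f K" and A: "A \<subseteq> B" and g: "AE x in lborel. x \<in> A \<longrightarrow> \<bar>g x\<bar> \<le> \<bar>f x\<bar>"
    and K: "0 \<le> K" "K \<le> L"
  shows "Lp_bd p A g L"
proof (cases "p = \<infinity>")
  case True
  have "AE x in lborel. x \<in> B \<longrightarrow> \<bar>f x\<bar> \<le> K" using f unfolding True Lp_bd_infinity .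
  with g have "AE x in lborel. x \<in> A \<longrightarrow> \<bar>g x\<bar> \<le> L"
    by eventually_elim (use A K in force)
  then show ?thesis unfolding True Lp_bd_infinity .
next
  case False
  let ?q = "enn2real p"
  have "(\<integral>\<^sup>+x. ennreal (\<bar>g x\<bar> powr ?q) * indicator A x \<partial>lborel) \<le> (\<integral>\<^sup>+x. ennreal (\<bar>f x\<bar> powr ?q) * indicator B x \<partial>lborel)"
  proof (rule nn_integral_mono_AE)
    show "AE x in lborel. ennreal (\<bar>g x\<bar> powr ?q) * indicator A x \<le> ennreal (\<bar>f x\<bar> powr ?q) * indicator B x"
      using g by eventually_elim (use A in \<open>auto simp: indicator_def intro!: ennreal_leI powr_mono2\<close>)
  qed
  also have "\<dots> \<le> ennreal (K powr ?q)" using f False by (simp add: Lp_bd_finite)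
  also have "\<dots> \<le> ennreal (L powr ?q)" using K by (intro ennreal_leI powr_mono2) auto
  finally show ?thesis using False by (simp add: Lp_bd_finite)
qed

lemma Lp_bd_add:
  assumes p: "1 \<le> p" and f: "Lp_bd p A f K" and g: "Lp_bd p A g L" and K: "0 \<le> K" "0 \<le> L"
    and [measurable]: "f \<in> borel_measurable borel" "g \<in> borel_measurable borel" "A \<in> sets borel"
  shows "Lp_bd p A (\<lambda>x. f x + g x) (2 * (K + L))"
proof (cases "p = \<infinity>")
  case True
  have "AE x in lborel. x \<in> A \<longrightarrow> \<bar>f x\<bar> \<le> K" "AE x in lborel. x \<in> A \<longrightarrow> \<bar>g x\<bar> \<le> L"
    using f g unfolding True Lp_bd_infinity by blast+
  then have "AE x in lborel. x \<in> A \<longrightarrow> \<bar>f x + g x\<bar> \<le> 2 * (K + L)"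
    by eventually_elim (use K in force)
  then show ?thesis unfolding True Lp_bd_infinity .
next
  case False
  let ?q = "enn2real p"
  have q: "?q \<ge> 1" using enn2real_ge_1[OF p False] .
  let ?I = "indicator A :: plane \<Rightarrow> ennreal"
  have "(\<integral>\<^sup>+x. ennreal (\<bar>f x + g x\<bar> powr ?q) * ?I x \<partial>lborel)
    \<le> (\<integral>\<^sup>+x. ennreal (2 powr ?q) * (ennreal (\<bar>f x\<bar> powr ?q) * ?I x + ennreal (\<bar>g x\<bar> powr ?q) * ?I x) \<partial>lborel)"
  proof (rule nn_integral_mono)
    fix x
    have "ennreal (\<bar>f x + g x\<bar> powr ?q) \<le> ennreal (2 powr ?q * (\<bar>f x\<bar> powr ?q + \<bar>g x\<bar> powr ?q))"
      by (intro ennreal_leI powr_add_le q)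
    also have "\<dots> = ennreal (2 powr ?q) * (ennreal (\<bar>f x\<bar> powr ?q) + ennreal (\<bar>g x\<bar> powr ?q))"
      by (simp add: ennreal_mult)
    finally show "ennreal (\<bar>f x + g x\<bar> powr ?q) * ?I x
        \<le> ennreal (2 powr ?q) * (ennreal (\<bar>f x\<bar> powr ?q) * ?I x + ennreal (\<bar>g x\<bar> powr ?q) * ?I x)"
      by (auto simp: indicator_def)
  qed
  also have "\<dots> = ennreal (2 powr ?q) * ((\<integral>\<^sup>+x. ennreal (\<bar>f x\<bar> powr ?q) * ?I x \<partial>lborel)
      + (\<integral>\<^sup>+x. ennreal (\<bar>g x\<bar> powr ?q) * ?I x \<partial>lborel))"
    by (simp add: nn_integral_cmult nn_integral_add)
  also have "\<dots> \<le> ennreal (2 powr ?q) * (ennreal (K powr ?q) + ennreal (L powr ?q))"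
    using f g False by (intro mult_left_mono add_mono) (simp_all add: Lp_bd_finite)
  also have "\<dots> = ennreal (2 powr ?q * (K powr ?q + L powr ?q))"
    by (simp add: ennreal_mult)
  also have "\<dots> \<le> ennreal ((2 * (K + L)) powr ?q)"
    using powr_superadd[OF q K] by (intro ennreal_leI) (simp only: powr_mult mult_left_mono powr_ge_zero)
  finally show ?thesis using False by (simp add: Lp_bd_finite)
qed

lemma Lp_bd_union:
  assumes p: "1 \<le> p" and f: "Lp_bd p A f K" and g: "Lp_bd p B f L" and K: "0 \<le> K" "0 \<le> L"
    and [measurable]: "f \<in> borel_measurable borel" "A \<in> sets borel" "B \<in> sets borel"
  shows "Lp_bd p (A \<union> B) f (K + L)"
proof (cases "p = \<infinity>")
  case True
  have "AE x in lborel. x \<in> A \<longrightarrow> \<bar>f x\<bar> \<le> K" "AE x in lborel. x \<in> B \<longrightarrow> \<bar>f x\<bar> \<le> L"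
    using f g unfolding True Lp_bd_infinity by blast+
  then have "AE x in lborel. x \<in> A \<union> B \<longrightarrow> \<bar>f x\<bar> \<le> K + L"
    by eventually_elim (use K in force)
  then show ?thesis unfolding True Lp_bd_infinity .
next
  case False
  let ?q = "enn2real p"
  have q: "?q \<ge> 1" using enn2real_ge_1[OF p False] .
  have "(\<integral>\<^sup>+x. ennreal (\<bar>f x\<bar> powr ?q) * indicator (A \<union> B) x \<partial>lborel)
    \<le> (\<integral>\<^sup>+x. ennreal (\<bar>f x\<bar> powr ?q) * indicator A x + ennreal (\<bar>f x\<bar> powr ?q) * indicator B x \<partial>lborel)"
    by (intro nn_integral_mono) (auto simp: indicator_def)
  also have "\<dots> = (\<integral>\<^sup>+x. ennreal (\<bar>f x\<bar> powr ?q) * indicator A x \<partial>lborel)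
      + (\<integral>\<^sup>+x. ennreal (\<bar>f x\<bar> powr ?q) * indicator B x \<partial>lborel)"
    by (rule nn_integral_add) auto
  also have "\<dots> \<le> ennreal (K powr ?q) + ennreal (L powr ?q)"
    using f g False by (intro add_mono) (simp_all add: Lp_bd_finite)
  also have "\<dots> = ennreal (K powr ?q + L powr ?q)" by simp
  also have "\<dots> \<le> ennreal ((K + L) powr ?q)"
    using powr_superadd[OF q K] by (intro ennreal_leI) simp
  finally show ?thesis using False by (simp add: Lp_bd_finite)
qed

lemma Lp_bd_const:
  assumes p: "1 \<le> p" and A: "A \<in> sets borel" "emeasure lborel A = ennreal m" "m \<ge> 0"
  shows "Lp_bd p A (\<lambda>_. c) (\<bar>c\<bar> * (1 + m))"
proof (cases "p = \<infinity>")
  case True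
  then show ?thesis using A(3) mult_left_mono[of 1 "1 + m" "\<bar>c\<bar>"] unfolding True Lp_bd_infinity by simp
next
  case False
  let ?q = "enn2real p"
  have q: "?q \<ge> 1" using enn2real_ge_1[OF p False] .
  have "(\<integral>\<^sup>+x. ennreal (\<bar>c\<bar> powr ?q) * indicator A x \<partial>lborel) = ennreal (\<bar>c\<bar> powr ?q * m)"
    using A by (simp add: nn_integral_cmult_indicator ennreal_mult)
  also have "\<dots> \<le> ennreal (\<bar>c\<bar> powr ?q * (1 + m) powr ?q)"
  proof (intro ennreal_leI mult_left_mono)
    have "(1 + m) powr 1 \<le> (1 + m) powr ?q" using q A by (intro powr_mono) auto
    then show "m \<le> (1 + m) powr ?q" using A(3) by simp
  qed simp
  finally show ?thesis using False by (simp add: Lp_bd_finite powr_mult)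
qed

text \<open>For \<open>p < \<infinity>\<close> the sharp bound is \<open>\<bar>c\<bar> \<le> m powr (-1/p) * K\<close>; the factor \<open>1 + 1/m\<close> serves all
  exponents.\<close>

lemma Lp_bd_const_le:
  assumes p: "1 \<le> p" and A: "A \<in> sets borel" "emeasure lborel A = ennreal m" "m > 0"
    and c: "Lp_bd p A (\<lambda>_. c) K" and K: "K \<ge> 0"
  shows "\<bar>c\<bar> \<le> (1 + 1/m) * K"
proof (cases "p = \<infinity>")
  case True
  have "\<bar>c\<bar> \<le> K"
  proof (rule ccontr)
    assume "\<not> \<bar>c\<bar> \<le> K"
    then have "AE x in lborel. x \<notin> A" using c unfolding True Lp_bd_infinity by simp
    then have "A \<in> null_sets lborel"
      using A(1) by (simp add: AE_iff_null_sets)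
    then show False using A by (auto simp: null_sets_def)
  qed
  moreover have "1 * K \<le> (1 + 1/m) * K" using K A(3) by (intro mult_right_mono) auto
  ultimately show ?thesis by simp
next
  case False
  let ?q = "enn2real p"
  have q: "?q \<ge> 1" using enn2real_ge_1[OF p False] .
  show ?thesis
  proof (rule ccontr)
    assume "\<not> \<bar>c\<bar> \<le> (1 + 1/m) * K"
    then have lt: "(1 + 1/m) * K < \<bar>c\<bar>" by simp
    have "ennreal (\<bar>c\<bar> powr ?q * m) \<le> ennreal (K powr ?q)"
      using c False A by (simp add: Lp_bd_finite nn_integral_cmult_indicator ennreal_mult)
    then have "\<bar>c\<bar> powr ?q * m \<le> K powr ?q" by (simp add: ennreal_le_iff)
    moreover have "((1 + 1/m) * K) powr ?q < \<bar>c\<bar> powr ?q"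
      using lt q K A by (intro powr_less_mono2) auto
    moreover have "(1 + 1/m) * K powr ?q \<le> ((1 + 1/m) * K) powr ?q"
    proof -
      have "(1 + 1/m) powr 1 \<le> (1 + 1/m) powr ?q" using q A by (intro powr_mono) auto
      then show ?thesis using A by (simp add: powr_mult mult_right_mono)
    qed
    ultimately have "(1 + 1/m) * K powr ?q * m < K powr ?q"
      using A(3) by (smt (verit) mult_strict_right_mono)
    moreover have "(1 + 1/m) * K powr ?q * m = (m + 1) * K powr ?q"
      using A(3) by (simp add: field_simps)
    moreover have "K powr ?q \<le> (m + 1) * K powr ?q"
      using A(3) mult_right_mono[of 1 "m + 1" "K powr ?q"] by simp
    ultimately show False by simp
  qed
qed

text \<open>After scaling to \<open>K = 1\<close> the claim follows from \<open>t \<le> 1 + t powr q\<close>, which replaces Hoelder's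
  inequality.\<close>

lemma Lp_bd_L1:
  assumes p: "1 \<le> p" and A: "A \<in> sets borel" "emeasure lborel A = ennreal m" "m \<ge> 0"
    and f: "Lp_bd p A f K" and K: "K \<ge> 0" and [measurable]: "f \<in> borel_measurable borel"
  shows "(\<integral>\<^sup>+x. ennreal \<bar>f x\<bar> * indicator A x \<partial>lborel) \<le> ennreal (K * (1 + m))"
proof -
  note [measurable] = A(1)
  have ae: "(\<integral>\<^sup>+x. ennreal \<bar>f x\<bar> * indicator A x \<partial>lborel) \<le> ennreal (K * (1 + m))"
    if "AE x in lborel. x \<in> A \<longrightarrow> \<bar>f x\<bar> \<le> K"
  proof -
    have "(\<integral>\<^sup>+x. ennreal \<bar>f x\<bar> * indicator A x \<partial>lborel) \<le> (\<integral>\<^sup>+x. ennreal K * indicator A x \<partial>lborel)"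
    proof (rule nn_integral_mono_AE)
      show "AE x in lborel. ennreal \<bar>f x\<bar> * indicator A x \<le> ennreal K * indicator A x"
        using that by eventually_elim (auto simp: indicator_def intro!: ennreal_leI)
    qed
    also have "\<dots> = ennreal (K * m)" using A K by (simp add: nn_integral_cmult_indicator ennreal_mult)
    also have "\<dots> \<le> ennreal (K * (1 + m))" using K by (intro ennreal_leI mult_left_mono) auto
    finally show ?thesis .
  qed
  show ?thesis
  proof (cases "p = \<infinity>")
    case True
    show ?thesis by (rule ae) (use f in \<open>unfold True Lp_bd_infinity\<close>)
  next
    case False
    let ?q = "enn2real p"
    have q: "?q \<ge> 1" using enn2real_ge_1[OF p False] .
    have fq: "(\<integral>\<^sup>+x. ennreal (\<bar>f x\<bar> powr ?q) * indicator A x \<partial>lborel) \<le> ennreal (K powr ?q)"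
      using f False by (simp add: Lp_bd_finite)
    show ?thesis
    proof (cases "K = 0")
      case True
      then have "AE x in lborel. ennreal (\<bar>f x\<bar> powr ?q) * indicator A x = 0"
        using fq by (subst nn_integral_0_iff_AE[symmetric]) auto
      then have "AE x in lborel. x \<in> A \<longrightarrow> \<bar>f x\<bar> \<le> K"
        by eventually_elim (use K in \<open>auto simp: indicator_def split: if_splits\<close>)
      then show ?thesis by (rule ae)
    next
      case False
      then have K0: "K > 0" using K by simp
      have "(\<integral>\<^sup>+x. ennreal \<bar>f x\<bar> * indicator A x \<partial>lborel)
        \<le> (\<integral>\<^sup>+x. ennreal K * indicator A x + ennreal (K / K powr ?q) * (ennreal (\<bar>f x\<bar> powr ?q) * indicator A x) \<partial>lborel)"
      proof (rule nn_integral_mono)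
        fix x
        have "\<bar>f x\<bar> / K \<le> 1 + (\<bar>f x\<bar> / K) powr ?q" using K0 q by (intro powr_ge_self) auto
        then have "\<bar>f x\<bar> \<le> K * (1 + \<bar>f x\<bar> powr ?q / K powr ?q)"
          using K0 by (simp add: powr_divide pos_divide_le_eq mult.commute)
        then have "ennreal \<bar>f x\<bar> \<le> ennreal (K + K / K powr ?q * \<bar>f x\<bar> powr ?q)"
          by (intro ennreal_leI) (simp add: distrib_left)
        also have "\<dots> = ennreal K + ennreal (K / K powr ?q) * ennreal (\<bar>f x\<bar> powr ?q)"
          using K0 by (simp add: ennreal_mult[symmetric])
        finally show "ennreal \<bar>f x\<bar> * indicator A x \<le> ennreal K * indicator A x + ennreal (K / K powr ?q) * (ennreal (\<bar>f x\<bar> powr ?q) * indicator A x)"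
          by (auto simp: indicator_def)
      qed
      also have "\<dots> = ennreal K * emeasure lborel A + ennreal (K / K powr ?q) * (\<integral>\<^sup>+x. ennreal (\<bar>f x\<bar> powr ?q) * indicator A x \<partial>lborel)"
        by (simp add: nn_integral_add nn_integral_cmult nn_integral_cmult_indicator)
      also have "\<dots> \<le> ennreal K * ennreal m + ennreal (K / K powr ?q) * ennreal (K powr ?q)"
        using fq A by (intro add_mono mult_left_mono) auto
      also have "\<dots> = ennreal (K * m + K)"
        using K0 A by (simp add: ennreal_mult[symmetric])
      finally show ?thesis by (simp add: algebra_simps)
    qed
  qed
qed

lemma Lp_bd_cmult:
  assumes f: "Lp_bd p A f K" and K: "0 \<le> K" and [measurable]: "f \<in> borel_measurable borel" "A \<in> sets borel"
  shows "Lp_bd p A (\<lambda>x. c * f x) (\<bar>c\<bar> * K)"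
proof (cases "p = \<infinity>")
  case True
  have "AE x in lborel. x \<in> A \<longrightarrow> \<bar>f x\<bar> \<le> K" using f unfolding True Lp_bd_infinity .
  then have "AE x in lborel. x \<in> A \<longrightarrow> \<bar>c * f x\<bar> \<le> \<bar>c\<bar> * K"
    by eventually_elim (auto simp: abs_mult intro!: mult_left_mono)
  then show ?thesis unfolding True Lp_bd_infinity .
next
  case False
  let ?q = "enn2real p"
  have "(\<integral>\<^sup>+x. ennreal (\<bar>c * f x\<bar> powr ?q) * indicator A x \<partial>lborel)
      = (\<integral>\<^sup>+x. ennreal (\<bar>c\<bar> powr ?q) * (ennreal (\<bar>f x\<bar> powr ?q) * indicator A x) \<partial>lborel)"
    by (intro nn_integral_cong) (auto simp: indicator_def abs_mult powr_mult ennreal_mult)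
  also have "\<dots> = ennreal (\<bar>c\<bar> powr ?q) * (\<integral>\<^sup>+x. ennreal (\<bar>f x\<bar> powr ?q) * indicator A x \<partial>lborel)"
    by (rule nn_integral_cmult) measurable
  also have "\<dots> \<le> ennreal (\<bar>c\<bar> powr ?q) * ennreal (K powr ?q)"
    using f False by (intro mult_left_mono) (simp_all add: Lp_bd_finite)
  also have "\<dots> = ennreal ((\<bar>c\<bar> * K) powr ?q)" by (simp add: powr_mult ennreal_mult)
  finally show ?thesis using False by (simp add: Lp_bd_finite)
qed


section \<open>The Poincare inequality\<close>

text \<open>\<open>L\<close> is an upper bound for the norm of the weak gradient of \<open>g\<close> in \<open>L\<^sub>p(U)\<close>.\<close>

definition grad_bd :: "ennreal \<Rightarrow> plane set \<Rightarrow> (plane \<Rightarrow> real) \<Rightarrow> real \<Rightarrow> bool" where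
  "grad_bd p U g L \<longleftrightarrow> 0 \<le> L \<and> integrable lborel g \<and> (\<exists>g1 g2. integrable lborel g1 \<and>
     integrable lborel g2 \<and> weak_grad U g g1 g2 \<and> Lp_bd p U (\<lambda>x. \<bar>g1 x\<bar> + \<bar>g2 x\<bar>) L)"

text \<open>The gradient is measured on all of \<open>U\<close>, the oscillation only on \<open>A\<close>: segments between points of
  \<open>A\<close> may leave \<open>A\<close>.\<close>

definition poincare_on :: "ennreal \<Rightarrow> plane set \<Rightarrow> plane set \<Rightarrow> bool" where
  "poincare_on p U A \<longleftrightarrow> (\<exists>K\<ge>0. \<forall>g L. grad_bd p U g L \<longrightarrow> (\<exists>c. Lp_bd p A (\<lambda>x. g x - c) (K * L)))"

lemma AE_exists_in:
  assumes "AE y in lborel. P y" "B \<in> sets borel" "emeasure lborel B \<noteq> 0"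
  shows "\<exists>y\<in>B. P y"
proof (rule ccontr)
  assume "\<not> (\<exists>y\<in>B. P y)"
  then have "AE y in lborel. y \<notin> B" using assms(1) by (auto elim: eventually_mono)
  then have "B \<in> null_sets lborel" using assms(2) by (simp add: AE_iff_null_sets)
  then show False using assms(3) by (auto simp: null_sets_def)
qed

text \<open>Otherwise \<open>\<phi> - \<kappa>\<close> would be positive on \<open>B\<close> and have a vanishing integral.\<close>

lemma exists_le_average:
  fixes \<phi> :: "'a::euclidean_space \<Rightarrow> ennreal"
  assumes B: "B \<in> sets borel" "emeasure lborel B = ennreal b" "b > 0"
    and [measurable]: "\<phi> \<in> borel_measurable borel"
    and int: "(\<integral>\<^sup>+y. \<phi> y * indicator B y \<partial>lborel) \<le> ennreal (\<kappa> * b)" and \<kappa>: "\<kappa> \<ge> 0"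
  shows "\<exists>y\<in>B. \<phi> y \<le> ennreal \<kappa>"
proof (rule ccontr)
  note [measurable] = B(1)
  assume "\<not> (\<exists>y\<in>B. \<phi> y \<le> ennreal \<kappa>)"
  then have gt: "\<And>y. y \<in> B \<Longrightarrow> ennreal \<kappa> < \<phi> y" by (auto simp: not_le)
  have c: "(\<integral>\<^sup>+y. ennreal \<kappa> * indicator B y \<partial>lborel) = ennreal (\<kappa> * b)"
    using B \<kappa> by (simp add: nn_integral_cmult_indicator ennreal_mult)
  have "(\<integral>\<^sup>+y. \<phi> y * indicator B y - ennreal \<kappa> * indicator B y \<partial>lborel)
      = (\<integral>\<^sup>+y. \<phi> y * indicator B y \<partial>lborel) - (\<integral>\<^sup>+y. ennreal \<kappa> * indicator B y \<partial>lborel)"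
  proof (rule nn_integral_diff)
    show "AE y in lborel. ennreal \<kappa> * indicator B y \<le> \<phi> y * indicator B y"
      using gt by (auto simp: indicator_def intro: less_imp_le)
  qed (use c in auto)
  also have "\<dots> = 0" unfolding c using int by (intro diff_eq_0_ennreal) (auto intro: order_le_less_trans[OF _ ennreal_less_top])
  finally have "AE y in lborel. \<phi> y * indicator B y - ennreal \<kappa> * indicator B y = 0"
    by (subst (asm) nn_integral_0_iff_AE) auto
  then obtain y where y: "y \<in> B" "\<phi> y * indicator B y - ennreal \<kappa> * indicator B y = 0"
    using AE_exists_in[OF _ B(1)] B by fastforce
  then have "\<phi> y - ennreal \<kappa> \<le> 0" by simp
  then have "\<phi> y \<le> ennreal \<kappa>" unfolding ennreal_minus_le_iff by simp
  then show False using gt[OF y(1)] by simp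
qed

lemma seg_avg_cong:
  assumes "\<And>z. z \<in> closed_segment y x \<Longrightarrow> F z = G z"
  shows "seg_avg F x y = seg_avg G x y"
  unfolding seg_avg_def
proof (rule nn_integral_cong)
  fix t :: real
  have "y + t *\<^sub>R (x - y) \<in> closed_segment y x" if "t \<in> {0..1}"
    unfolding closed_segment_def using that by (auto simp: algebra_simps intro!: exI[of _ t])
  then show "F (y + t *\<^sub>R (x - y)) * indicator {0..1} t = G (y + t *\<^sub>R (x - y)) * indicator {0..1} t"
    using assms by (cases "t \<in> {0..1}") auto
qed

lemma seg_avg_epow_le:
  assumes [measurable]: "F \<in> borel_measurable borel" and q: "q \<ge> 1"
  shows "epow (seg_avg F x y) q \<le> seg_avg (\<lambda>z. epow (F z) q) x y"
proof -
  let ?M = "restrict_space lborel {0..1::real}"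
  have eq: "seg_avg H x y = (\<integral>\<^sup>+t. H (y + t *\<^sub>R (x - y)) \<partial>?M)" for H
    unfolding seg_avg_def by (subst nn_integral_restrict_space) auto
  have meas: "(\<lambda>t. F (y + t *\<^sub>R (x - y))) \<in> borel_measurable ?M"
    by (rule measurable_restrict_space1) measurable
  have "emeasure ?M (space ?M) = 1"
    by (simp add: space_restrict_space emeasure_restrict_space)
  from nn_integral_epow_jensen[OF this q meas] show ?thesis unfolding eq .
qed

lemma epow_cmult: "c > 0 \<Longrightarrow> epow (ennreal c * x) q = ennreal (c powr q) * epow x q"
  by (cases x) (auto simp: ennreal_mult[symmetric] epow_ennreal powr_mult ennreal_mult_top)

lemma bounded_diameter:
  fixes U :: "plane set"
  assumes "bounded U"
  obtains D where "D > 0" "\<And>x y. x \<in> U \<Longrightarrow> y \<in> U \<Longrightarrow> norm (x - y) \<le> D"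
proof -
  obtain b where b: "\<And>x. x \<in> U \<Longrightarrow> norm x \<le> b" using assms unfolding bounded_iff by blast
  have "norm (x - y) \<le> 2 * \<bar>b\<bar> + 1" if "x \<in> U" "y \<in> U" for x y
    using norm_triangle_ineq4[of x y] b[OF that(1)] b[OF that(2)] by linarith
  then show ?thesis by (intro that[of "2 * \<bar>b\<bar> + 1"]) auto
qed

lemma emeasure_bounded_real:
  fixes A :: "'a::euclidean_space set"
  assumes "bounded A"
  obtains m where "m \<ge> 0" "emeasure lborel A = ennreal m"
  using emeasure_bounded_finite[OF assms] by (cases "emeasure lborel A") auto

lemma open_emeasure_nonzero:
  fixes B :: "plane set"
  assumes "open B" "B \<noteq> {}"
  shows "emeasure lborel B \<noteq> 0"
proof
  assume "emeasure lborel B = 0"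
  then have "B \<in> null_sets lborel" using assms by (auto simp: null_sets_def)
  then have "negligible B" by (simp add: negligible_iff_null_sets null_sets_completionI)
  then show False using open_not_negligible[of B] assms by auto
qed

text \<open>The constant \<open>c\<close> is the value of \<open>g\<close> at a suitable point \<open>y\<close> of \<open>B\<close>. For \<open>p < \<infinity>\<close> the
  segment inequality is raised to the power \<open>p\<close> by Jensen and integrated over \<open>A \<times> B\<close>, and \<open>y\<close> is chosen such
  that the inner integral is at most its average. For \<open>p = \<infinity>\<close> the null set on which the gradient
  exceeds its bound meets almost no segment in a set of positive length.\<close>

lemma poincare_on_visible:
  assumes p: "1 \<le> p" and U: "open U" "bounded U" and A: "A \<in> sets borel"
    and B: "B \<in> sets borel" "emeasure lborel B \<noteq> 0"
    and vis: "\<And>x y. x \<in> A \<Longrightarrow> y \<in> B \<Longrightarrow> closed_segment y x \<subseteq> U"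
  shows "poincare_on p U A"
proof (cases "A = {}")
  case True
  then show ?thesis unfolding poincare_on_def Lp_bd_def by (intro exI[of _ 0]) auto
next
  case False
  then have BU: "B \<subseteq> U" using vis by fastforce
  have "B \<noteq> {}" using B by auto
  then have AU: "A \<subseteq> U" using vis by fastforce
  note [measurable] = A B(1) borel_open[OF U(1)]
  obtain D where D: "D > 0" "\<And>x y. x \<in> U \<Longrightarrow> y \<in> U \<Longrightarrow> norm (x - y) \<le> D"
    using bounded_diameter[OF U(2)] by blast
  obtain u where u: "u \<ge> 0" "emeasure lborel U = ennreal u" using emeasure_bounded_real[OF U(2)] by blast
  obtain b where b: "b \<ge> 0" "emeasure lborel B = ennreal b"
    using emeasure_bounded_real[OF bounded_subset[OF U(2) BU]] by blast
  have b0: "b > 0" using b B(2) by (cases "b = 0") auto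
  let ?I = "indicator U :: plane \<Rightarrow> ennreal"
  have base: "AE y in lborel. AE x in lborel. x \<in> A \<longrightarrow> y \<in> B \<longrightarrow>
      ennreal \<bar>g x - g y\<bar> \<le> ennreal D * seg_avg (\<lambda>z. ennreal (\<bar>g1 z\<bar> + \<bar>g2 z\<bar>) * ?I z) x y"
    if g: "integrable lborel g" "integrable lborel g1" "integrable lborel g2" "weak_grad U g g1 g2" for g g1 g2
    using segment_inequality[OF U(1) g]
  proof eventually_elim
    case (elim y)
    then show ?case
    proof eventually_elim
      case (elim x)
      show ?case
      proof (intro impI)
        assume xy: "x \<in> A" "y \<in> B"
        note s = vis[OF xy]
        have "ennreal \<bar>g x - g y\<bar> \<le> ennreal (norm (x - y)) * seg_avg (\<lambda>z. ennreal (\<bar>g1 z\<bar> + \<bar>g2 z\<bar>)) x y"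
          using elim s by blast
        also have "seg_avg (\<lambda>z. ennreal (\<bar>g1 z\<bar> + \<bar>g2 z\<bar>)) x y = seg_avg (\<lambda>z. ennreal (\<bar>g1 z\<bar> + \<bar>g2 z\<bar>) * ?I z) x y"
          by (rule seg_avg_cong) (use s in auto)
        also have "ennreal (norm (x - y)) * \<dots> \<le> ennreal D * \<dots>"
          using D(2)[of x y] xy AU BU by (intro mult_right_mono ennreal_leI) auto
        finally show "ennreal \<bar>g x - g y\<bar> \<le> ennreal D * seg_avg (\<lambda>z. ennreal (\<bar>g1 z\<bar> + \<bar>g2 z\<bar>) * ?I z) x y" .
      qed
    qed
  qed
  show ?thesis
  proof (cases "p = \<infinity>")
    case True
    show ?thesis unfolding poincare_on_def
    proof (rule exI[of _ D], intro conjI allI impI)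
      fix g L assume "grad_bd p U g L"
      then obtain g1 g2 where g: "integrable lborel g" "integrable lborel g1" "integrable lborel g2" "weak_grad U g g1 g2"
        and L: "0 \<le> L" "Lp_bd p U (\<lambda>x. \<bar>g1 x\<bar> + \<bar>g2 x\<bar>) L"
        unfolding grad_bd_def by blast
      have [measurable]: "g \<in> borel_measurable borel" "g1 \<in> borel_measurable borel" "g2 \<in> borel_measurable borel"
        using g by auto
      \<comment> \<open>The exceptional null set of the gradient bound, seen by almost no segment.\<close>
      let ?F = "indicator {x\<in>U. L < \<bar>g1 x\<bar> + \<bar>g2 x\<bar>} :: plane \<Rightarrow> ennreal"
      have [measurable]: "?F \<in> borel_measurable borel"
        by measurable
      have "AE x in lborel. ?F x = 0"
        using L(2) unfolding True Lp_bd_infinity by eventually_elim (auto simp: indicator_def)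
      then have F0: "(\<integral>\<^sup>+x. ?F x \<partial>lborel) = 0"
        by (subst nn_integral_0_iff_AE) auto
      have [measurable]: "(\<lambda>x. seg_avg ?F x y) \<in> borel_measurable borel" for y
        by (rule seg_avg_measurable) measurable
      have [measurable]: "(\<lambda>p. seg_avg ?F (snd p) (fst p)) \<in> borel_measurable (borel \<Otimes>\<^sub>M borel)"
        by (rule seg_avg_measurable) measurable
      have "(\<integral>\<^sup>+y. \<integral>\<^sup>+x. seg_avg ?F x y * ?I x * ?I y \<partial>lborel \<partial>lborel) = 0"
        using seg_avg_integral_le[of ?F U] F0 by simp
      then have "AE y in lborel. (\<integral>\<^sup>+x. seg_avg ?F x y * ?I x * ?I y \<partial>lborel) = 0"
        by (subst (asm) nn_integral_0_iff_AE) measurable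
      then have ae0: "AE y in lborel. AE x in lborel. seg_avg ?F x y * ?I x * ?I y = 0"
      proof eventually_elim
        case (elim y)
        then show ?case by (subst (asm) nn_integral_0_iff_AE) auto
      qed
      have "AE y in lborel. AE x in lborel. x \<in> A \<longrightarrow> y \<in> B \<longrightarrow> \<bar>g x - g y\<bar> \<le> D * L"
        using base[OF g] ae0
      proof eventually_elim
        case (elim y)
        from elim show ?case
        proof eventually_elim
          case (elim x)
          show ?case
          proof (intro impI)
            assume xy: "x \<in> A" "y \<in> B"
            then have F: "seg_avg ?F x y = 0" using elim(2) AU BU by auto
            have "seg_avg (\<lambda>z. ennreal (\<bar>g1 z\<bar> + \<bar>g2 z\<bar>) * ?I z) x y \<le> seg_avg (\<lambda>z. ennreal L + top * ?F z) x y"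
            proof (rule seg_avg_mono)
              fix z
              \<comment> \<open>On the exceptional set nothing is known; there the bound is infinite.\<close>
              show "ennreal (\<bar>g1 z\<bar> + \<bar>g2 z\<bar>) * ?I z \<le> ennreal L + top * ?F z"
                by (cases "z \<in> U"; cases "L < \<bar>g1 z\<bar> + \<bar>g2 z\<bar>") (auto simp del: ennreal_plus intro!: ennreal_leI)
            qed
            also have "\<dots> = seg_avg (\<lambda>z. ennreal L) x y + seg_avg (\<lambda>z. top * ?F z) x y"
              by (rule seg_avg_add) measurable
            also have "seg_avg (\<lambda>z. ennreal L) x y = ennreal L"
              by (simp add: seg_avg_def nn_integral_cmult_indicator)
            also have "seg_avg (\<lambda>z. top * ?F z) x y = top * seg_avg ?F x y"
              unfolding seg_avg_def by (subst nn_integral_cmult[symmetric]) (auto simp: mult.assoc)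
            finally have "seg_avg (\<lambda>z. ennreal (\<bar>g1 z\<bar> + \<bar>g2 z\<bar>) * ?I z) x y \<le> ennreal L" using F by simp
            then have "ennreal D * seg_avg (\<lambda>z. ennreal (\<bar>g1 z\<bar> + \<bar>g2 z\<bar>) * ?I z) x y \<le> ennreal D * ennreal L"
              by (rule mult_left_mono) simp
            then have "ennreal \<bar>g x - g y\<bar> \<le> ennreal (D * L)"
              using elim(1) xy D(1) L(1) by (auto simp: ennreal_mult)
            then show "\<bar>g x - g y\<bar> \<le> D * L" using D(1) L(1) by (simp add: ennreal_le_iff)
          qed
        qed
      qed
      from AE_exists_in[OF this B] obtain y where "y \<in> B"
        "AE x in lborel. x \<in> A \<longrightarrow> y \<in> B \<longrightarrow> \<bar>g x - g y\<bar> \<le> D * L" by blast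
      then show "\<exists>c. Lp_bd p A (\<lambda>x. g x - c) (D * L)"
        unfolding True Lp_bd_infinity by (intro exI[of _ "g y"]) simp
    qed (use D in simp)
  next
    case False
    let ?q = "enn2real p"
    have q: "?q \<ge> 1" using enn2real_ge_1[OF p False] .
    \<comment> \<open>\<open>4 * u\<close> comes from \<open>seg_avg_integral_le\<close>, and \<open>b\<close> from averaging over \<open>B\<close>.\<close>
    define K where "K = D * (4 * u / b) powr (1 / ?q)"
    have Kq: "(K * L) powr ?q = D powr ?q * (4 * u / b) * L powr ?q" for L
      using q u(1) b0 by (simp add: K_def powr_mult powr_powr powr_one)
    show ?thesis unfolding poincare_on_def
    proof (rule exI[of _ K], intro conjI allI impI)
      show "0 \<le> K" using D(1) by (simp add: K_def)
      fix g L assume "grad_bd p U g L"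
      then obtain g1 g2 where g: "integrable lborel g" "integrable lborel g1" "integrable lborel g2" "weak_grad U g g1 g2"
        and L: "0 \<le> L" "Lp_bd p U (\<lambda>x. \<bar>g1 x\<bar> + \<bar>g2 x\<bar>) L"
        unfolding grad_bd_def by blast
      have [measurable]: "g \<in> borel_measurable borel" "g1 \<in> borel_measurable borel" "g2 \<in> borel_measurable borel"
        using g by auto
      let ?G = "\<lambda>z. ennreal (\<bar>g1 z\<bar> + \<bar>g2 z\<bar>) * ?I z"
      let ?Gq = "\<lambda>z. ennreal ((\<bar>g1 z\<bar> + \<bar>g2 z\<bar>) powr ?q) * ?I z"
      have Gq: "epow (?G z) ?q = ?Gq z" for z
        using epow_ennreal[of 0 ?q] by (cases "z \<in> U") (simp_all add: epow_ennreal del: ennreal_plus)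
      have [measurable]: "(\<lambda>x. seg_avg ?Gq x y) \<in> borel_measurable borel" for y
        by (rule seg_avg_measurable) measurable
      have [measurable]: "(\<lambda>p. seg_avg ?Gq (snd p) (fst p)) \<in> borel_measurable (borel \<Otimes>\<^sub>M borel)"
        by (rule seg_avg_measurable) measurable
      define \<phi> where "\<phi> y = (\<integral>\<^sup>+x. ennreal (\<bar>g x - g y\<bar> powr ?q) * indicator A x \<partial>lborel)" for y
      have [measurable]: "\<phi> \<in> borel_measurable borel" unfolding \<phi>_def by measurable
      have "(\<integral>\<^sup>+y. \<phi> y * indicator B y \<partial>lborel)
        \<le> (\<integral>\<^sup>+y. \<integral>\<^sup>+x. ennreal (D powr ?q) * (seg_avg ?Gq x y * ?I x * ?I y) \<partial>lborel \<partial>lborel)"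
      proof (rule nn_integral_mono_AE)
        show "AE y in lborel. \<phi> y * indicator B y
            \<le> (\<integral>\<^sup>+x. ennreal (D powr ?q) * (seg_avg ?Gq x y * ?I x * ?I y) \<partial>lborel)"
          using base[OF g]
        proof eventually_elim
          case (elim y)
          show ?case
          proof (cases "y \<in> B")
            case yB: True
            have "\<phi> y \<le> (\<integral>\<^sup>+x. ennreal (D powr ?q) * (seg_avg ?Gq x y * ?I x * ?I y) \<partial>lborel)"
              unfolding \<phi>_def
            proof (rule nn_integral_mono_AE)
              show "AE x in lborel. ennreal (\<bar>g x - g y\<bar> powr ?q) * indicator A x
                  \<le> ennreal (D powr ?q) * (seg_avg ?Gq x y * ?I x * ?I y)"
                using elim
              proof eventually_elim
                case (elim x)
                show ?case
                proof (cases "x \<in> A")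
                  case True
                  have "ennreal (\<bar>g x - g y\<bar> powr ?q) = epow (ennreal \<bar>g x - g y\<bar>) ?q"
                    by (simp add: epow_ennreal)
                  also have "\<dots> \<le> epow (ennreal D * seg_avg ?G x y) ?q"
                    using elim True yB q by (intro epow_mono) auto
                  also have "\<dots> = ennreal (D powr ?q) * epow (seg_avg ?G x y) ?q"
                    by (rule epow_cmult[OF D(1)])
                  also have "\<dots> \<le> ennreal (D powr ?q) * seg_avg (\<lambda>z. epow (?G z) ?q) x y"
                    by (intro mult_left_mono seg_avg_epow_le q) auto
                  finally show ?thesis
                    using True yB subsetD[OF AU, of x] subsetD[OF BU, of y] unfolding Gq by simp
                qed simp
              qed
            qed
            then show ?thesis using yB by simp
          qed simp
        qed
      qed
      also have "\<dots> = ennreal (D powr ?q) * (\<integral>\<^sup>+y. \<integral>\<^sup>+x. seg_avg ?Gq x y * ?I x * ?I y \<partial>lborel \<partial>lborel)"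
        by (simp add: nn_integral_cmult)
      also have "\<dots> \<le> ennreal (D powr ?q) * (4 * emeasure lborel U * (\<integral>\<^sup>+x. ?Gq x \<partial>lborel))"
        by (intro mult_left_mono seg_avg_integral_le) auto
      also have "\<dots> \<le> ennreal (D powr ?q) * (4 * ennreal u * ennreal (L powr ?q))"
        unfolding u(2) using L(2) False
        by (intro mult_left_mono[OF mult_left_mono]) (simp_all add: Lp_bd_finite)
      also have "\<dots> = ennreal (D powr ?q * (4 * u * L powr ?q))"
        using u(1) by (simp add: ennreal_mult)
      also have "D powr ?q * (4 * u * L powr ?q) = (K * L) powr ?q * b"
        unfolding Kq using b0 by (simp add: field_simps)
      finally have "\<exists>y\<in>B. \<phi> y \<le> ennreal ((K * L) powr ?q)"
        by (intro exists_le_average[OF B(1) b(2) b0]) auto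
      then show "\<exists>c. Lp_bd p A (\<lambda>x. g x - c) (K * L)"
        using False unfolding \<phi>_def by (auto simp: Lp_bd_finite)
    qed
  qed
qed

text \<open>On the intersection, which has positive measure, both constants approximate \<open>g\<close>; hence they differ by a
  multiple of the gradient bound, and one of them serves on the whole union.\<close>

lemma poincare_on_union:
  assumes p: "1 \<le> p" and A: "open A" "A \<subseteq> U" "poincare_on p U A" and B: "open B" "B \<subseteq> U" "poincare_on p U B"
    and ne: "A \<inter> B \<noteq> {}" and U: "bounded U"
  shows "poincare_on p U (A \<union> B)"
proof -
  obtain KA where KA: "KA \<ge> 0" "\<And>g L. grad_bd p U g L \<Longrightarrow> \<exists>c. Lp_bd p A (\<lambda>x. g x - c) (KA * L)"
    using A(3) unfolding poincare_on_def by blast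
  obtain KB where KB: "KB \<ge> 0" "\<And>g L. grad_bd p U g L \<Longrightarrow> \<exists>c. Lp_bd p B (\<lambda>x. g x - c) (KB * L)"
    using B(3) unfolding poincare_on_def by blast
  note [measurable] = borel_open[OF A(1)] borel_open[OF B(1)]
  have "bounded (A \<inter> B)" using U A(2) by (meson bounded_subset inf.coboundedI1)
  then obtain m where m: "m \<ge> 0" "emeasure lborel (A \<inter> B) = ennreal m" using emeasure_bounded_real by blast
  have m0: "m > 0"
    using open_emeasure_nonzero[of "A \<inter> B"] A(1) B(1) ne m by (cases "m = 0") auto
  obtain n where n: "n \<ge> 0" "emeasure lborel B = ennreal n"
    using emeasure_bounded_real[OF bounded_subset[OF U B(2)]] by blast
  \<comment> \<open>\<open>K1 * L\<close> bounds the difference of the two constants, \<open>K2 * L\<close> the distance of \<open>g\<close> on \<open>B\<close> from the constant of \<open>A\<close>.\<close>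
  define K1 where "K1 = (1 + 1/m) * (2 * (KA + KB))"
  define K2 where "K2 = 2 * (KB + K1 * (1 + n))"
  have K1: "K1 \<ge> 0" using KA(1) KB(1) m0 by (simp add: K1_def)
  have K2: "K2 \<ge> 0" using KB(1) K1 n by (simp add: K2_def)
  show ?thesis unfolding poincare_on_def
  proof (rule exI[of _ "KA + K2"], intro conjI allI impI)
    show "0 \<le> KA + K2" using KA(1) K2 by simp
    fix g L assume g: "grad_bd p U g L"
    then have L: "0 \<le> L" and [measurable]: "g \<in> borel_measurable borel" by (auto simp: grad_bd_def)
    obtain c where c: "Lp_bd p A (\<lambda>x. g x - c) (KA * L)" using KA(2)[OF g] by blast
    obtain d where d: "Lp_bd p B (\<lambda>x. g x - d) (KB * L)" using KB(2)[OF g] by blast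
    have KL: "KA * L \<ge> 0" "KB * L \<ge> 0" "K1 * L \<ge> 0" "K2 * L \<ge> 0"
      using KA(1) KB(1) K1 K2 L by auto
    have "Lp_bd p (A \<inter> B) (\<lambda>x. (g x - d) + - 1 * (g x - c)) (2 * (KB * L + \<bar>-1\<bar> * (KA * L)))"
    proof (rule Lp_bd_add[OF p])
      show "Lp_bd p (A \<inter> B) (\<lambda>x. g x - d) (KB * L)"
        by (rule Lp_bd_mono[OF d]) (use KL in auto)
      show "Lp_bd p (A \<inter> B) (\<lambda>x. - 1 * (g x - c)) (\<bar>-1\<bar> * (KA * L))"
        by (intro Lp_bd_cmult Lp_bd_mono[OF c]) (use KL in auto)
    qed (use KL in auto)
    then have "Lp_bd p (A \<inter> B) (\<lambda>x. c - d) (2 * (KA + KB) * L)"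
      by (simp add: algebra_simps)
    then have "\<bar>c - d\<bar> \<le> (1 + 1/m) * (2 * (KA + KB) * L)"
      using KA(1) KB(1) L by (intro Lp_bd_const_le[OF p _ m(2) m0]) auto
    then have cd: "\<bar>d - c\<bar> \<le> K1 * L" by (simp add: K1_def abs_minus_commute)
    have "Lp_bd p B (\<lambda>x. (g x - d) + (d - c)) (2 * (KB * L + K1 * L * (1 + n)))"
    proof (rule Lp_bd_add[OF p d])
      show "Lp_bd p B (\<lambda>x. d - c) (K1 * L * (1 + n))"
        by (rule Lp_bd_mono[OF Lp_bd_const[OF p _ n(2) n(1)]])
           (use cd n in \<open>auto intro!: mult_right_mono\<close>)
    qed (use KL n in auto)
    then have "Lp_bd p B (\<lambda>x. g x - c) (K2 * L)"
      by (simp add: K2_def algebra_simps)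
    from Lp_bd_union[OF p c this] have "Lp_bd p (A \<union> B) (\<lambda>x. g x - c) (KA * L + K2 * L)"
      using KL by simp
    then show "\<exists>c. Lp_bd p (A \<union> B) (\<lambda>x. g x - c) ((KA + K2) * L)"
      by (auto simp: distrib_right)
  qed
qed

text \<open>A maximal subfamily on whose union the inequality holds is disjoint from all remaining sets, because
  otherwise one of them could be added; connectedness leaves nothing outside.\<close>

lemma poincare_on_finite_cover:
  assumes p: "1 \<le> p" and U: "connected U" "bounded U" "U \<noteq> {}"
    and \<A>: "finite \<A>" "\<Union>\<A> = U" "\<And>A. A \<in> \<A> \<Longrightarrow> open A \<and> A \<noteq> {} \<and> poincare_on p U A"
  shows "poincare_on p U U"
proof -
  define good where "good = {\<B>. \<B> \<subseteq> \<A> \<and> \<B> \<noteq> {} \<and> poincare_on p U (\<Union>\<B>)}"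
  have fin: "finite good" unfolding good_def using \<A>(1) by (auto intro: finite_subset[of _ "Pow \<A>"])
  obtain A0 where "A0 \<in> \<A>" using U(3) \<A>(2) by auto
  then have "{A0} \<in> good" using \<A>(3) by (auto simp: good_def)
  then have "good \<noteq> {}" by blast
  then have "Max (card ` good) \<in> card ` good" using fin by (intro Max_in) auto
  then obtain \<B> where \<B>0: "\<B> \<in> good" "card \<B> = Max (card ` good)" by auto
  have \<B>: "\<B> \<in> good" "\<And>\<C>. \<C> \<in> good \<Longrightarrow> card \<C> \<le> card \<B>"
    using \<B>0 fin by auto
  have \<B>': "\<B> \<subseteq> \<A>" "\<B> \<noteq> {}" "poincare_on p U (\<Union>\<B>)" using \<B>(1) by (auto simp: good_def)
  have "\<Union>\<B> \<inter> A = {}" if A: "A \<in> \<A> - \<B>" for A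
  proof (rule ccontr)
    assume ne: "\<Union>\<B> \<inter> A \<noteq> {}"
    have "open (\<Union>\<B>)" using \<A>(3) \<B>'(1) by (intro open_Union) blast
    moreover have "\<Union>\<B> \<subseteq> U" "A \<subseteq> U" "open A" "poincare_on p U A" using \<A> A \<B>'(1) by blast+
    ultimately have "poincare_on p U (\<Union>\<B> \<union> A)"
      using \<B>'(3) by (intro poincare_on_union[OF p _ _ _ _ _ _ ne U(2)])
    then have "insert A \<B> \<in> good" using A \<B>' by (auto simp: good_def Un_commute)
    then have "card (insert A \<B>) \<le> card \<B>" by (rule \<B>(2))
    moreover have "finite \<B>" using \<B>'(1) \<A>(1) finite_subset by blast
    ultimately show False using A by simp
  qed
  then have disj: "\<Union>\<B> \<inter> \<Union>(\<A> - \<B>) = {}" by blast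
  have un: "\<Union>\<B> \<union> \<Union>(\<A> - \<B>) = U" using \<B>'(1) \<A>(2) by blast
  have op: "open (\<Union>\<B>)" "open (\<Union>(\<A> - \<B>))" using \<A>(3) \<B>'(1) by (intro open_Union; blast)+
  have "\<Union>\<B> \<noteq> {}" using \<B>' \<A>(3) by blast
  then have "\<Union>(\<A> - \<B>) = {}"
    using connectedD[OF U(1) op] disj un by blast
  then have "\<Union>\<B> = U" using un by blast
  then show ?thesis using \<B>'(3) by simp
qed

text \<open>Near \<open>x0\<close> the set consists of the points above the graph of a function with Lipschitz constant
  \<open>L\<close>. A ball placed a distance \<open>r/2\<close> higher, with a radius proportional to \<open>r/(1 + L)\<close>, is seen from
  all points close to \<open>x0\<close> under a slope of at least \<open>L\<close>, so the connecting segments stay above the graph.\<close>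

lemma lipschitz_boundary_patch:
  assumes U: "open U" "lipschitz_boundary U" and x0: "x0 \<in> frontier U"
  shows "\<exists>V B. open V \<and> x0 \<in> V \<and> open B \<and> B \<noteq> {} \<and> (\<forall>x\<in>V \<inter> U. \<forall>y\<in>B. closed_segment y x \<subseteq> U)"
proof -
  obtain r R h L where r: "r > 0" and R: "orthogonal_transformation (R :: plane \<Rightarrow> plane)"
    and h: "L-lipschitz_on UNIV (h :: real \<Rightarrow> real)"
    and chart: "\<And>x. x \<in> ball x0 r \<Longrightarrow> x \<in> U \<longleftrightarrow> h (fst (R x)) < snd (R x)"
    using U(2) x0 unfolding lipschitz_boundary_def by blast
  have L: "L \<ge> 0" using h by (rule lipschitz_on_nonneg)
  have lip: "h a \<le> h b + L * \<bar>a - b\<bar>" for a b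
    using lipschitz_onD[OF h, of a b] by (simp add: dist_real_def)
  have lin: "linear R" using R by (rule orthogonal_transformation_linear)
  interpret R: linear R by (rule lin)
  have nR: "norm (R x) = norm x" for x using R by (rule orthogonal_transformation_norm)
  obtain n where n: "R n = (0, 1)"
    using orthogonal_transformation_surj[OF R] by (metis surjD)
  have nn: "norm n = 1" using nR[of n] n by (simp add: norm_Pair)
  \<comment> \<open>This radius makes \<open>L * (2 * \<rho>) \<le> r/2 - 2 * \<rho>\<close>, the condition for the slope.\<close>
  define \<rho> where "\<rho> = r / (4 * (1 + L))"
  have \<rho>: "\<rho> > 0" "\<rho> \<le> r / 4" using r L by (auto simp: \<rho>_def divide_simps)
  define y0 where "y0 = x0 + (r/2) *\<^sub>R n"
  have Ry0: "fst (R y0) = fst (R x0)" "snd (R y0) = snd (R x0) + r/2"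
    by (simp_all add: y0_def R.add R.scale n)
  have coord: "\<bar>fst (R a) - fst (R b)\<bar> \<le> norm (a - b)" "\<bar>snd (R a) - snd (R b)\<bar> \<le> norm (a - b)" for a b
    using abs_coord_le_norm[of "R (a - b)"] unfolding nR by (simp_all add: R.diff)
  have "closed_segment y x \<subseteq> U" if x: "x \<in> ball x0 \<rho> \<inter> U" and y: "y \<in> ball y0 \<rho>" for x y
  proof
    fix z assume z: "z \<in> closed_segment y x"
    have xb: "x \<in> ball x0 r" using x \<rho> r by auto
    have "dist x0 y \<le> dist x0 y0 + dist y0 y" by (rule dist_triangle)
    moreover have "dist x0 y0 = r/2" using r nn by (simp add: y0_def dist_norm)
    ultimately have yb: "y \<in> ball x0 r" using y \<rho> r by auto
    have "closed_segment y x \<subseteq> ball x0 r" using xb yb by (intro closed_segment_subset convex_ball)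
    then have zb: "z \<in> ball x0 r" using z by blast
    obtain t where t: "0 \<le> t" "t \<le> 1" "z = (1 - t) *\<^sub>R y + t *\<^sub>R x" using z by (auto simp: closed_segment_def)
    define s where "s = 1 - t"
    have s: "0 \<le> s" "z = x + s *\<^sub>R (y - x)" using t by (auto simp: s_def algebra_simps)
    have x1: "norm (x - x0) < \<rho>" using x by (auto simp: dist_norm norm_minus_commute)
    have y1: "norm (y - y0) < \<rho>" using y by (auto simp: dist_norm norm_minus_commute)
    have "snd (R y) - snd (R x) \<ge> r/2 - 2 * \<rho>"
      using coord(2)[of x x0] coord(2)[of y y0] x1 y1 Ry0(2) by linarith
    moreover have "\<bar>fst (R y) - fst (R x)\<bar> \<le> 2 * \<rho>"
      using coord(1)[of x x0] coord(1)[of y y0] x1 y1 Ry0(1) by linarith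
    then have "L * \<bar>fst (R y) - fst (R x)\<bar> \<le> L * (2 * \<rho>)" using L by (rule mult_left_mono)
    moreover have "2 * (1 + L) * \<rho> = r / 2" using L by (simp add: \<rho>_def field_simps)
    \<comment> \<open>In the rotated coordinates, \<open>y\<close> lies in the upward cone of slope \<open>L\<close> with vertex \<open>x\<close>.\<close>
    ultimately have cone: "L * \<bar>fst (R y) - fst (R x)\<bar> \<le> snd (R y) - snd (R x)"
      by (simp add: algebra_simps)
    have Rz: "fst (R z) = fst (R x) + s * (fst (R y) - fst (R x))" "snd (R z) = snd (R x) + s * (snd (R y) - snd (R x))"
      by (simp_all add: s(2) R.add R.scale R.diff)
    have "h (fst (R z)) \<le> h (fst (R x)) + L * \<bar>s * (fst (R y) - fst (R x))\<bar>"
      using lip[of "fst (R z)" "fst (R x)"] by (simp add: Rz(1))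
    also have "L * \<bar>s * (fst (R y) - fst (R x))\<bar> = s * (L * \<bar>fst (R y) - fst (R x)\<bar>)"
      using s(1) by (simp add: abs_mult)
    also have "h (fst (R x)) + \<dots> \<le> h (fst (R x)) + s * (snd (R y) - snd (R x))"
      using cone s(1) by (intro add_left_mono mult_left_mono)
    also have "\<dots> < snd (R x) + s * (snd (R y) - snd (R x))"
      using chart[OF xb] x by auto
    finally show "z \<in> U" using chart[OF zb] Rz(2) by simp
  qed
  then show ?thesis
    using \<rho>(1) by (intro exI[of _ "ball x0 \<rho>"] exI[of _ "ball y0 \<rho>"]) auto
qed

lemma poincare_reference_domain:
  assumes p: "1 \<le> p" and U: "reference_domain U"
  shows "poincare_on p U U"
proof -
  have U': "open U" "U \<noteq> {}" "bounded U" "connected U" "lipschitz_boundary U"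
    using U unfolding reference_domain_def by auto
  have patch: "\<exists>V. open V \<and> x0 \<in> V \<and> poincare_on p U (V \<inter> U)" if x0: "x0 \<in> closure U" for x0
  proof -
    have "\<exists>V B. open V \<and> x0 \<in> V \<and> open B \<and> B \<noteq> {} \<and> (\<forall>x\<in>V \<inter> U. \<forall>y\<in>B. closed_segment y x \<subseteq> U)"
    proof (cases "x0 \<in> U")
      case True
      then obtain r where r: "r > 0" "ball x0 r \<subseteq> U" using U'(1) open_contains_ball by blast
      have "closed_segment y x \<subseteq> U" if "x \<in> ball x0 r" "y \<in> ball x0 r" for x y
        using closed_segment_subset[OF that(2,1) convex_ball] r(2) by blast
      then show ?thesis using r(1) by (intro exI[of _ "ball x0 r"]) auto
    next
      case False
      then have "x0 \<in> frontier U" using x0 U'(1) by (simp add: frontier_def interior_open)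
      then show ?thesis using lipschitz_boundary_patch[OF U'(1,5)] by blast
    qed
    then obtain V B where V: "open V" "x0 \<in> V" "open B" "B \<noteq> {}"
      "\<And>x y. x \<in> V \<inter> U \<Longrightarrow> y \<in> B \<Longrightarrow> closed_segment y x \<subseteq> U" by blast
    have "poincare_on p U (V \<inter> U)"
      using V U' open_emeasure_nonzero[OF V(3,4)] by (intro poincare_on_visible[OF p U'(1,3) _ _ _ V(5)]) auto
    then show ?thesis using V by blast
  qed
  define \<V> where "\<V> = {V. open V \<and> poincare_on p U (V \<inter> U)}"
  have "compact (closure U)" using U'(3) by simp
  moreover have "closure U \<subseteq> \<Union>\<V>" using patch unfolding \<V>_def by blast
  ultimately obtain \<W> where \<W>: "\<W> \<subseteq> \<V>" "finite \<W>" "closure U \<subseteq> \<Union>\<W>"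
    using compactE[of "closure U" \<V>] unfolding \<V>_def by blast
  let ?\<A> = "(\<lambda>V. V \<inter> U) ` \<W> - {{}}"
  show ?thesis
  proof (rule poincare_on_finite_cover[OF p U'(4,3,2), of ?\<A>])
    have "\<Union>?\<A> = \<Union>\<W> \<inter> U" by blast
    moreover have "U \<subseteq> \<Union>\<W>" by (rule order_trans[OF closure_subset \<W>(3)])
    ultimately show "\<Union>?\<A> = U" by (simp only: Int_absorb1)
    show "open A \<and> A \<noteq> {} \<and> poincare_on p U A" if "A \<in> ?\<A>" for A
      using that \<W>(1) U'(1) unfolding \<V>_def by auto
  qed (use \<W> in simp)
qed

text \<open>Integration of \<open>g - c\<close> against \<open>\<omega>\<close> shows that \<open>c\<close> is close to the weighted mean of \<open>g\<close>. The
  freedom in \<open>\<omega>\<close> matters: besides the mean, a test function is used as a weight.\<close>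

lemma poincare_weighted:
  assumes p: "1 \<le> p" and U: "reference_domain U"
    and \<omega> [measurable]: "\<omega> \<in> borel_measurable borel" and W: "\<And>x. \<bar>\<omega> x\<bar> \<le> W"
    and \<omega>1: "(\<integral>x. \<omega> x * indicator U x \<partial>lborel) = 1"
  shows "\<exists>C\<ge>0. \<forall>g L m. grad_bd p U g L \<longrightarrow> \<bar>\<integral>x. g x * (\<omega> x * indicator U x) \<partial>lborel\<bar> \<le> m \<longrightarrow>
     Lp_bd p U g (C * (L + m))"
proof -
  have U': "open U" "bounded U" using U unfolding reference_domain_def by auto
  note [measurable] = borel_open[OF U'(1)]
  obtain u where u: "u \<ge> 0" "emeasure lborel U = ennreal u" using emeasure_bounded_real[OF U'(2)] by blast
  obtain K where K: "K \<ge> 0" "\<And>g L. grad_bd p U g L \<Longrightarrow> \<exists>c. Lp_bd p U (\<lambda>x. g x - c) (K * L)"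
    using poincare_reference_domain[OF p U] unfolding poincare_on_def by blast
  have W0: "W \<ge> 0" using W[of 0] by (rule order_trans[OF abs_ge_zero])
  define C where "C = 2 * (K + (1 + W * K * (1 + u)) * (1 + u))"
  have C: "C \<ge> 0" using K W0 u by (simp add: C_def)
  have \<omega>U: "\<bar>\<omega> x * indicator U x\<bar> \<le> W" for x
    using W[of x] W0 by (auto simp: indicator_def)
  have intI: "integrable lborel (\<lambda>x. indicator U x :: real)"
    using u by (simp add: integrable_indicator_iff ennreal_less_top)
  have int\<omega>: "integrable lborel (\<lambda>x. \<omega> x * indicator U x)"
    using integrable_mult_bounded[OF intI, of \<omega> W] W by (simp add: mult.commute)
  show ?thesis
  proof (rule exI[of _ C], intro conjI allI impI C)
    fix g L m
    assume gL: "grad_bd p U g L"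
      and m: "\<bar>\<integral>x. g x * (\<omega> x * indicator U x) \<partial>lborel\<bar> \<le> m"
    have g: "integrable lborel g" and L: "0 \<le> L" using gL by (auto simp: grad_bd_def)
    then have [measurable]: "g \<in> borel_measurable borel" by auto
    have m0: "m \<ge> 0" using m by (rule order_trans[OF abs_ge_zero])
    obtain c where c: "Lp_bd p U (\<lambda>x. g x - c) (K * L)" using K(2)[OF gL] by blast
    have KL: "K * L \<ge> 0" using K(1) L by simp
    have L1: "(\<integral>\<^sup>+x. ennreal \<bar>g x - c\<bar> * indicator U x \<partial>lborel) \<le> ennreal (K * L * (1 + u))"
      by (rule Lp_bd_L1[OF p _ u(2,1) c KL]) auto
    have i1: "integrable lborel (\<lambda>x. g x * (\<omega> x * indicator U x))"
      by (rule integrable_mult_bounded[OF g _ \<omega>U]) measurable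
    have i2: "integrable lborel (\<lambda>x. c * (\<omega> x * indicator U x))" using int\<omega> by simp
    have "(\<integral>x. g x * (\<omega> x * indicator U x) \<partial>lborel) - c = (\<integral>x. g x * (\<omega> x * indicator U x) - c * (\<omega> x * indicator U x) \<partial>lborel)"
      using i1 i2 by (simp add: Bochner_Integration.integral_diff \<omega>1)
    also have "ennreal (norm \<dots>) \<le> (\<integral>\<^sup>+x. ennreal (norm (g x * (\<omega> x * indicator U x) - c * (\<omega> x * indicator U x))) \<partial>lborel)"
      using i1 i2 by (intro integral_norm_bound_ennreal) auto
    also have "\<dots> \<le> (\<integral>\<^sup>+x. ennreal W * (ennreal \<bar>g x - c\<bar> * indicator U x) \<partial>lborel)"
    proof (rule nn_integral_mono)
      fix x
      show "ennreal (norm (g x * (\<omega> x * indicator U x) - c * (\<omega> x * indicator U x))) \<le> ennreal W * (ennreal \<bar>g x - c\<bar> * indicator U x)"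
      proof (cases "x \<in> U")
        case True
        have "\<bar>g x * \<omega> x - c * \<omega> x\<bar> = \<bar>\<omega> x\<bar> * \<bar>g x - c\<bar>"
          by (subst left_diff_distrib[symmetric]) (simp only: abs_mult mult.commute)
        also have "\<dots> \<le> W * \<bar>g x - c\<bar>" using W by (intro mult_right_mono) auto
        finally show ?thesis using True W0 by (simp add: ennreal_mult[symmetric] ennreal_leI)
      qed simp
    qed
    also have "\<dots> = ennreal W * (\<integral>\<^sup>+x. ennreal \<bar>g x - c\<bar> * indicator U x \<partial>lborel)"
      by (rule nn_integral_cmult) measurable
    also have "\<dots> \<le> ennreal W * ennreal (K * L * (1 + u))" by (intro mult_left_mono L1) simp
    also have "\<dots> = ennreal (W * (K * L * (1 + u)))" using W0 KL u by (simp add: ennreal_mult)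
    finally have "norm ((\<integral>x. g x * (\<omega> x * indicator U x) \<partial>lborel) - c) \<le> W * (K * L * (1 + u))"
      using W0 KL u by (subst (asm) ennreal_le_iff) auto
    then have cb: "\<bar>c\<bar> \<le> m + W * K * (1 + u) * L" using m by (simp add: algebra_simps)
    let ?E = "1 + W * K * (1 + u)"
    have E: "?E \<ge> 0" "W * K * (1 + u) \<ge> 0" using W0 K(1) u by auto
    have "\<bar>c\<bar> \<le> ?E * (L + m)"
    proof -
      have "0 \<le> W * K * (1 + u) * m" using E m0 by simp
      then show ?thesis using cb L by (simp add: algebra_simps)
    qed
    then have cE: "\<bar>c\<bar> * (1 + u) \<le> ?E * (L + m) * (1 + u)" using u by (intro mult_right_mono) auto
    have "Lp_bd p U (\<lambda>x. (g x - c) + c) (2 * (K * (L + m) + ?E * (L + m) * (1 + u)))"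
    proof (rule Lp_bd_add[OF p])
      show "Lp_bd p U (\<lambda>x. g x - c) (K * (L + m))"
        by (rule Lp_bd_mono[OF c]) (use KL K(1) m0 in \<open>auto intro!: mult_left_mono\<close>)
      show "Lp_bd p U (\<lambda>x. c) (?E * (L + m) * (1 + u))"
        by (rule Lp_bd_mono[OF Lp_bd_const[OF p _ u(2,1)]]) (use cE u in auto)
    qed (use K(1) L m0 E(1) u in auto)
    then show "Lp_bd p U g (C * (L + m))" by (simp add: C_def algebra_simps)
  qed
qed


section \<open>Regular distributions and their densities\<close>

lemma AE_lebesgue_on_iff:
  fixes U :: "plane set"
  assumes "open U"
  shows "(AE x in lebesgue_on U. P x) \<longleftrightarrow> (AE x in lborel. x \<in> U \<longrightarrow> P x)"
  using assms by (subst AE_restrict_space_iff) (auto simp: AE_completion_iff)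

lemma nn_integral_lebesgue_on:
  fixes U :: "plane set"
  assumes "open U"
  shows "(\<integral>\<^sup>+x. f x \<partial>lebesgue_on U) = (\<integral>\<^sup>+x. f x * indicator U x \<partial>lborel)"
  using assms by (subst nn_integral_restrict_space) (auto simp: nn_integral_completion)

lemma integral_lebesgue_on_AE:
  fixes v g :: "plane \<Rightarrow> real"
  assumes U: "open U" and v: "v \<in> L1 U" and g: "g \<in> borel_measurable borel" "AE x in lborel. x \<in> U \<longrightarrow> v x = g x"
    and \<phi>: "\<phi> \<in> borel_measurable borel"
  shows "(\<integral>x. v x * \<phi> x \<partial>lebesgue_on U) = (\<integral>x. g x * \<phi> x * indicator U x \<partial>lborel)"
proof -
  have [measurable]: "v \<in> borel_measurable (lebesgue_on U)" using v by (auto simp: L1_def)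
  have leb: "f \<in> borel_measurable (lebesgue_on U)" if "f \<in> borel_measurable borel" for f :: "plane \<Rightarrow> real"
    using that by (intro measurable_restrict_space1 measurable_completion) simp
  note [measurable] = leb[OF g(1)] leb[OF \<phi>] and [measurable] = g(1) \<phi> borel_open[OF U]
  have "(\<integral>x. v x * \<phi> x \<partial>lebesgue_on U) = (\<integral>x. g x * \<phi> x \<partial>lebesgue_on U)"
    by (intro integral_cong_AE) (use g(2) in \<open>auto simp: AE_lebesgue_on_iff[OF U] elim!: eventually_mono\<close>)
  also have "\<dots> = (\<integral>x. indicator U x *\<^sub>R (g x * \<phi> x) \<partial>lebesgue)"
    using U by (intro integral_restrict_space) auto
  also have "\<dots> = (\<integral>x. indicator U x *\<^sub>R (g x * \<phi> x) \<partial>lborel)"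
    by (rule integral_completion) measurable
  finally show ?thesis by (simp add: mult.commute)
qed

text \<open>A Borel measurable density on the whole plane, which vanishes outside \<open>U\<close>. With it, all integrals can
  be taken with respect to \<open>lborel\<close>.\<close>

definition dens :: "plane set \<Rightarrow> distribution \<Rightarrow> (plane \<Rightarrow> real) \<Rightarrow> bool" where
  "dens U T g \<longleftrightarrow> integrable lborel g \<and> (\<forall>x. x \<notin> U \<longrightarrow> g x = 0) \<and> T = dist_of U g"

lemma dens_measurable: "dens U T g \<Longrightarrow> g \<in> borel_measurable borel"
  by (auto simp: dens_def)

lemma integrable_imp_L1:
  assumes "open U" "integrable lborel g"
  shows "g \<in> L1 U"
proof -
  have "integrable lebesgue g" using assms(2) by (simp add: integrable_completion)
  then show ?thesis using assms(1) unfolding L1_def by (auto intro!: integrable_restrict_space[THEN iffD2] integrable_mult_indicator)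
qed

lemma L1_representative:
  assumes U: "open U" and v: "v \<in> L1 U"
  obtains g where "integrable lborel g" "\<And>x. x \<notin> U \<Longrightarrow> g x = 0" "AE x in lborel. x \<in> U \<longrightarrow> v x = g x"
proof -
  have "integrable lebesgue (\<lambda>x. indicator U x *\<^sub>R v x)"
    using v U unfolding L1_def by (subst integrable_restrict_space[symmetric]) auto
  then have i: "integrable lebesgue (\<lambda>x. indicator U x * v x)" by simp
  then obtain h where h: "h \<in> borel_measurable lborel" "AE x in lborel. indicator U x * v x = h x"
    using completion_ex_borel_measurable_real[OF borel_measurable_integrable[OF i]] by blast
  have "integrable lebesgue h"
  proof (rule integrable_cong_AE_imp[OF i])
    show "h \<in> borel_measurable lebesgue" using h(1) by (rule measurable_completion)
    show "AE x in lebesgue. indicator U x * v x = h x"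
      unfolding AE_completion_iff using h(2) .
  qed
  then have ih: "integrable lborel h" using h(1) by (simp add: integrable_completion)
  show ?thesis
  proof (rule that[of "\<lambda>x. indicator U x * h x"])
    have [measurable]: "U \<in> sets borel" using U by simp
    show "integrable lborel (\<lambda>x. indicator U x * h x)"
      using integrable_mult_indicator[OF _ ih, of U] by simp
    show "AE x in lborel. x \<in> U \<longrightarrow> v x = indicator U x * h x"
      using h(2) by eventually_elim auto
  qed simp
qed

lemma dist_of_test:
  assumes U: "open U" and g: "integrable lborel g" and \<phi>: "\<phi> \<in> test_funs U"
  shows "dist_of U g \<phi> = (\<integral>x. g x * \<phi> x \<partial>lborel)"
proof -
  have "dist_of U g \<phi> = (\<integral>x. g x * \<phi> x * indicator U x \<partial>lborel)"
    using integral_lebesgue_on_AE[OF U integrable_imp_L1[OF U g], of g \<phi>] g test_funs_measurable[OF \<phi>] \<phi>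
    by (simp add: dist_of_def)
  also have "\<dots> = (\<integral>x. g x * \<phi> x \<partial>lborel)"
    using test_funs_outside[OF \<phi>] by (intro Bochner_Integration.integral_cong) (auto simp: indicator_def)
  finally show ?thesis .
qed

lemma dist_of_cong_AE:
  assumes U: "open U" and v: "v \<in> L1 U" and g: "integrable lborel g" "AE x in lborel. x \<in> U \<longrightarrow> v x = g x"
  shows "dist_of U v = dist_of U g"
proof
  fix \<phi>
  show "dist_of U v \<phi> = dist_of U g \<phi>"
  proof (cases "\<phi> \<in> test_funs U")
    case True
    have m: "g \<in> borel_measurable borel" "\<phi> \<in> borel_measurable borel"
      using g(1) test_funs_measurable[OF True] by auto
    show ?thesis
      using integral_lebesgue_on_AE[OF U v m(1) g(2) m(2)]
        integral_lebesgue_on_AE[OF U integrable_imp_L1[OF U g(1)] m(1) _ m(2)] True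
      by (simp add: dist_of_def)
  qed (simp add: dist_of_def)
qed

lemma regular_dens:
  assumes U: "open U" and T: "is_regular U T"
  obtains g where "dens U T g"
proof -
  obtain v where v: "v \<in> L1 U" "T = dist_of U v" using T unfolding is_regular_def by blast
  obtain g where g: "integrable lborel g" "\<And>x. x \<notin> U \<Longrightarrow> g x = 0" "AE x in lborel. x \<in> U \<longrightarrow> v x = g x"
    by (rule L1_representative[OF U v(1)]) (rule that)
  show ?thesis
    by (rule that[of g]) (use g v dist_of_cong_AE[OF U v(1) g(1,3)] in \<open>auto simp: dens_def\<close>)
qed

lemma dens_test: "open U \<Longrightarrow> dens U T g \<Longrightarrow> \<phi> \<in> test_funs U \<Longrightarrow> T \<phi> = (\<integral>x. g x * \<phi> x \<partial>lborel)"
  by (auto simp: dens_def dist_of_test)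

text \<open>The mollifications vanish at every point of \<open>U\<close> as soon as the radius is small, and they converge to
  \<open>g\<close> in the mean.\<close>

lemma fundamental_lemma:
  assumes U: "open U" and g: "integrable lborel g"
    and 0: "\<And>\<phi>. \<phi> \<in> test_funs U \<Longrightarrow> (\<integral>x. g x * \<phi> x \<partial>lborel) = 0"
  shows "AE x in lborel. x \<in> U \<longrightarrow> g x = 0"
proof -
  have [measurable]: "g \<in> borel_measurable borel" using g by auto
  let ?e = "\<lambda>n x. ennreal \<bar>mollify (1 / real (Suc n)) g x - g x\<bar>"
  have "(\<lambda>n. \<integral>\<^sup>+x. ?e n x \<partial>lborel) \<longlonglongrightarrow> 0" by (rule mollify_tendsto[OF g])
  then have "liminf (\<lambda>n. \<integral>\<^sup>+x. ?e n x \<partial>lborel) = 0" by (intro lim_imp_Liminf) auto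
  then have "(\<integral>\<^sup>+x. liminf (\<lambda>n. ?e n x) \<partial>lborel) = 0"
    using nn_integral_liminf[of ?e lborel] by simp
  then have "AE x in lborel. liminf (\<lambda>n. ?e n x) = 0"
    by (subst (asm) nn_integral_0_iff_AE) auto
  then show ?thesis
  proof eventually_elim
    case (elim x)
    show ?case
    proof
      assume "x \<in> U"
      then obtain r where r: "r > 0" "cball x r \<subseteq> U" using U open_contains_cball by blast
      obtain N where N: "1 / real (Suc N) < r" using r(1) nat_approx_posE by blast
      have "eventually (\<lambda>n. ennreal \<bar>g x\<bar> \<le> 0 + ?e n x) sequentially"
        using eventually_ge_at_top[of N]
      proof eventually_elim
        case (elim n)
        have "1 / real (Suc n) \<le> 1 / real (Suc N)" using elim by (simp add: divide_simps)
        then have "cball x (1 / real (Suc n)) \<subseteq> cball x r" using N by (intro subset_cball) simp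
        then have "cball x (1 / real (Suc n)) \<subseteq> U" using r(2) by blast
        from 0[OF moll_test[OF this]] have "mollify (1 / real (Suc n)) g x = 0"
          by (simp add: mollify_def)
        then show ?case by simp
      qed
      from ennreal_null_sequence_le[OF this elim] show "g x = 0" by simp
    qed
  qed
qed

lemma dens_unique:
  assumes U: "open U" and g: "dens U T g" and v: "v \<in> L1 U" "T = dist_of U v"
  shows "AE x in lborel. x \<in> U \<longrightarrow> v x = g x"
proof -
  obtain h where h: "integrable lborel h" "\<And>x. x \<notin> U \<Longrightarrow> h x = 0" "AE x in lborel. x \<in> U \<longrightarrow> v x = h x"
    by (rule L1_representative[OF U v(1)]) (rule that)
  have eq: "dist_of U g = dist_of U h"
    using g v dist_of_cong_AE[OF U v(1) h(1,3)] by (auto simp: dens_def)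
  have gi: "integrable lborel g" using g by (auto simp: dens_def)
  have "AE x in lborel. x \<in> U \<longrightarrow> h x - g x = 0"
  proof (rule fundamental_lemma[OF U])
    fix \<phi> assume \<phi>: "\<phi> \<in> test_funs U"
    have "(\<integral>x. (h x - g x) * \<phi> x \<partial>lborel) = (\<integral>x. h x * \<phi> x \<partial>lborel) - (\<integral>x. g x * \<phi> x \<partial>lborel)"
      using integrable_mult_test[OF h(1) \<phi>] integrable_mult_test[OF gi \<phi>]
      by (simp add: left_diff_distrib Bochner_Integration.integral_diff)
    also have "\<dots> = 0"
      using dist_of_test[OF U h(1) \<phi>] dist_of_test[OF U gi \<phi>] eq by simp
    finally show "(\<integral>x. (h x - g x) * \<phi> x \<partial>lborel) = 0" .
  qed (use h(1) gi in simp)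
  with h(3) show ?thesis by eventually_elim auto
qed

lemma dens_density_of:
  assumes U: "open U" and g: "dens U T g"
  shows "density_of U T \<in> L1 U" "AE x in lborel. x \<in> U \<longrightarrow> density_of U T x = g x"
proof -
  have "g \<in> L1 U \<and> T = dist_of U g"
    using g integrable_imp_L1[OF U] by (auto simp: dens_def)
  then have "density_of U T \<in> L1 U \<and> T = dist_of U (density_of U T)"
    unfolding density_of_def by (rule someI[of "\<lambda>g. g \<in> L1 U \<and> T = dist_of U g"])
  then show "density_of U T \<in> L1 U" "AE x in lborel. x \<in> U \<longrightarrow> density_of U T x = g x"
    using dens_unique[OF U g] by blast+
qed

lemma dens_regular: "open U \<Longrightarrow> dens U T g \<Longrightarrow> is_regular U T"
  unfolding is_regular_def dens_def using integrable_imp_L1 by blast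

lemma integral_over_dens:
  assumes U: "open U" and g: "dens U T g"
  shows "integral_over U T = (\<integral>x. g x \<partial>lborel)"
proof -
  have "integral_over U T = (\<integral>x. density_of U T x * 1 \<partial>lebesgue_on U)"
    by (simp add: integral_over_def)
  also have "\<dots> = (\<integral>x. g x * 1 * indicator U x \<partial>lborel)"
    by (rule integral_lebesgue_on_AE[OF U dens_density_of(1)[OF U g] dens_measurable[OF g] dens_density_of(2)[OF U g]]) simp
  also have "\<dots> = (\<integral>x. g x \<partial>lborel)"
    using g by (intro Bochner_Integration.integral_cong) (auto simp: dens_def indicator_def)
  finally show ?thesis .
qed

lemma epow_inverse_le_iff:
  assumes "q \<ge> 1" "K \<ge> 0"
  shows "epow x (1 / q) \<le> ennreal K \<longleftrightarrow> x \<le> ennreal (K powr q)"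
proof (cases x)
  case (real r)
  have "r powr (1/q) \<le> K \<longleftrightarrow> r \<le> K powr q"
  proof
    assume "r powr (1/q) \<le> K"
    then have "(r powr (1/q)) powr q \<le> K powr q" using assms by (intro powr_mono2) auto
    then show "r \<le> K powr q" using real assms by (simp add: powr_powr)
  next
    assume "r \<le> K powr q"
    then have "r powr (1/q) \<le> (K powr q) powr (1/q)" using real assms by (intro powr_mono2) auto
    then show "r powr (1/q) \<le> K" using assms by (simp add: powr_powr)
  qed
  then show ?thesis using real assms by (simp add: epow_ennreal)
qed (simp add: top_unique)

text \<open>The norm of a distribution is defined through a chosen density, but every density computes it.\<close>

lemma Lp_dnorm_le_iff:
  assumes U: "open U" and p: "1 \<le> p" and g: "dens U T g" and K: "K \<ge> 0"
  shows "Lp_dnorm U p T \<le> ennreal K \<longleftrightarrow> Lp_bd p U g K"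
proof -
  let ?d = "density_of U T"
  note d = dens_density_of[OF U g]
  have dn: "Lp_dnorm U p T = Lp_norm U p ?d"
    using dens_regular[OF U g] by (simp add: Lp_dnorm_def)
  show ?thesis
  proof (cases "p = \<infinity>")
    case True
    have m: "(\<lambda>x. ennreal \<bar>?d x\<bar>) \<in> borel_measurable (lebesgue_on U)"
      using d(1) by (auto simp: L1_def)
    have "Lp_norm U p ?d \<le> ennreal K \<longleftrightarrow> (AE x in lebesgue_on U. ennreal \<bar>?d x\<bar> \<le> ennreal K)"
    proof
      assume le: "Lp_norm U p ?d \<le> ennreal K"
      have "AE x in lebesgue_on U. ennreal \<bar>?d x\<bar> \<le> esssup (lebesgue_on U) (\<lambda>x. ennreal \<bar>?d x\<bar>)"
        by (rule esssup_AE)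
      then show "AE x in lebesgue_on U. ennreal \<bar>?d x\<bar> \<le> ennreal K"
        by eventually_elim (use le True in \<open>auto simp: Lp_norm_def\<close>)
    next
      assume "AE x in lebesgue_on U. ennreal \<bar>?d x\<bar> \<le> ennreal K"
      then show "Lp_norm U p ?d \<le> ennreal K"
        using esssup_I[OF m] True by (simp add: Lp_norm_def)
    qed
    also have "\<dots> \<longleftrightarrow> (AE x in lborel. x \<in> U \<longrightarrow> \<bar>?d x\<bar> \<le> K)"
      using K by (simp add: AE_lebesgue_on_iff[OF U])
    also have "\<dots> \<longleftrightarrow> (AE x in lborel. x \<in> U \<longrightarrow> \<bar>g x\<bar> \<le> K)"
      by (rule eventually_cong[OF d(2)]) auto
    finally have e: "Lp_norm U p ?d \<le> ennreal K \<longleftrightarrow> (AE x in lborel. x \<in> U \<longrightarrow> \<bar>g x\<bar> \<le> K)" .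
    show ?thesis unfolding dn e by (simp add: Lp_bd_def True)
  next
    case False
    let ?q = "enn2real p"
    have q: "?q \<ge> 1" using enn2real_ge_1[OF p False] .
    have "(\<integral>\<^sup>+x. ennreal (\<bar>?d x\<bar> powr ?q) \<partial>lebesgue_on U) = (\<integral>\<^sup>+x. ennreal (\<bar>?d x\<bar> powr ?q) * indicator U x \<partial>lborel)"
      by (rule nn_integral_lebesgue_on[OF U])
    also have "\<dots> = (\<integral>\<^sup>+x. ennreal (\<bar>g x\<bar> powr ?q) * indicator U x \<partial>lborel)"
    proof (rule nn_integral_cong_AE)
      show "AE x in lborel. ennreal (\<bar>?d x\<bar> powr ?q) * indicator U x = ennreal (\<bar>g x\<bar> powr ?q) * indicator U x"
        using d(2) by eventually_elim (auto simp: indicator_def)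
    qed
    finally show ?thesis
      using False epow_inverse_le_iff[OF q K] unfolding dn by (simp add: Lp_norm_def Lp_bd_finite)
  qed
qed

lemma dist_of_add:
  assumes U: "open U" and "u \<in> L1 U" "v \<in> L1 U"
  shows "dist_of U (\<lambda>x. a * u x + b * v x) = a *\<^sub>R dist_of U u + b *\<^sub>R dist_of U v"
proof
  fix \<phi>
  show "dist_of U (\<lambda>x. a * u x + b * v x) \<phi> = (a *\<^sub>R dist_of U u + b *\<^sub>R dist_of U v) \<phi>"
  proof (cases "\<phi> \<in> test_funs U")
    case True
    obtain B where B: "\<And>x. \<bar>\<phi> x\<bar> \<le> B" using test_funs_bounded[OF True] by blast
    have m: "\<phi> \<in> borel_measurable (lebesgue_on U)"
      using test_funs_measurable[OF True] by (intro measurable_restrict_space1 measurable_completion) simp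
    have i: "integrable (lebesgue_on U) (\<lambda>x. w x * \<phi> x)" if "w \<in> L1 U" for w
      using that unfolding L1_def by (intro integrable_mult_bounded[OF _ m B]) simp
    show ?thesis using True i[OF assms(2)] i[OF assms(3)]
      by (simp add: dist_of_def scaleR_fun_def distrib_right mult.assoc)
  qed (simp add: dist_of_def scaleR_fun_def)
qed

lemma dens_lincomb:
  assumes U: "open U" and g: "dens U T g" and h: "dens U T' h"
  shows "dens U (a *\<^sub>R T + b *\<^sub>R T') (\<lambda>x. a * g x + b * h x)"
proof -
  have i: "integrable lborel g" "integrable lborel h" using g h by (auto simp: dens_def)
  show ?thesis
    using dist_of_add[OF U integrable_imp_L1[OF U i(1)] integrable_imp_L1[OF U i(2)], of a b] g h
    by (auto simp: dens_def)
qed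

lemma Lp_dnorm_regular: "Lp_dnorm U p T < \<infinity> \<Longrightarrow> is_regular U T"
  by (auto simp: Lp_dnorm_def split: if_splits)

lemma ennreal_lt_top_le:
  assumes "x < (\<infinity> :: ennreal)"
  obtains K where "K \<ge> 0" "x = ennreal K"
  using assms by (cases x) auto

lemma dens_zero: "dens U 0 (\<lambda>_. 0)"
  by (auto simp: dens_def dist_of_def zero_fun_def)

lemma Lp_dnorm_zero:
  assumes U: "open U" and p: "1 \<le> p"
  shows "Lp_dnorm U p 0 = 0"
proof -
  have "Lp_dnorm U p 0 \<le> ennreal 0"
    by (subst Lp_dnorm_le_iff[OF U p dens_zero]) (auto simp: Lp_bd_def)
  then show ?thesis by simp
qed

text \<open>A triangle inequality up to the factor 2. If a norm is infinite, so is the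
  right-hand side, unless the coefficient is 0 and the summand drops out.\<close>

lemma Lp_dnorm_lincomb:
  assumes U: "open U" and p: "1 \<le> p"
  shows "Lp_dnorm U p (a *\<^sub>R T + b *\<^sub>R T') \<le> 2 * (ennreal \<bar>a\<bar> * Lp_dnorm U p T + ennreal \<bar>b\<bar> * Lp_dnorm U p T')"
proof -
  have main: "Lp_dnorm U p (a *\<^sub>R T + b *\<^sub>R T') \<le> 2 * (ennreal \<bar>a\<bar> * Lp_dnorm U p T + ennreal \<bar>b\<bar> * Lp_dnorm U p T')"
    if fin: "Lp_dnorm U p T < \<infinity>" "Lp_dnorm U p T' < \<infinity>" for T T'
  proof -
    obtain K where K: "K \<ge> 0" "Lp_dnorm U p T = ennreal K" by (rule ennreal_lt_top_le[OF fin(1)])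
    obtain L where L: "L \<ge> 0" "Lp_dnorm U p T' = ennreal L" by (rule ennreal_lt_top_le[OF fin(2)])
    obtain g where g: "dens U T g" by (rule regular_dens[OF U Lp_dnorm_regular[OF fin(1)]])
    obtain h where h: "dens U T' h" by (rule regular_dens[OF U Lp_dnorm_regular[OF fin(2)]])
    have [measurable]: "g \<in> borel_measurable borel" "h \<in> borel_measurable borel" "U \<in> sets borel"
      using g h U by (auto simp: dens_def)
    have "Lp_bd p U g K" "Lp_bd p U h L"
      using Lp_dnorm_le_iff[OF U p g K(1)] Lp_dnorm_le_iff[OF U p h L(1)] K L by auto
    then have "Lp_bd p U (\<lambda>x. a * g x + b * h x) (2 * (\<bar>a\<bar> * K + \<bar>b\<bar> * L))"
      using K(1) L(1) by (intro Lp_bd_add[OF p] Lp_bd_cmult) auto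
    then have "Lp_dnorm U p (a *\<^sub>R T + b *\<^sub>R T') \<le> ennreal (2 * (\<bar>a\<bar> * K + \<bar>b\<bar> * L))"
      using K(1) L(1) by (subst Lp_dnorm_le_iff[OF U p dens_lincomb[OF U g h]]) auto
    also have "\<dots> = 2 * (ennreal \<bar>a\<bar> * ennreal K + ennreal \<bar>b\<bar> * ennreal L)"
      using K(1) L(1) by (simp add: ennreal_mult)
    finally show ?thesis using K L by simp
  qed
  note z = Lp_dnorm_zero[OF U p]
  consider "(a = 0 \<or> Lp_dnorm U p T < \<infinity>) \<and> (b = 0 \<or> Lp_dnorm U p T' < \<infinity>)"
    | "a \<noteq> 0 \<and> Lp_dnorm U p T = \<infinity>" | "b \<noteq> 0 \<and> Lp_dnorm U p T' = \<infinity>"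
    using top.not_eq_extremum[of "Lp_dnorm U p T"] top.not_eq_extremum[of "Lp_dnorm U p T'"]
    unfolding infinity_ennreal_def by blast
  then show ?thesis
  proof cases
    case 1
    have "a *\<^sub>R T = a *\<^sub>R (if a = 0 then 0 else T)" "b *\<^sub>R T' = b *\<^sub>R (if b = 0 then 0 else T')" by simp_all
    moreover have "Lp_dnorm U p (if a = 0 then 0 else T) < \<infinity>" "Lp_dnorm U p (if b = 0 then 0 else T') < \<infinity>"
      using 1 z by auto
    moreover have "ennreal \<bar>a\<bar> * Lp_dnorm U p (if a = 0 then 0 else T) = ennreal \<bar>a\<bar> * Lp_dnorm U p T"
      "ennreal \<bar>b\<bar> * Lp_dnorm U p (if b = 0 then 0 else T') = ennreal \<bar>b\<bar> * Lp_dnorm U p T'" by simp_all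
    ultimately show ?thesis using main by metis
  next
    case 2
    then have "ennreal \<bar>a\<bar> * Lp_dnorm U p T = top" by (simp add: ennreal_mult_top)
    then show ?thesis by (simp add: ennreal_mult_top)
  next
    case 3
    then have "ennreal \<bar>b\<bar> * Lp_dnorm U p T' = top" by (simp add: ennreal_mult_top)
    then show ?thesis by (simp add: ennreal_mult_top)
  qed
qed

section \<open>Weak derivatives\<close>

lemma wderiv_lincomb: "wderiv U \<alpha> (a *\<^sub>R T + b *\<^sub>R T') = a *\<^sub>R wderiv U \<alpha> T + b *\<^sub>R wderiv U \<alpha> T'"
  by (auto simp: wderiv_def fun_eq_iff scaleR_fun_def algebra_simps)

lemma wderiv_wderiv: "wderiv U \<alpha> (wderiv U \<beta> T) = wderiv U (\<alpha> + \<beta>) T"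
proof
  fix \<phi>
  show "wderiv U \<alpha> (wderiv U \<beta> T) \<phi> = wderiv U (\<alpha> + \<beta>) T \<phi>"
  proof (cases "\<phi> \<in> test_funs U")
    case True
    then have "smooth \<phi>" by (simp add: test_funs_iff)
    then have "pderivs \<beta> (pderivs \<alpha> \<phi>) = pderivs (\<alpha> + \<beta>) \<phi>"
      by (simp add: pderivs_pderivs add.commute)
    then have "wderiv U \<alpha> (wderiv U \<beta> T) \<phi>
        = (-1) ^ (fst \<alpha> + snd \<alpha>) * ((-1) ^ (fst \<beta> + snd \<beta>) * T (pderivs (\<alpha> + \<beta>) \<phi>))"
      using True test_funs_pderivs[OF True] by (simp add: wderiv_def)
    then show ?thesis using True by (simp add: wderiv_def power_add ac_simps)
  qed (simp add: wderiv_def)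
qed

lemma wderiv_zero_index: "wderiv U 0 (dist_of U v) = dist_of U v"
  by (auto simp: wderiv_def dist_of_def pderivs_def zero_prod_def)

text \<open>The link between distributional derivatives and the functions in the Poincare inequality.\<close>

lemma weak_grad_dens:
  assumes U: "open U" and g: "dens U T g" "dens U (wderiv U (1,0) T) g1" "dens U (wderiv U (0,1) T) g2"
  shows "weak_grad U g g1 g2"
  unfolding weak_grad_def
proof
  fix \<phi> assume \<phi>: "\<phi> \<in> test_funs U"
  have "wderiv U (1,0) T \<phi> = - T (pd (1,0) \<phi>)" "wderiv U (0,1) T \<phi> = - T (pd (0,1) \<phi>)"
    using \<phi> by (simp_all add: wderiv_def pderivs_def)
  then show "(\<integral>x. g x * pd (1,0) \<phi> x \<partial>lborel) = - (\<integral>x. g1 x * \<phi> x \<partial>lborel) \<and>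
      (\<integral>x. g x * pd (0,1) \<phi> x \<partial>lborel) = - (\<integral>x. g2 x * \<phi> x \<partial>lborel)"
    using dens_test[OF U g(2) \<phi>] dens_test[OF U g(3) \<phi>] dens_test[OF U g(1) test_funs_pd(1)[OF \<phi>]]
      dens_test[OF U g(1) test_funs_pd(2)[OF \<phi>]] by simp
qed

lemma Lp_dnorm_le_sob_norm:
  assumes "finite P" "\<alpha> \<in> P" "1 \<le> p"
  shows "Lp_dnorm U p (wderiv U \<alpha> T) \<le> sob_norm U p P T"
proof (cases "p = \<infinity>")
  case True
  then show ?thesis using assms by (auto simp: sob_norm_def intro: SUP_upper2)
next
  case False
  let ?q = "enn2real p"
  have q: "?q \<ge> 1" using enn2real_ge_1[OF assms(3) False] .
  let ?a = "\<lambda>\<alpha>. Lp_dnorm U p (wderiv U \<alpha> T)"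
  have "epow (epow (?a \<alpha>) ?q) (1 / ?q) = ?a \<alpha>"
    using q by (cases "?a \<alpha>") (auto simp: epow_ennreal powr_powr)
  moreover have "epow (?a \<alpha>) ?q \<le> (\<Sum>\<alpha>\<in>P. epow (?a \<alpha>) ?q)"
    using assms by (intro member_le_sum) auto
  then have "epow (epow (?a \<alpha>) ?q) (1 / ?q) \<le> epow (\<Sum>\<alpha>\<in>P. epow (?a \<alpha>) ?q) (1 / ?q)"
    using q by (intro epow_mono) auto
  ultimately show ?thesis using False by (simp add: sob_norm_def)
qed

text \<open>Together with the preceding lemma this replaces the norm, up to constants, by the sum of the norms of the
  derivatives, which is treated in the same way for all exponents.\<close>

lemma sob_norm_le_sum:
  assumes "finite P" "1 \<le> p"
  shows "sob_norm U p P T \<le> (\<Sum>\<alpha>\<in>P. Lp_dnorm U p (wderiv U \<alpha> T))"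
proof (cases "p = \<infinity>")
  case True
  then show ?thesis using assms by (auto simp: sob_norm_def intro!: SUP_least member_le_sum)
next
  case False
  let ?q = "enn2real p"
  have q: "?q \<ge> 1" using enn2real_ge_1[OF assms(2) False] .
  let ?a = "\<lambda>\<alpha>. Lp_dnorm U p (wderiv U \<alpha> T)"
  have super: "epow x ?q + epow y ?q \<le> epow (x + y) ?q" for x y
    by (cases x; cases y) (auto simp: epow_ennreal powr_superadd[OF q] simp flip: ennreal_plus)
  have "(\<Sum>\<alpha>\<in>P. epow (?a \<alpha>) ?q) \<le> epow (\<Sum>\<alpha>\<in>P. ?a \<alpha>) ?q"
    using assms(1)
  proof (induction P rule: finite_induct)
    case (insert x F)
    then have "(\<Sum>\<alpha>\<in>insert x F. epow (?a \<alpha>) ?q) \<le> epow (?a x) ?q + epow (\<Sum>\<alpha>\<in>F. ?a \<alpha>) ?q"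
      by (simp add: add_left_mono)
    also have "\<dots> \<le> epow (?a x + (\<Sum>\<alpha>\<in>F. ?a \<alpha>)) ?q" by (rule super)
    finally show ?case using insert by simp
  qed simp
  then have "epow (\<Sum>\<alpha>\<in>P. epow (?a \<alpha>) ?q) (1 / ?q) \<le> epow (epow (\<Sum>\<alpha>\<in>P. ?a \<alpha>) ?q) (1 / ?q)"
    using q by (intro epow_mono) auto
  also have "\<dots> = (\<Sum>\<alpha>\<in>P. ?a \<alpha>)"
    using q by (cases "\<Sum>\<alpha>\<in>P. ?a \<alpha>") (auto simp: epow_ennreal powr_powr)
  finally show ?thesis using False by (simp add: sob_norm_def)
qed


section \<open>Polynomials as distributions\<close>

lemma monom2_has_derivative:
  "(monom2 (a, b) has_derivative (\<lambda>h. fst h * (real a * monom2 (a - 1, b) x)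
     + snd h * (real b * monom2 (a, b - 1) x))) (at x)"
proof -
  have "((\<lambda>s. s ^ a) has_real_derivative real a * fst x ^ (a - 1)) (at (fst x))"
    "((\<lambda>s. s ^ b) has_real_derivative real b * snd x ^ (b - 1)) (at (snd x))"
    by (auto intro!: derivative_eq_intros)
  from has_derivative_product[OF this] show ?thesis
    by (simp add: monom2_def[abs_def] ac_simps)
qed

lemma pd_monom2:
  "pd (1,0) (monom2 (a, b)) = real a *\<^sub>R monom2 (a - 1, b)"
  "pd (0,1) (monom2 (a, b)) = real b *\<^sub>R monom2 (a, b - 1)"
  using pd_eq[OF monom2_has_derivative] by (simp_all add: fun_eq_iff scaleR_fun_def)

lemma polynomial_Ck: "f \<in> span (range monom2) \<Longrightarrow> f \<in> Ck k U"
proof (rule smooth_span[of "range monom2"])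
  fix g assume "g \<in> range monom2"
  then obtain a b where g: "g = monom2 (a, b)" by auto
  show "g differentiable (at x)" for x
    using monom2_has_derivative unfolding g differentiable_def by blast
  show "pd (1,0) g \<in> span (range monom2)" "pd (0,1) g \<in> span (range monom2)"
    unfolding g pd_monom2 by (intro span_scale span_base rangeI)+
qed

lemma smooth_monom2: "smooth (monom2 \<beta>)"
  unfolding smooth_def using polynomial_Ck[OF span_base[OF rangeI]] by blast

text \<open>The factor produced by differentiating \<open>monom2 \<beta>\<close>. Subtraction is truncated, so a factor 0
  occurs exactly if \<open>\<alpha> \<le> \<beta>\<close> fails.\<close>

definition dcoeff :: "multi_index \<Rightarrow> multi_index \<Rightarrow> real" where
  "dcoeff \<alpha> \<beta> = (\<Prod>i<fst \<alpha>. real (fst \<beta> - i)) * (\<Prod>i<snd \<alpha>. real (snd \<beta> - i))"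

lemma pd_scaleR_smooth: "smooth f \<Longrightarrow> pd e (c *\<^sub>R f) = c *\<^sub>R pd e f"
  using pd_scaleR[OF smooth_differentiable] by (simp add: fun_eq_iff scaleR_fun_def)

lemma pderivs_monom2: "pderivs \<alpha> (monom2 \<beta>) = dcoeff \<alpha> \<beta> *\<^sub>R monom2 (\<beta> - \<alpha>)"
proof -
  obtain a b where \<beta>: "\<beta> = (a, b)" by (cases \<beta>)
  have y: "(pd (0,1) ^^ n) (monom2 (a, b)) = (\<Prod>i<n. real (b - i)) *\<^sub>R monom2 (a, b - n)" for n
    by (induction n) (simp_all add: pd_scaleR_smooth smooth_monom2 pd_monom2)
  have x: "(pd (1,0) ^^ n) (c *\<^sub>R monom2 (a, b)) = (c * (\<Prod>i<n. real (a - i))) *\<^sub>R monom2 (a - n, b)" for n c b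
    by (induction n) (simp_all add: pd_scaleR_smooth smooth_monom2 pd_monom2)
  show ?thesis
    by (simp add: \<beta> pderivs_def y x dcoeff_def mult.commute)
       (cases \<alpha>, simp)
qed

lemma dcoeff_eq_0: "\<not> \<alpha> \<le> \<beta> \<Longrightarrow> dcoeff \<alpha> \<beta> = 0"
  by (auto simp: dcoeff_def less_eq_prod_def not_le intro!: prod_zero)

lemma dcoeff_nonzero: "\<alpha> \<le> \<beta> \<Longrightarrow> dcoeff \<alpha> \<beta> \<noteq> 0"
  by (auto simp: dcoeff_def less_eq_prod_def)

lemma integrable_continuous_on_bounded:
  fixes f :: "plane \<Rightarrow> real"
  assumes "continuous_on UNIV f" "bounded U" "U \<in> sets borel"
  shows "integrable lborel (\<lambda>x. f x * indicator U x)"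
proof -
  have "compact (closure U)" "continuous_on (closure U) f"
    using assms continuous_on_subset by auto
  then have i: "integrable lborel (\<lambda>x. indicator (closure U) x *\<^sub>R f x)"
    by (rule borel_integrable_compact)
  have "integrable lborel (\<lambda>x. indicator U x *\<^sub>R (indicator (closure U) x *\<^sub>R f x))"
    by (rule integrable_mult_indicator[OF _ i]) (use assms(3) in simp)
  moreover have "(\<lambda>x. indicator U x *\<^sub>R (indicator (closure U) x *\<^sub>R f x)) = (\<lambda>x. f x * indicator U x)"
    using closure_subset[of U] by (auto simp: fun_eq_iff indicator_def)
  ultimately show ?thesis by simp
qed

lemma dens_continuous:
  assumes U: "open U" "bounded U" and f: "continuous_on UNIV f"
  shows "f \<in> L1 U" "dens U (dist_of U f) (\<lambda>x. f x * indicator U x)"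
proof -
  have i: "integrable lborel (\<lambda>x. f x * indicator U x)"
    using U by (intro integrable_continuous_on_bounded f) auto
  then have il: "integrable lebesgue (\<lambda>x. f x * indicator U x)" by (simp add: integrable_completion)
  then have "integrable lebesgue (\<lambda>x. indicator U x *\<^sub>R f x)" by (simp add: mult.commute)
  then show L: "f \<in> L1 U"
    using U unfolding L1_def by (subst (asm) integrable_restrict_space[symmetric]) auto
  have "dist_of U f = dist_of U (\<lambda>x. f x * indicator U x)"
    by (rule dist_of_cong_AE[OF U(1) L i]) auto
  then show "dens U (dist_of U f) (\<lambda>x. f x * indicator U x)"
    using i by (simp add: dens_def)
qed

lemma dist_of_continuous_test:
  assumes U: "open U" "bounded U" and f: "continuous_on UNIV f" and \<phi>: "\<phi> \<in> test_funs U"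
  shows "dist_of U f \<phi> = (\<integral>x. f x * \<phi> x \<partial>lborel)"
proof -
  have "dist_of U f \<phi> = (\<integral>x. f x * indicator U x * \<phi> x \<partial>lborel)"
    by (rule dens_test[OF U(1) dens_continuous(2)[OF U f] \<phi>])
  also have "\<dots> = (\<integral>x. f x * \<phi> x \<partial>lborel)"
    using test_funs_outside[OF \<phi>] by (intro Bochner_Integration.integral_cong) (auto simp: indicator_def)
  finally show ?thesis .
qed

lemma integrable_continuous_test:
  fixes f :: "plane \<Rightarrow> real"
  assumes f: "continuous_on UNIV f" and \<phi>: "\<phi> \<in> test_funs U"
  shows "integrable lborel (\<lambda>x. f x * \<phi> x)"
proof -
  let ?K = "closure {x. \<phi> x \<noteq> 0}"
  have K: "compact ?K" using \<phi> by (simp add: test_funs_iff)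
  have "integrable lborel (\<lambda>x. f x * indicator ?K x)"
    using K compact_imp_closed by (intro integrable_continuous_on_bounded f compact_imp_bounded) auto
  from integrable_mult_test[OF this \<phi>]
  have "integrable lborel (\<lambda>x. f x * indicator ?K x * \<phi> x)" .
  moreover have "f x * indicator ?K x * \<phi> x = f x * \<phi> x" for x
    using closure_subset[of "{x. \<phi> x \<noteq> 0}"] by (cases "\<phi> x = 0") (auto simp: indicator_def)
  ultimately show ?thesis by simp
qed

lemma test_funs_ball:
  assumes "\<phi> \<in> test_funs U"
  obtains R where "\<And>x. norm x > R \<Longrightarrow> \<phi> x = 0"
proof -
  have "bounded (closure {x. \<phi> x \<noteq> 0})"
    using assms by (auto simp: test_funs_iff compact_imp_bounded)
  then obtain R where R: "\<And>x. x \<in> closure {x. \<phi> x \<noteq> 0} \<Longrightarrow> norm x \<le> R" unfolding bounded_iff by blast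
  show ?thesis
  proof (rule that)
    fix x :: plane assume "norm x > R"
    then have "x \<notin> closure {x. \<phi> x \<noteq> 0}" using R[of x] by auto
    then show "\<phi> x = 0" using closure_subset[of "{x. \<phi> x \<noteq> 0}"] by blast
  qed
qed

text \<open>The derivative of the product \<open>f \<phi>\<close> has integral 0 along every line parallel to an axis, because the
  product vanishes far away.\<close>

lemma smooth_integration_by_parts:
  assumes f: "smooth f" and \<phi>: "\<phi> \<in> test_funs U"
  shows "(\<integral>x. f x * pd (1,0) \<phi> x \<partial>lborel) = - (\<integral>x. pd (1,0) f x * \<phi> x \<partial>lborel)"
    and "(\<integral>x. f x * pd (0,1) \<phi> x \<partial>lborel) = - (\<integral>x. pd (0,1) f x * \<phi> x \<partial>lborel)"
proof -
  have s: "smooth \<phi>" using \<phi> by (simp add: test_funs_iff)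
  note cf = smooth_continuous[OF f] and cfx = smooth_continuous[OF smooth_pd(1)[OF f]]
    and cfy = smooth_continuous[OF smooth_pd(2)[OF f]] and c\<phi> = smooth_continuous[OF s]
    and c\<phi>x = smooth_continuous[OF smooth_pd(1)[OF s]] and c\<phi>y = smooth_continuous[OF smooth_pd(2)[OF s]]
  obtain R0 where R0: "\<And>x. norm x > R0 \<Longrightarrow> \<phi> x = 0" by (rule test_funs_ball[OF \<phi>]) (rule that)
  obtain R1 where R1: "\<And>x. norm x > R1 \<Longrightarrow> pd (1,0) \<phi> x = 0" by (rule test_funs_ball[OF test_funs_pd(1)[OF \<phi>]]) (rule that)
  obtain R2 where R2: "\<And>x. norm x > R2 \<Longrightarrow> pd (0,1) \<phi> x = 0" by (rule test_funs_ball[OF test_funs_pd(2)[OF \<phi>]]) (rule that)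
  define R where "R = max (max 0 R0) (max R1 R2) + 1"
  have R: "\<phi> x = 0" "pd (1,0) \<phi> x = 0" "pd (0,1) \<phi> x = 0" if "\<bar>fst x\<bar> \<ge> R \<or> \<bar>snd x\<bar> \<ge> R" for x
  proof -
    have "norm x > R0" "norm x > R1" "norm x > R2"
      using abs_coord_le_norm[of x] that by (auto simp: R_def)
    then show "\<phi> x = 0" "pd (1,0) \<phi> x = 0" "pd (0,1) \<phi> x = 0" using R0 R1 R2 by auto
  qed
  have Rp: "R > 0" by (simp add: R_def)
  let ?hx = "\<lambda>x. f x * pd (1,0) \<phi> x + pd (1,0) f x * \<phi> x"
  let ?hy = "\<lambda>x. f x * pd (0,1) \<phi> x + pd (0,1) f x * \<phi> x"
  have ix: "integrable lborel (\<lambda>x. f x * pd (1,0) \<phi> x)" "integrable lborel (\<lambda>x. pd (1,0) f x * \<phi> x)"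
    by (rule integrable_continuous_test[OF cf test_funs_pd(1)[OF \<phi>]] integrable_continuous_test[OF cfx \<phi>])+
  have iy: "integrable lborel (\<lambda>x. f x * pd (0,1) \<phi> x)" "integrable lborel (\<lambda>x. pd (0,1) f x * \<phi> x)"
    by (rule integrable_continuous_test[OF cf test_funs_pd(2)[OF \<phi>]] integrable_continuous_test[OF cfy \<phi>])+
  have inner_x: "(\<integral>s. ?hx (s, y) \<partial>lborel) = 0" for y
  proof -
    have "(\<integral>s. ?hx (s, y) \<partial>lborel) = (\<integral>s. ?hx (s, y) * indicator {-R..R} s \<partial>lborel)"
    proof (rule Bochner_Integration.integral_cong[OF refl])
      show "?hx (s, y) = ?hx (s, y) * indicator {-R..R} s" for s
        using R(1,2)[of "(s, y)"] by (cases "\<bar>s\<bar> \<ge> R") (auto simp: indicator_def)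
    qed
    also have "\<dots> = f (R, y) * \<phi> (R, y) - f (-R, y) * \<phi> (-R, y)"
    proof (rule integral_FTC_Icc_real)
      show "((\<lambda>s. f (s, y) * \<phi> (s, y)) has_real_derivative ?hx (s, y)) (at s)" for s
        using DERIV_mult[OF smooth_partial_x[OF f] smooth_partial_x[OF s]] by (simp add: algebra_simps)
      have "continuous_on UNIV (\<lambda>s. ?hx (s, y))"
        by (intro continuous_intros continuous_on_compose2[OF cf] continuous_on_compose2[OF cfx]
            continuous_on_compose2[OF c\<phi>] continuous_on_compose2[OF c\<phi>x]) auto
      then show "isCont (\<lambda>s. ?hx (s, y)) s" for s by (simp add: continuous_on_eq_continuous_at)
    qed (use Rp in simp)
    also have "\<dots> = 0" using R(1)[of "(R, y)"] R(1)[of "(-R, y)"] Rp by simp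
    finally show ?thesis .
  qed
  have inner_y: "(\<integral>s. ?hy (x, s) \<partial>lborel) = 0" for x
  proof -
    have "(\<integral>s. ?hy (x, s) \<partial>lborel) = (\<integral>s. ?hy (x, s) * indicator {-R..R} s \<partial>lborel)"
    proof (rule Bochner_Integration.integral_cong[OF refl])
      show "?hy (x, s) = ?hy (x, s) * indicator {-R..R} s" for s
        using R(1,3)[of "(x, s)"] by (cases "\<bar>s\<bar> \<ge> R") (auto simp: indicator_def)
    qed
    also have "\<dots> = f (x, R) * \<phi> (x, R) - f (x, -R) * \<phi> (x, -R)"
    proof (rule integral_FTC_Icc_real)
      show "((\<lambda>s. f (x, s) * \<phi> (x, s)) has_real_derivative ?hy (x, s)) (at s)" for s
        using DERIV_mult[OF smooth_partial_y[OF f] smooth_partial_y[OF s]] by (simp add: algebra_simps)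
      have "continuous_on UNIV (\<lambda>s. ?hy (x, s))"
        by (intro continuous_intros continuous_on_compose2[OF cf] continuous_on_compose2[OF cfy]
            continuous_on_compose2[OF c\<phi>] continuous_on_compose2[OF c\<phi>y]) auto
      then show "isCont (\<lambda>s. ?hy (x, s)) s" for s by (simp add: continuous_on_eq_continuous_at)
    qed (use Rp in simp)
    also have "\<dots> = 0" using R(1)[of "(x, R)"] R(1)[of "(x, -R)"] Rp by simp
    finally show ?thesis .
  qed
  have eq: "case_prod (\<lambda>a b. ?hx (a, b)) = ?hx" by (rule ext) (simp add: split_beta)
  have "integrable (lborel \<Otimes>\<^sub>M lborel) (case_prod (\<lambda>a b. ?hx (a, b)))"
    unfolding eq lborel_prod using ix by (rule Bochner_Integration.integrable_add)
  from lborel_pair.integral_snd[OF this] have "(\<integral>x. ?hx x \<partial>lborel) = 0"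
    unfolding eq lborel_prod inner_x by simp
  then show "(\<integral>x. f x * pd (1,0) \<phi> x \<partial>lborel) = - (\<integral>x. pd (1,0) f x * \<phi> x \<partial>lborel)"
    using ix by simp
  have eq: "case_prod (\<lambda>a b. ?hy (a, b)) = ?hy" by (rule ext) (simp add: split_beta)
  have "integrable (lborel \<Otimes>\<^sub>M lborel) (case_prod (\<lambda>a b. ?hy (a, b)))"
    unfolding eq lborel_prod using iy by (rule Bochner_Integration.integrable_add)
  from lborel_pair.integral_fst[OF this] have "(\<integral>x. ?hy x \<partial>lborel) = 0"
    unfolding eq lborel_prod inner_y by simp
  then show "(\<integral>x. f x * pd (0,1) \<phi> x \<partial>lborel) = - (\<integral>x. pd (0,1) f x * \<phi> x \<partial>lborel)"
    using iy by simp
qed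

lemma wderiv_smooth:
  assumes U: "open U" "bounded U" and f: "smooth f"
  shows "wderiv U \<alpha> (dist_of U f) = dist_of U (pderivs \<alpha> f)"
proof -
  have x: "wderiv U (1,0) (dist_of U f) = dist_of U (pd (1,0) f)" if f: "smooth f" for f
  proof
    fix \<phi>
    show "wderiv U (1,0) (dist_of U f) \<phi> = dist_of U (pd (1,0) f) \<phi>"
    proof (cases "\<phi> \<in> test_funs U")
      case True
      then show ?thesis
        using dist_of_continuous_test[OF U smooth_continuous[OF f] test_funs_pd(1)[OF True]]
          dist_of_continuous_test[OF U smooth_continuous[OF smooth_pd(1)[OF f]] True]
          smooth_integration_by_parts(1)[OF f True]
        by (simp add: wderiv_def pderivs_def)
    qed (simp add: wderiv_def dist_of_def)
  qed
  have y: "wderiv U (0,1) (dist_of U f) = dist_of U (pd (0,1) f)" if f: "smooth f" for f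
  proof
    fix \<phi>
    show "wderiv U (0,1) (dist_of U f) \<phi> = dist_of U (pd (0,1) f) \<phi>"
    proof (cases "\<phi> \<in> test_funs U")
      case True
      then show ?thesis
        using dist_of_continuous_test[OF U smooth_continuous[OF f] test_funs_pd(2)[OF True]]
          dist_of_continuous_test[OF U smooth_continuous[OF smooth_pd(2)[OF f]] True]
          smooth_integration_by_parts(2)[OF f True]
        by (simp add: wderiv_def pderivs_def)
    qed (simp add: wderiv_def dist_of_def)
  qed
  have yn: "wderiv U (0, n) (dist_of U f) = dist_of U ((pd (0,1) ^^ n) f)" for n
  proof (induction n)
    case 0
    then show ?case using wderiv_zero_index[of U f] by (simp add: zero_prod_def)
  next
    case (Suc n)
    have "wderiv U (0, Suc n) (dist_of U f) = wderiv U (0,1) (wderiv U (0, n) (dist_of U f))"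
      by (simp add: wderiv_wderiv)
    then show ?case using Suc y[OF smooth_funpow_pd(2)[OF f]] by simp
  qed
  have "wderiv U (m, n) (dist_of U f) = dist_of U ((pd (1,0) ^^ m) ((pd (0,1) ^^ n) f))" for m n
  proof (induction m)
    case (Suc m)
    have "wderiv U (Suc m, n) (dist_of U f) = wderiv U (1,0) (wderiv U (m, n) (dist_of U f))"
      by (simp add: wderiv_wderiv)
    then show ?case using Suc x[OF smooth_funpow_pd(1)[OF smooth_funpow_pd(2)[OF f]]] by simp
  qed (simp add: yn)
  from this[of "fst \<alpha>" "snd \<alpha>"] show ?thesis by (simp add: pderivs_def)
qed

lemma wderiv_sum:
  "finite J \<Longrightarrow> wderiv U \<alpha> (\<Sum>i\<in>J. a i *\<^sub>R T i) = (\<Sum>i\<in>J. a i *\<^sub>R wderiv U \<alpha> (T i))"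
proof (induction J rule: finite_induct)
  case empty
  show ?case using wderiv_lincomb[of U \<alpha> 0 0 0 0] by (simp only: scaleR_zero_left add_0 sum.empty)
next
  case (insert x F)
  have "wderiv U \<alpha> (a x *\<^sub>R T x + 1 *\<^sub>R (\<Sum>i\<in>F. a i *\<^sub>R T i))
      = a x *\<^sub>R wderiv U \<alpha> (T x) + 1 *\<^sub>R wderiv U \<alpha> (\<Sum>i\<in>F. a i *\<^sub>R T i)"
    by (rule wderiv_lincomb)
  then show ?case
    by (simp only: sum.insert[OF insert.hyps] insert.IH scaleR_one)
qed

lemma dens_sum:
  assumes U: "open U"
  shows "finite J \<Longrightarrow> (\<And>i. i \<in> J \<Longrightarrow> dens U (T i) (g i)) \<Longrightarrow>
    dens U (\<Sum>i\<in>J. a i *\<^sub>R T i) (\<lambda>x. \<Sum>i\<in>J. a i * g i x)"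
proof (induction J rule: finite_induct)
  case empty
  show ?case using dens_zero by (simp only: sum.empty)
next
  case (insert x F)
  have "dens U (a x *\<^sub>R T x + 1 *\<^sub>R (\<Sum>i\<in>F. a i *\<^sub>R T i)) (\<lambda>y. a x * g x y + 1 * (\<Sum>i\<in>F. a i * g i y))"
    using insert by (intro dens_lincomb[OF U]) auto
  then show ?case by (simp only: sum.insert[OF insert.hyps] scaleR_one mult_1)
qed

lemma Lp_dnorm_sum:
  assumes U: "open U" and p: "1 \<le> p"
  shows "finite J \<Longrightarrow> Lp_dnorm U p (\<Sum>i\<in>J. a i *\<^sub>R T i) \<le> 2 ^ card J * (\<Sum>i\<in>J. ennreal \<bar>a i\<bar> * Lp_dnorm U p (T i))"
proof (induction J rule: finite_induct)
  case empty
  show ?case unfolding sum.empty Lp_dnorm_zero[OF U p] by simp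
next
  case (insert x F)
  let ?N = "\<lambda>i. ennreal \<bar>a i\<bar> * Lp_dnorm U p (T i)"
  have "Lp_dnorm U p (a x *\<^sub>R T x + 1 *\<^sub>R (\<Sum>i\<in>F. a i *\<^sub>R T i))
      \<le> 2 * (?N x + ennreal \<bar>1\<bar> * Lp_dnorm U p (\<Sum>i\<in>F. a i *\<^sub>R T i))"
    by (rule Lp_dnorm_lincomb[OF U p])
  also have "\<dots> \<le> 2 * (2 ^ card F * ?N x + 2 ^ card F * (\<Sum>i\<in>F. ?N i))"
  proof (intro mult_left_mono add_mono)
    have "(1::ennreal) * ?N x \<le> 2 ^ card F * ?N x" by (intro mult_right_mono one_le_power) auto
    then show "?N x \<le> 2 ^ card F * ?N x" by simp
  qed (use insert.IH in auto)
  also have "\<dots> = 2 ^ card (insert x F) * (\<Sum>i\<in>insert x F. ?N i)"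
    using insert.hyps by (simp add: distrib_left mult.assoc)
  finally show ?case by (simp only: sum.insert[OF insert.hyps] scaleR_one)
qed

lemma dist_of_sum:
  assumes U: "open U"
  shows "finite J \<Longrightarrow> (\<And>i. i \<in> J \<Longrightarrow> v i \<in> L1 U) \<Longrightarrow>
    (\<Sum>i\<in>J. a i *\<^sub>R v i) \<in> L1 U \<and> dist_of U (\<Sum>i\<in>J. a i *\<^sub>R v i) = (\<Sum>i\<in>J. a i *\<^sub>R dist_of U (v i))"
proof (induction J rule: finite_induct)
  case empty
  have "dist_of U (\<lambda>_. 0) = 0" by (auto simp: dist_of_def fun_eq_iff)
  then show ?case by (simp add: L1_def)
next
  case (insert x F)
  let ?s = "\<Sum>i\<in>F. a i *\<^sub>R v i"
  have s: "?s \<in> L1 U" "dist_of U ?s = (\<Sum>i\<in>F. a i *\<^sub>R dist_of U (v i))" using insert by auto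
  have x: "v x \<in> L1 U" using insert by auto
  have eq: "(\<Sum>i\<in>insert x F. a i *\<^sub>R v i) = (\<lambda>y. a x * v x y + 1 * ?s y)"
    unfolding sum.insert[OF insert.hyps] by (simp add: fun_eq_iff scaleR_fun_def)
  have "(\<lambda>y. a x * v x y + 1 * ?s y) \<in> L1 U"
    using s(1) x unfolding L1_def by (auto intro!: Bochner_Integration.integrable_add)
  moreover have "dist_of U (\<lambda>y. a x * v x y + 1 * ?s y) = a x *\<^sub>R dist_of U (v x) + 1 *\<^sub>R dist_of U ?s"
    by (rule dist_of_add[OF U x s(1)])
  ultimately show ?case unfolding eq s(2) by (simp only: sum.insert[OF insert.hyps] scaleR_one)
qed

section \<open>Triangular systems of moments\<close>

definition deg :: "multi_index \<Rightarrow> nat" where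
  "deg \<alpha> = fst \<alpha> + snd \<alpha>"

lemma deg_less: "\<alpha> \<le> \<beta> \<Longrightarrow> \<alpha> \<noteq> \<beta> \<Longrightarrow> deg \<alpha> < deg \<beta>"
  by (cases \<alpha>; cases \<beta>) (auto simp: deg_def less_eq_prod_def)

lemma finite_deg_bound:
  assumes "finite X"
  obtains M where "\<And>\<alpha>. \<alpha> \<in> X \<Longrightarrow> deg \<alpha> \<le> M"
  using assms finite_imageI[of X deg] Max_ge[of "deg ` X"] by blast

text \<open>An index of minimal degree occurs in no equation but its own; so the other equations are solved first.\<close>

lemma triangular_solvable:
  fixes K :: "multi_index \<Rightarrow> multi_index \<Rightarrow> real"
  assumes "finite Q" and tri: "\<And>\<alpha> \<beta>. \<not> \<alpha> \<le> \<beta> \<Longrightarrow> K \<alpha> \<beta> = 0" and diag: "\<And>\<alpha>. K \<alpha> \<alpha> \<noteq> 0"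
  shows "\<exists>c. \<forall>\<alpha>\<in>Q. (\<Sum>\<beta>\<in>Q. c \<beta> * K \<alpha> \<beta>) = m \<alpha>"
  using assms(1)
proof (induction "card Q" arbitrary: Q)
  case 0
  then show ?case by simp
next
  case (Suc n)
  then have "Q \<noteq> {}" by auto
  then obtain \<beta>0 where \<beta>0: "\<beta>0 \<in> Q" "\<And>\<alpha>. \<alpha> \<in> Q \<Longrightarrow> deg \<beta>0 \<le> deg \<alpha>"
    using ex_min_if_finite[of "deg ` Q"] Suc.prems
    by (metis (no_types, lifting) arg_min_least arg_min_if_finite(1))
  let ?Q = "Q - {\<beta>0}"
  have "n = card ?Q" "finite ?Q" using Suc \<beta>0 by auto
  then obtain c where c: "\<And>\<alpha>. \<alpha> \<in> ?Q \<Longrightarrow> (\<Sum>\<beta>\<in>?Q. c \<beta> * K \<alpha> \<beta>) = m \<alpha>" using Suc.hyps(1) by blast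
  \<comment> \<open>The row of \<open>\<beta>0\<close> determines its coefficient.\<close>
  define c' where "c' = c(\<beta>0 := (m \<beta>0 - (\<Sum>\<beta>\<in>?Q. c \<beta> * K \<beta>0 \<beta>)) / K \<beta>0 \<beta>0)"
  have split: "(\<Sum>\<beta>\<in>Q. c' \<beta> * K \<alpha> \<beta>) = c' \<beta>0 * K \<alpha> \<beta>0 + (\<Sum>\<beta>\<in>?Q. c \<beta> * K \<alpha> \<beta>)" for \<alpha>
    using Suc.prems \<beta>0 by (subst sum.remove[of Q \<beta>0]) (auto simp: c'_def intro!: sum.cong)
  have "(\<Sum>\<beta>\<in>Q. c' \<beta> * K \<alpha> \<beta>) = m \<alpha>" if \<alpha>: "\<alpha> \<in> Q" for \<alpha>
  proof (cases "\<alpha> = \<beta>0")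
    case True
    then show ?thesis using diag[of \<beta>0] by (simp add: split) (simp add: c'_def)
  next
    case False
    have "\<not> \<alpha> \<le> \<beta>0" using deg_less[of \<alpha> \<beta>0] \<beta>0(2)[OF \<alpha>] False by auto
    then show ?thesis using c[of \<alpha>] False \<alpha> tri by (simp add: split)
  qed
  then show ?case by blast
qed

text \<open>Backward substitution, which only ever uses the equations with indices above \<open>\<beta>\<close>; that only their
  right-hand sides enter the bound is essential for \<open>moment_coefficient_estimate\<close>.\<close>

lemma triangular_bound:
  fixes K :: "multi_index \<Rightarrow> multi_index \<Rightarrow> real"
  assumes Q: "finite Q" and tri: "\<And>\<alpha> \<beta>. \<not> \<alpha> \<le> \<beta> \<Longrightarrow> K \<alpha> \<beta> = 0" and diag: "\<And>\<alpha>. K \<alpha> \<alpha> \<noteq> 0"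
    and \<beta>: "\<beta> \<in> Q"
  shows "\<exists>C\<ge>0. \<forall>c m. (\<forall>\<alpha>\<in>Q. (\<Sum>\<beta>\<in>Q. c \<beta> * K \<alpha> \<beta>) = m \<alpha>) \<longrightarrow>
    \<bar>c \<beta>\<bar> \<le> C * (\<Sum>\<alpha>\<in>{\<alpha>\<in>Q. \<beta> \<le> \<alpha>}. \<bar>m \<alpha>\<bar>)"
proof -
  obtain M where M: "\<And>\<alpha>. \<alpha> \<in> Q \<Longrightarrow> deg \<alpha> \<le> M" by (rule finite_deg_bound[OF Q]) (rule that)
  show ?thesis using \<beta>
  proof (induction \<beta> rule: measure_induct_rule[of "\<lambda>\<beta>. M - deg \<beta>"])
    case (less \<beta>)
    let ?A = "{\<beta>'\<in>Q. \<beta> \<le> \<beta>' \<and> \<beta>' \<noteq> \<beta>}"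
    have "\<exists>C\<ge>0. \<forall>c m. (\<forall>\<alpha>\<in>Q. (\<Sum>\<beta>\<in>Q. c \<beta> * K \<alpha> \<beta>) = m \<alpha>) \<longrightarrow>
      \<bar>c \<beta>'\<bar> \<le> C * (\<Sum>\<alpha>\<in>{\<alpha>\<in>Q. \<beta>' \<le> \<alpha>}. \<bar>m \<alpha>\<bar>)" if "\<beta>' \<in> ?A" for \<beta>'
      using that deg_less[of \<beta> \<beta>'] M[of \<beta>'] by (intro less.IH) auto
    then have "\<forall>\<beta>'\<in>?A. \<exists>C. C \<ge> 0 \<and> (\<forall>c m. (\<forall>\<alpha>\<in>Q. (\<Sum>\<beta>\<in>Q. c \<beta> * K \<alpha> \<beta>) = m \<alpha>) \<longrightarrow>
      \<bar>c \<beta>'\<bar> \<le> C * (\<Sum>\<alpha>\<in>{\<alpha>\<in>Q. \<beta>' \<le> \<alpha>}. \<bar>m \<alpha>\<bar>))"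
      by simp
    from bchoice[OF this] obtain C where C': "\<forall>\<beta>'\<in>?A. C \<beta>' \<ge> 0 \<and>
      (\<forall>c m. (\<forall>\<alpha>\<in>Q. (\<Sum>\<beta>\<in>Q. c \<beta> * K \<alpha> \<beta>) = m \<alpha>) \<longrightarrow>
        \<bar>c \<beta>'\<bar> \<le> C \<beta>' * (\<Sum>\<alpha>\<in>{\<alpha>\<in>Q. \<beta>' \<le> \<alpha>}. \<bar>m \<alpha>\<bar>))" ..
    have C: "C \<beta>' \<ge> 0" if "\<beta>' \<in> ?A" for \<beta>'
      using bspec[OF C' that] by (rule conjunct1)
    have C2: "\<bar>c \<beta>'\<bar> \<le> C \<beta>' * (\<Sum>\<alpha>\<in>{\<alpha>\<in>Q. \<beta>' \<le> \<alpha>}. \<bar>m \<alpha>\<bar>)"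
      if "\<beta>' \<in> ?A" "\<forall>\<alpha>\<in>Q. (\<Sum>\<beta>\<in>Q. c \<beta> * K \<alpha> \<beta>) = m \<alpha>" for \<beta>' c m
      using bspec[OF C' that(1), THEN conjunct2, rule_format, of c m] that(2) by simp
    define D where "D = (1 + (\<Sum>\<beta>'\<in>?A. C \<beta>' * \<bar>K \<beta> \<beta>'\<bar>)) / \<bar>K \<beta> \<beta>\<bar>"
    have fA: "finite ?A" using Q by simp
    show ?case
    proof (rule exI[of _ D], intro conjI allI impI)
      show "D \<ge> 0" unfolding D_def using C by (intro divide_nonneg_nonneg add_nonneg_nonneg sum_nonneg) auto
      fix c m assume eq: "\<forall>\<alpha>\<in>Q. (\<Sum>\<beta>\<in>Q. c \<beta> * K \<alpha> \<beta>) = m \<alpha>"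
      let ?S = "\<Sum>\<alpha>\<in>{\<alpha>\<in>Q. \<beta> \<le> \<alpha>}. \<bar>m \<alpha>\<bar>"
      have "(\<Sum>\<beta>'\<in>Q. c \<beta>' * K \<beta> \<beta>') = (\<Sum>\<beta>'\<in>insert \<beta> ?A. c \<beta>' * K \<beta> \<beta>')"
      proof (rule sum.mono_neutral_right[OF Q])
        show "insert \<beta> ?A \<subseteq> Q" using less.prems by blast
        have "c \<beta>' * K \<beta> \<beta>' = 0" if "\<beta>' \<in> Q - insert \<beta> ?A" for \<beta>'
        proof -
          have "\<not> \<beta> \<le> \<beta>'" using that by blast
          then show ?thesis by (simp add: tri)
        qed
        then show "\<forall>\<beta>'\<in>Q - insert \<beta> ?A. c \<beta>' * K \<beta> \<beta>' = 0" by blast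
      qed
      then have "m \<beta> = c \<beta> * K \<beta> \<beta> + (\<Sum>\<beta>'\<in>?A. c \<beta>' * K \<beta> \<beta>')"
        using eq less.prems fA by simp
      then have "\<bar>c \<beta>\<bar> * \<bar>K \<beta> \<beta>\<bar> = \<bar>m \<beta> - (\<Sum>\<beta>'\<in>?A. c \<beta>' * K \<beta> \<beta>')\<bar>" by (simp add: abs_mult[symmetric])
      also have "\<dots> \<le> \<bar>m \<beta>\<bar> + \<bar>\<Sum>\<beta>'\<in>?A. c \<beta>' * K \<beta> \<beta>'\<bar>" by (rule abs_triangle_ineq4)
      also have "\<dots> \<le> \<bar>m \<beta>\<bar> + (\<Sum>\<beta>'\<in>?A. \<bar>c \<beta>'\<bar> * \<bar>K \<beta> \<beta>'\<bar>)"
        by (intro add_left_mono order_trans[OF sum_abs]) (simp add: abs_mult)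
      also have "\<dots> \<le> ?S + (\<Sum>\<beta>'\<in>?A. (C \<beta>' * \<bar>K \<beta> \<beta>'\<bar>) * ?S)"
      proof (intro add_mono sum_mono)
        show "\<bar>m \<beta>\<bar> \<le> ?S" using Q less.prems by (intro member_le_sum) auto
        fix \<beta>' assume \<beta>': "\<beta>' \<in> ?A"
        have "(\<Sum>\<alpha>\<in>{\<alpha>\<in>Q. \<beta>' \<le> \<alpha>}. \<bar>m \<alpha>\<bar>) \<le> ?S"
          using \<beta>' Q by (intro sum_mono2) auto
        then have "\<bar>c \<beta>'\<bar> \<le> C \<beta>' * ?S"
          by (rule order_trans[OF C2[OF \<beta>' eq] mult_left_mono[OF _ C[OF \<beta>']]])
        then have "\<bar>c \<beta>'\<bar> * \<bar>K \<beta> \<beta>'\<bar> \<le> (C \<beta>' * ?S) * \<bar>K \<beta> \<beta>'\<bar>" by (rule mult_right_mono) simp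
        then show "\<bar>c \<beta>'\<bar> * \<bar>K \<beta> \<beta>'\<bar> \<le> (C \<beta>' * \<bar>K \<beta> \<beta>'\<bar>) * ?S" by (simp add: ac_simps)
      qed
      also have "\<dots> = (1 + (\<Sum>\<beta>'\<in>?A. C \<beta>' * \<bar>K \<beta> \<beta>'\<bar>)) * ?S" by (simp add: distrib_right sum_distrib_right)
      finally show "\<bar>c \<beta>\<bar> \<le> D * ?S"
        unfolding D_def using diag[of \<beta>] by (simp add: field_simps)
    qed
  qed
qed

section \<open>Descent in the hull\<close>

text \<open>Each derivative is controlled by the two next higher ones, up to an error of size \<open>s\<close>. Starting from
  the indices outside \<open>Q\<close>, induction downwards on the degree controls everything; the constant grows by a
  factor \<open>1 + 3 C0\<close> in each step.\<close>

lemma descent_in_hull: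
  fixes C0 :: real and Q X :: "multi_index set"
  assumes Q: "finite Q" and X: "finite X" "\<And>\<alpha>. \<alpha> \<in> X \<inter> Q \<Longrightarrow> \<alpha> + (1,0) \<in> X \<and> \<alpha> + (0,1) \<in> X"
    and C0: "C0 \<ge> 0"
  shows "\<exists>C\<ge>0. \<forall>(N :: multi_index \<Rightarrow> ennreal) s. 0 \<le> s \<longrightarrow>
    (\<forall>\<alpha>\<in>X \<inter> Q. N \<alpha> \<le> ennreal C0 * (N (\<alpha> + (1,0)) + N (\<alpha> + (0,1)) + ennreal s)) \<longrightarrow>
    (\<forall>\<delta>\<in>X - Q. N \<delta> \<le> ennreal s) \<longrightarrow> (\<forall>\<alpha>\<in>X. N \<alpha> \<le> ennreal (C * s))"
proof -
  obtain M where M: "\<And>\<alpha>. \<alpha> \<in> X \<Longrightarrow> deg \<alpha> \<le> M" by (rule finite_deg_bound[OF X(1)]) (rule that)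
  let ?b = "1 + 3 * C0"
  have b1: "1 \<le> ?b ^ k" for k using C0 by (intro one_le_power) auto
  show ?thesis
  proof (rule exI[of _ "?b ^ M"], intro conjI allI impI ballI)
    show "?b ^ M \<ge> 0" using C0 by simp
    fix N s \<alpha>
    assume s: "0 \<le> s"
      and step: "\<forall>\<alpha>\<in>X \<inter> Q. N \<alpha> \<le> ennreal C0 * (N (\<alpha> + (1,0)) + N (\<alpha> + (0,1)) + ennreal s)"
      and base: "\<forall>\<delta>\<in>X - Q. N \<delta> \<le> ennreal s" and \<alpha>: "\<alpha> \<in> X"
    have "N \<alpha> \<le> ennreal (?b ^ (M - deg \<alpha>) * s)"
      using \<alpha>
    proof (induction \<alpha> rule: measure_induct_rule[of "\<lambda>\<alpha>. M - deg \<alpha>"])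
      case (less \<alpha>)
      show ?case
      proof (cases "\<alpha> \<in> Q")
        case False
        have "1 * s \<le> ?b ^ (M - deg \<alpha>) * s" using s b1 by (intro mult_right_mono) auto
        then have "ennreal s \<le> ennreal (?b ^ (M - deg \<alpha>) * s)" by (intro ennreal_leI) simp
        moreover have "N \<alpha> \<le> ennreal s" using base False less.prems by blast
        ultimately show ?thesis by (rule order_trans[rotated])
      next
        case True
        then have X': "\<alpha> + (1,0) \<in> X" "\<alpha> + (0,1) \<in> X" using X(2) less.prems by auto
        have d: "deg (\<alpha> + (1,0)) = Suc (deg \<alpha>)" "deg (\<alpha> + (0,1)) = Suc (deg \<alpha>)" by (auto simp: deg_def)
        define k where "k = M - Suc (deg \<alpha>)"
        have k: "M - deg \<alpha> = Suc k" using M[OF X'(1)] d by (simp add: k_def)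
        have IH: "N (\<alpha> + (1,0)) \<le> ennreal (?b ^ k * s)" "N (\<alpha> + (0,1)) \<le> ennreal (?b ^ k * s)"
          using less.IH[OF _ X'(1)] less.IH[OF _ X'(2)] k unfolding d k_def by auto
        have "N \<alpha> \<le> ennreal C0 * (N (\<alpha> + (1,0)) + N (\<alpha> + (0,1)) + ennreal s)"
          using step True less.prems by blast
        also have "\<dots> \<le> ennreal C0 * (ennreal (?b ^ k * s) + ennreal (?b ^ k * s) + ennreal s)"
          by (intro mult_left_mono add_mono IH) auto
        also have "\<dots> = ennreal (C0 * (?b ^ k * s + ?b ^ k * s + s))"
        proof -
          have *: "ennreal C0 * (ennreal a + ennreal a + ennreal s) = ennreal (C0 * (a + a + s))" if "a \<ge> 0" for a
            using C0 s that by (simp only: ennreal_mult ennreal_plus add_nonneg_nonneg)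
          show ?thesis by (rule *) (use C0 s in simp)
        qed
        also have "\<dots> \<le> ennreal (?b ^ Suc k * s)"
        proof (rule ennreal_leI)
          define a where "a = ?b ^ k * s"
          have 1: "s \<le> a" using s b1[of k] mult_right_mono[of 1 "?b ^ k" s] by (simp add: a_def)
          then have "C0 * (a + a + s) \<le> C0 * (3 * a)"
            using C0 by (intro mult_left_mono) auto
          also have "\<dots> \<le> (1 + 3 * C0) * a" using 1 s by (simp add: algebra_simps)
          finally show "C0 * (?b ^ k * s + ?b ^ k * s + s) \<le> ?b ^ Suc k * s"
            by (simp only: a_def power_Suc mult.assoc)
        qed
        finally show ?thesis unfolding k .
      qed
    qed
    also have "\<dots> \<le> ennreal (?b ^ M * s)"
      using C0 s by (intro ennreal_leI mult_right_mono power_increasing) auto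
    finally show "N \<alpha> \<le> ennreal (?b ^ M * s)" .
  qed
qed


section \<open>Poincare inequalities for regular distributions\<close>

lemma distribution_poincare:
  assumes p: "1 \<le> p" and U: "reference_domain U"
    and \<omega>: "\<omega> \<in> borel_measurable borel" and W: "\<And>x. \<bar>\<omega> x\<bar> \<le> W"
    and \<omega>1: "(\<integral>x. \<omega> x * indicator U x \<partial>lborel) = 1"
  shows "\<exists>C\<ge>0. \<forall>T g m. dens U T g \<longrightarrow> Lp_dnorm U p (wderiv U (1,0) T) < \<infinity> \<longrightarrow>
    Lp_dnorm U p (wderiv U (0,1) T) < \<infinity> \<longrightarrow> \<bar>\<integral>x. g x * (\<omega> x * indicator U x) \<partial>lborel\<bar> \<le> m \<longrightarrow>
    Lp_dnorm U p T \<le> ennreal C * (Lp_dnorm U p (wderiv U (1,0) T) + Lp_dnorm U p (wderiv U (0,1) T) + ennreal m)"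
proof -
  have oU: "open U" using U unfolding reference_domain_def by auto
  note [measurable] = borel_open[OF oU]
  obtain C where C: "C \<ge> 0" and est: "\<And>g L m. grad_bd p U g L \<Longrightarrow> \<bar>\<integral>x. g x * (\<omega> x * indicator U x) \<partial>lborel\<bar> \<le> m \<Longrightarrow>
     Lp_bd p U g (C * (L + m))"
    using poincare_weighted[OF p U \<omega> W \<omega>1] by blast
  show ?thesis
  proof (rule exI[of _ "2 * C"], intro conjI allI impI)
    show "0 \<le> 2 * C" using C by simp
    fix T g m
    assume g: "dens U T g" and fin: "Lp_dnorm U p (wderiv U (1,0) T) < \<infinity>" "Lp_dnorm U p (wderiv U (0,1) T) < \<infinity>"
      and m: "\<bar>\<integral>x. g x * (\<omega> x * indicator U x) \<partial>lborel\<bar> \<le> m"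
    have m0: "0 \<le> m" using m by (rule order_trans[OF abs_ge_zero])
    obtain K where K: "K \<ge> 0" "Lp_dnorm U p (wderiv U (1,0) T) = ennreal K" by (rule ennreal_lt_top_le[OF fin(1)])
    obtain L where L: "L \<ge> 0" "Lp_dnorm U p (wderiv U (0,1) T) = ennreal L" by (rule ennreal_lt_top_le[OF fin(2)])
    obtain g1 where g1: "dens U (wderiv U (1,0) T) g1" by (rule regular_dens[OF oU Lp_dnorm_regular[OF fin(1)]])
    obtain g2 where g2: "dens U (wderiv U (0,1) T) g2" by (rule regular_dens[OF oU Lp_dnorm_regular[OF fin(2)]])
    note [measurable] = dens_measurable[OF g1] dens_measurable[OF g2]
    have b: "Lp_bd p U g1 K" "Lp_bd p U g2 L"
      using Lp_dnorm_le_iff[OF oU p g1 K(1)] Lp_dnorm_le_iff[OF oU p g2 L(1)] K L by auto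
    have "Lp_bd p U (\<lambda>x. \<bar>g1 x\<bar> + \<bar>g2 x\<bar>) (2 * (K + L))"
      using K(1) L(1) by (intro Lp_bd_add[OF p] Lp_bd_mono[OF b(1)] Lp_bd_mono[OF b(2)]) auto
    then have "grad_bd p U g (2 * (K + L))"
      unfolding grad_bd_def using weak_grad_dens[OF oU g g1 g2] g g1 g2 K(1) L(1) by (auto simp: dens_def)
    from est[OF this m] have "Lp_bd p U g (C * (2 * (K + L) + m))" .
    then have "Lp_dnorm U p T \<le> ennreal (C * (2 * (K + L) + m))"
      using Lp_dnorm_le_iff[OF oU p g, of "C * (2 * (K + L) + m)"] C K(1) L(1) m0 by simp
    also have "\<dots> \<le> ennreal (2 * C * (K + L + m))"
      using C m0 by (intro ennreal_leI) (simp add: algebra_simps)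
    also have "\<dots> = ennreal (2 * C) * (ennreal K + ennreal L + ennreal m)"
      using C K(1) L(1) m0 by (simp only: ennreal_mult ennreal_plus add_nonneg_nonneg mult_nonneg_nonneg zero_le_numeral)
    finally show "Lp_dnorm U p T \<le> ennreal (2 * C) * (Lp_dnorm U p (wderiv U (1,0) T) + Lp_dnorm U p (wderiv U (0,1) T) + ennreal m)"
      using K L by simp
  qed
qed

lemma unit_test_function:
  assumes "open U" "U \<noteq> {}"
  obtains \<phi> where "\<phi> \<in> test_funs U" "(\<integral>x. \<phi> x \<partial>lborel) = 1"
proof -
  obtain z where "z \<in> U" using assms by blast
  then obtain r where r: "r > 0" "cball z r \<subseteq> U" using assms open_contains_cball by blast
  have "(\<integral>w. moll r (w + - z) \<partial>lborel) = 1"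
    using integral_translate[of "moll r" "- z"] moll_integral(1)[OF r(1)] by simp
  then show ?thesis using moll_test[OF r(2)] by (intro that[of "\<lambda>w. moll r (w - z)"]) simp_all
qed

lemma distribution_poincare_test:
  assumes p: "1 \<le> p" and U: "reference_domain U" and \<phi>: "\<phi> \<in> test_funs U" "(\<integral>x. \<phi> x \<partial>lborel) = 1"
  shows "\<exists>C\<ge>0. \<forall>T. Lp_dnorm U p T < \<infinity> \<longrightarrow> Lp_dnorm U p (wderiv U (1,0) T) < \<infinity> \<longrightarrow>
    Lp_dnorm U p (wderiv U (0,1) T) < \<infinity> \<longrightarrow>
    Lp_dnorm U p T \<le> ennreal C * (Lp_dnorm U p (wderiv U (1,0) T) + Lp_dnorm U p (wderiv U (0,1) T) + ennreal \<bar>T \<phi>\<bar>)"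
proof -
  have oU: "open U" using U unfolding reference_domain_def by auto
  obtain W where "W \<ge> 0" and W: "\<And>x. \<bar>\<phi> x\<bar> \<le> W" by (rule test_funs_bounded[OF \<phi>(1)]) (rule that)
  have ind: "\<phi> x * indicator U x = \<phi> x" for x
    using test_funs_outside[OF \<phi>(1)] by (cases "x \<in> U") auto
  obtain C where C: "C \<ge> 0" and est: "\<And>T g m. dens U T g \<Longrightarrow> Lp_dnorm U p (wderiv U (1,0) T) < \<infinity> \<Longrightarrow>
    Lp_dnorm U p (wderiv U (0,1) T) < \<infinity> \<Longrightarrow> \<bar>\<integral>x. g x * \<phi> x \<partial>lborel\<bar> \<le> m \<Longrightarrow>
    Lp_dnorm U p T \<le> ennreal C * (Lp_dnorm U p (wderiv U (1,0) T) + Lp_dnorm U p (wderiv U (0,1) T) + ennreal m)"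
    using distribution_poincare[OF p U test_funs_measurable[OF \<phi>(1)] W] \<phi>(2) unfolding ind by blast
  show ?thesis
  proof (rule exI[of _ C], intro conjI allI impI C)
    fix T assume fin: "Lp_dnorm U p T < \<infinity>" "Lp_dnorm U p (wderiv U (1,0) T) < \<infinity>" "Lp_dnorm U p (wderiv U (0,1) T) < \<infinity>"
    obtain g where g: "dens U T g" by (rule regular_dens[OF oU Lp_dnorm_regular[OF fin(1)]])
    show "Lp_dnorm U p T \<le> ennreal C * (Lp_dnorm U p (wderiv U (1,0) T) + Lp_dnorm U p (wderiv U (0,1) T) + ennreal \<bar>T \<phi>\<bar>)"
      by (rule est[OF g fin(2,3)]) (simp add: dens_test[OF oU g \<phi>(1)])
  qed
qed

lemma reference_domain_measure:
  assumes "reference_domain U"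
  obtains u where "u > 0" "emeasure lborel U = ennreal u"
proof -
  have U: "open U" "bounded U" "U \<noteq> {}" using assms unfolding reference_domain_def by auto
  obtain u where u: "u \<ge> 0" "emeasure lborel U = ennreal u" by (rule emeasure_bounded_real[OF U(2)]) (rule that)
  have "u \<noteq> 0" using u open_emeasure_nonzero[OF U(1,3)] by auto
  then show ?thesis using u that by simp
qed

lemma distribution_poincare_mean:
  assumes p: "1 \<le> p" and U: "reference_domain U"
  shows "\<exists>C\<ge>0. \<forall>T. Lp_dnorm U p T < \<infinity> \<longrightarrow> Lp_dnorm U p (wderiv U (1,0) T) < \<infinity> \<longrightarrow>
    Lp_dnorm U p (wderiv U (0,1) T) < \<infinity> \<longrightarrow> integral_over U T = 0 \<longrightarrow>
    Lp_dnorm U p T \<le> ennreal C * (Lp_dnorm U p (wderiv U (1,0) T) + Lp_dnorm U p (wderiv U (0,1) T))"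
proof -
  have oU: "open U" using U unfolding reference_domain_def by auto
  obtain u where u: "u > 0" "emeasure lborel U = ennreal u" by (rule reference_domain_measure[OF U])
  have m: "measure lborel U = u" using u by (simp add: measure_def)
  have \<omega>1: "(\<integral>x. (1/u) * indicator U x \<partial>lborel) = 1"
    using u m oU by simp
  obtain C where C: "C \<ge> 0" and est: "\<And>T g m. dens U T g \<Longrightarrow> Lp_dnorm U p (wderiv U (1,0) T) < \<infinity> \<Longrightarrow>
    Lp_dnorm U p (wderiv U (0,1) T) < \<infinity> \<Longrightarrow> \<bar>\<integral>x. g x * ((1/u) * indicator U x) \<partial>lborel\<bar> \<le> m \<Longrightarrow>
    Lp_dnorm U p T \<le> ennreal C * (Lp_dnorm U p (wderiv U (1,0) T) + Lp_dnorm U p (wderiv U (0,1) T) + ennreal m)"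
    using distribution_poincare[OF p U _ _ \<omega>1, of "1/u"] u(1) by auto
  show ?thesis
  proof (rule exI[of _ C], intro conjI allI impI C)
    fix T assume fin: "Lp_dnorm U p T < \<infinity>" "Lp_dnorm U p (wderiv U (1,0) T) < \<infinity>" "Lp_dnorm U p (wderiv U (0,1) T) < \<infinity>"
      and 0: "integral_over U T = 0"
    obtain g where g: "dens U T g" by (rule regular_dens[OF oU Lp_dnorm_regular[OF fin(1)]])
    have "(\<lambda>x. g x * ((1/u) * indicator U x)) = (\<lambda>x. (1/u) * g x)"
      using g by (auto simp: dens_def fun_eq_iff indicator_def)
    then have "(\<integral>x. g x * ((1/u) * indicator U x) \<partial>lborel) = (1/u) * (\<integral>x. g x \<partial>lborel)" by simp
    also have "\<dots> = 0" using integral_over_dens[OF oU g] 0 by simp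
    finally have "\<bar>\<integral>x. g x * ((1/u) * indicator U x) \<partial>lborel\<bar> \<le> 0" by simp
    from est[OF g fin(2,3) this]
    show "Lp_dnorm U p T \<le> ennreal C * (Lp_dnorm U p (wderiv U (1,0) T) + Lp_dnorm U p (wderiv U (0,1) T))"
      by simp
  qed
qed

text \<open>Applied with a constant \<open>h\<close> it bounds moments, and with a test function the values of distributions.\<close>

lemma dens_pairing_le:
  assumes p: "1 \<le> p" and U: "open U" "emeasure lborel U = ennreal u" "u \<ge> 0"
    and g: "dens U T g" and s: "Lp_dnorm U p T \<le> ennreal s" "s \<ge> 0"
    and h: "h \<in> borel_measurable borel" "\<And>x. \<bar>h x\<bar> \<le> B"
  shows "\<bar>\<integral>x. g x * h x \<partial>lborel\<bar> \<le> B * (1 + u) * s"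
proof -
  note [measurable] = dens_measurable[OF g] h(1)
  have B: "B \<ge> 0" using h(2)[of undefined] by (rule order_trans[OF abs_ge_zero])
  have gi: "integrable lborel g" and g0: "\<And>x. x \<notin> U \<Longrightarrow> g x = 0" using g by (auto simp: dens_def)
  have "Lp_bd p U g s" using Lp_dnorm_le_iff[OF U(1) p g s(2)] s(1) by simp
  then have L1: "(\<integral>\<^sup>+x. ennreal \<bar>g x\<bar> * indicator U x \<partial>lborel) \<le> ennreal (s * (1 + u))"
    using U s(2) by (intro Lp_bd_L1[OF p]) auto
  have "integrable lborel (\<lambda>x. g x * h x)" by (rule integrable_mult_bounded[OF gi _ h(2)]) simp
  then have "ennreal \<bar>\<integral>x. g x * h x \<partial>lborel\<bar> \<le> (\<integral>\<^sup>+x. ennreal (norm (g x * h x)) \<partial>lborel)"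
    using integral_norm_bound_ennreal by fastforce
  also have "\<dots> \<le> (\<integral>\<^sup>+x. ennreal B * (ennreal \<bar>g x\<bar> * indicator U x) \<partial>lborel)"
  proof (rule nn_integral_mono)
    fix x
    have "\<bar>g x\<bar> * \<bar>h x\<bar> \<le> B * \<bar>g x\<bar>" using mult_right_mono[OF h(2)[of x], of "\<bar>g x\<bar>"] by (simp add: mult.commute)
    then show "ennreal (norm (g x * h x)) \<le> ennreal B * (ennreal \<bar>g x\<bar> * indicator U x)"
      using g0[of x] B by (cases "x \<in> U") (auto simp: abs_mult ennreal_mult[symmetric] intro!: ennreal_leI)
  qed
  also have "\<dots> = ennreal B * (\<integral>\<^sup>+x. ennreal \<bar>g x\<bar> * indicator U x \<partial>lborel)"
    using U(1) by (intro nn_integral_cmult) simp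
  also have "\<dots> \<le> ennreal B * ennreal (s * (1 + u))" by (intro mult_left_mono L1) simp
  also have "\<dots> = ennreal (B * (1 + u) * s)"
    using B s(2) U(3) by (simp add: ennreal_mult[symmetric] ac_simps)
  finally show ?thesis using B s(2) U(3) by (subst (asm) ennreal_le_iff) auto
qed

section \<open>The moment polynomial\<close>

lemma finite_idx_hull: "finite Q \<Longrightarrow> finite (idx_hull Q)"
proof -
  assume "finite Q"
  moreover have "idx_hull Q = Q \<union> (\<lambda>\<alpha>. \<alpha> + (1,0)) ` Q \<union> (\<lambda>\<alpha>. \<alpha> + (0,1)) ` Q"
    unfolding idx_hull_def by blast
  ultimately show ?thesis by simp
qed

lemma idx_hull_mem:
  assumes "\<alpha> \<in> Q"
  shows "\<alpha> \<in> idx_hull Q" "\<alpha> + (1,0) \<in> idx_hull Q" "\<alpha> + (0,1) \<in> idx_hull Q"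
  using assms unfolding idx_hull_def by blast+

definition mpoly :: "multi_index set \<Rightarrow> multi_index \<Rightarrow> (multi_index \<Rightarrow> real) \<Rightarrow> plane \<Rightarrow> real" where
  "mpoly Q \<gamma> c = (\<Sum>\<beta>\<in>Q. c \<beta> *\<^sub>R monom2 (\<beta> + \<gamma>))"

text \<open>The integral of the derivative of index \<open>\<alpha> + \<gamma>\<close> of the monomial \<open>\<beta> + \<gamma>\<close>: the entry of the matrix of the
  moment conditions in row \<open>\<alpha>\<close> and column \<open>\<beta>\<close>.\<close>

definition moment :: "plane set \<Rightarrow> multi_index \<Rightarrow> multi_index \<Rightarrow> multi_index \<Rightarrow> real" where
  "moment U \<gamma> \<alpha> \<beta> = (\<integral>x. pderivs (\<alpha> + \<gamma>) (monom2 (\<beta> + \<gamma>)) x * indicator U x \<partial>lborel)"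

lemma polys_eq_mpoly:
  assumes "finite Q"
  shows "polys (idx_shift Q \<gamma>) = range (mpoly Q \<gamma>)"
proof
  have mem: "monom2 (\<beta> + \<gamma>) \<in> span (monom2 ` idx_shift Q \<gamma>)" if "\<beta> \<in> Q" for \<beta>
    using that by (intro span_base) (auto simp: idx_shift_def)
  show "range (mpoly Q \<gamma>) \<subseteq> polys (idx_shift Q \<gamma>)"
    unfolding polys_def mpoly_def by (auto intro!: span_sum span_scale mem)
  show "polys (idx_shift Q \<gamma>) \<subseteq> range (mpoly Q \<gamma>)"
    unfolding polys_def
  proof (rule span_minimal)
    show "monom2 ` idx_shift Q \<gamma> \<subseteq> range (mpoly Q \<gamma>)"
    proof
      fix f assume "f \<in> monom2 ` idx_shift Q \<gamma>"
      then obtain \<beta> where \<beta>: "\<beta> \<in> Q" "f = monom2 (\<beta> + \<gamma>)" by (auto simp: idx_shift_def)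
      have "mpoly Q \<gamma> (\<lambda>b. if b = \<beta> then 1 else 0) = (\<Sum>b\<in>Q. if b = \<beta> then monom2 (b + \<gamma>) else 0)"
        unfolding mpoly_def by (intro sum.cong) auto
      also have "\<dots> = f" using \<beta> assms by (simp only: sum.delta if_True)
      finally show "f \<in> range (mpoly Q \<gamma>)" by (metis rangeI)
    qed
    show "subspace (range (mpoly Q \<gamma>))"
    proof (rule subspaceI)
      have "mpoly Q \<gamma> (\<lambda>_. 0) = 0" unfolding mpoly_def by (simp only: scaleR_zero_left sum.neutral_const)
      then show "0 \<in> range (mpoly Q \<gamma>)" by (metis rangeI)
    next
      fix f g assume "f \<in> range (mpoly Q \<gamma>)" "g \<in> range (mpoly Q \<gamma>)"
      then obtain c d where cd: "f = mpoly Q \<gamma> c" "g = mpoly Q \<gamma> d" by blast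
      have "f + g = mpoly Q \<gamma> (\<lambda>\<beta>. c \<beta> + d \<beta>)"
        unfolding cd mpoly_def by (simp only: scaleR_left_distrib sum.distrib)
      then show "f + g \<in> range (mpoly Q \<gamma>)" by (metis rangeI)
    next
      fix a f assume "f \<in> range (mpoly Q \<gamma>)"
      then obtain c where c: "f = mpoly Q \<gamma> c" by blast
      have "a *\<^sub>R f = mpoly Q \<gamma> (\<lambda>\<beta>. a * c \<beta>)"
        unfolding c mpoly_def by (simp only: scaleR_sum_right scaleR_scaleR)
      then show "a *\<^sub>R f \<in> range (mpoly Q \<gamma>)" by (metis rangeI)
    qed
  qed
qed

lemma mpoly_Ck: "mpoly Q \<gamma> c \<in> Ck k U"
  unfolding mpoly_def by (intro polynomial_Ck span_sum span_scale span_base rangeI)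

lemma moment_triangular: "\<not> \<alpha> \<le> \<beta> \<Longrightarrow> moment U \<gamma> \<alpha> \<beta> = 0"
proof -
  assume "\<not> \<alpha> \<le> \<beta>"
  then have "\<not> \<alpha> + \<gamma> \<le> \<beta> + \<gamma>" by (auto simp: less_eq_prod_def)
  then show ?thesis by (simp add: moment_def pderivs_monom2 dcoeff_eq_0)
qed

text \<open>On the diagonal the derivative of the monomial is a nonzero constant.\<close>

lemma moment_diagonal:
  assumes "reference_domain U"
  shows "moment U \<gamma> \<alpha> \<alpha> \<noteq> 0"
proof -
  have oU: "open U" using assms unfolding reference_domain_def by auto
  obtain u where u: "u > 0" "emeasure lborel U = ennreal u" by (rule reference_domain_measure[OF assms])
  have m: "measure lborel U = u" using u by (simp add: measure_def)
  have "monom2 (\<alpha> + \<gamma> - (\<alpha> + \<gamma>)) x = 1" for x by (simp add: monom2_def)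
  then have "moment U \<gamma> \<alpha> \<alpha> = dcoeff (\<alpha> + \<gamma>) (\<alpha> + \<gamma>) * u"
    using oU m by (simp add: moment_def pderivs_monom2 scaleR_fun_def)
  then show ?thesis using dcoeff_nonzero[of "\<alpha> + \<gamma>" "\<alpha> + \<gamma>"] u(1) by simp
qed

lemma wderiv_mpoly:
  assumes U: "open U" "bounded U" and Q: "finite Q"
  shows "mpoly Q \<gamma> c \<in> L1 U"
    and "wderiv U \<alpha> (Dw U \<gamma> (mpoly Q \<gamma> c)) = (\<Sum>\<beta>\<in>Q. c \<beta> *\<^sub>R dist_of U (pderivs (\<alpha> + \<gamma>) (monom2 (\<beta> + \<gamma>))))"
proof -
  have L: "monom2 \<beta> \<in> L1 U" for \<beta>
    by (rule dens_continuous(1)[OF U smooth_continuous[OF smooth_monom2]])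
  note s = dist_of_sum[OF U(1) Q, of "\<lambda>\<beta>. monom2 (\<beta> + \<gamma>)" c, OF L]
  show "mpoly Q \<gamma> c \<in> L1 U" unfolding mpoly_def using s by blast
  have "wderiv U \<alpha> (Dw U \<gamma> (mpoly Q \<gamma> c)) = wderiv U (\<alpha> + \<gamma>) (\<Sum>\<beta>\<in>Q. c \<beta> *\<^sub>R dist_of U (monom2 (\<beta> + \<gamma>)))"
    unfolding Dw_def wderiv_wderiv mpoly_def using s by simp
  also have "\<dots> = (\<Sum>\<beta>\<in>Q. c \<beta> *\<^sub>R dist_of U (pderivs (\<alpha> + \<gamma>) (monom2 (\<beta> + \<gamma>))))"
    unfolding wderiv_sum[OF Q] wderiv_smooth[OF U smooth_monom2] ..
  finally show "wderiv U \<alpha> (Dw U \<gamma> (mpoly Q \<gamma> c)) = (\<Sum>\<beta>\<in>Q. c \<beta> *\<^sub>R dist_of U (pderivs (\<alpha> + \<gamma>) (monom2 (\<beta> + \<gamma>))))" .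
qed

lemma dens_pderivs_monom2:
  assumes U: "open U" "bounded U"
  shows "dens U (dist_of U (pderivs \<alpha> (monom2 \<beta>))) (\<lambda>x. pderivs \<alpha> (monom2 \<beta>) x * indicator U x)"
  by (rule dens_continuous(2)[OF U smooth_continuous[OF smooth_pderivs[OF smooth_monom2]]])

lemma Lp_dnorm_finite_of_bounded:
  assumes U: "open U" "bounded U" and p: "1 \<le> p" and f: "continuous_on UNIV f"
  shows "Lp_dnorm U p (dist_of U f) < \<infinity>"
proof -
  have "compact (closure U)" "continuous_on (closure U) f" using U f continuous_on_subset by auto
  then have "bounded (f ` closure U)" by (intro compact_imp_bounded compact_continuous_image)
  then obtain B where B: "\<And>x. x \<in> closure U \<Longrightarrow> \<bar>f x\<bar> \<le> B" unfolding bounded_iff by fastforce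
  obtain u where u: "u \<ge> 0" "emeasure lborel U = ennreal u" by (rule emeasure_bounded_real[OF U(2)]) (rule that)
  have "Lp_bd p U (\<lambda>x. f x * indicator U x) (\<bar>B\<bar> * (1 + u))"
  proof (rule Lp_bd_mono[OF Lp_bd_const[OF p _ u(2,1)]])
    show "AE x in lborel. x \<in> U \<longrightarrow> \<bar>f x * indicator U x\<bar> \<le> \<bar>B\<bar>"
      using B closure_subset[of U] by (intro AE_I2) force
  qed (use U u in auto)
  then have "Lp_dnorm U p (dist_of U f) \<le> ennreal (\<bar>B\<bar> * (1 + u))"
    using Lp_dnorm_le_iff[OF U(1) p dens_continuous(2)[OF U f], of "\<bar>B\<bar> * (1 + u)"] u(1) by simp
  then show ?thesis by (rule order_le_less_trans) (simp add: ennreal_less_top)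
qed

lemma integral_over_diff_mpoly:
  assumes U: "open U" "bounded U" and Q: "finite Q" and T: "is_regular U (wderiv U \<alpha> T)"
  shows "integral_over U (wderiv U \<alpha> (T - Dw U \<gamma> (mpoly Q \<gamma> c)))
    = integral_over U (wderiv U \<alpha> T) - (\<Sum>\<beta>\<in>Q. c \<beta> * moment U \<gamma> \<alpha> \<beta>)"
proof -
  obtain g where g: "dens U (wderiv U \<alpha> T) g" by (rule regular_dens[OF U(1) T])
  let ?m = "\<lambda>\<beta> x. pderivs (\<alpha> + \<gamma>) (monom2 (\<beta> + \<gamma>)) x * indicator U x"
  have h: "dens U (wderiv U \<alpha> (Dw U \<gamma> (mpoly Q \<gamma> c))) (\<lambda>x. \<Sum>\<beta>\<in>Q. c \<beta> * ?m \<beta> x)"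
    unfolding wderiv_mpoly(2)[OF U Q] by (intro dens_sum[OF U(1) Q] dens_pderivs_monom2[OF U])
  have im: "integrable lborel (?m \<beta>)" for \<beta>
    using dens_pderivs_monom2[OF U] by (simp add: dens_def)
  have "T - Dw U \<gamma> (mpoly Q \<gamma> c) = 1 *\<^sub>R T + (-1) *\<^sub>R Dw U \<gamma> (mpoly Q \<gamma> c)" by simp
  then have "dens U (wderiv U \<alpha> (T - Dw U \<gamma> (mpoly Q \<gamma> c))) (\<lambda>x. 1 * g x + (-1) * (\<Sum>\<beta>\<in>Q. c \<beta> * ?m \<beta> x))"
    using dens_lincomb[OF U(1) g h, of 1 "-1"] by (simp only: wderiv_lincomb)
  from integral_over_dens[OF U(1) this]
  have "integral_over U (wderiv U \<alpha> (T - Dw U \<gamma> (mpoly Q \<gamma> c)))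
      = (\<integral>x. g x - (\<Sum>\<beta>\<in>Q. c \<beta> * ?m \<beta> x) \<partial>lborel)" by simp
  also have "\<dots> = (\<integral>x. g x \<partial>lborel) - (\<integral>x. (\<Sum>\<beta>\<in>Q. c \<beta> * ?m \<beta> x) \<partial>lborel)"
    using g im by (intro Bochner_Integration.integral_diff) (auto simp: dens_def)
  also have "(\<integral>x. (\<Sum>\<beta>\<in>Q. c \<beta> * ?m \<beta> x) \<partial>lborel) = (\<Sum>\<beta>\<in>Q. c \<beta> * moment U \<gamma> \<alpha> \<beta>)"
    unfolding moment_def using im by (subst Bochner_Integration.integral_sum) auto
  finally show ?thesis unfolding integral_over_dens[OF U(1) g] .
qed

section \<open>The estimate for the moment polynomial\<close>

text \<open>The indices of the hull lying above an index that contributes to the seminorm. Derivatives with such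
  indices are derivatives of those in the seminorm. For \<open>Q\<close> closed under passing to smaller indices,
  the shadow is disjoint from \<open>Q\<close>.\<close>

definition shadow :: "multi_index set \<Rightarrow> multi_index set" where
  "shadow Q = {\<alpha>\<in>idx_hull Q. \<exists>\<delta>\<in>idx_hull Q - Q. \<delta> \<le> \<alpha>}"

lemma shadow_step: "\<alpha> \<in> shadow Q \<inter> Q \<Longrightarrow> \<alpha> + (1,0) \<in> shadow Q \<and> \<alpha> + (0,1) \<in> shadow Q"
proof -
  assume \<alpha>: "\<alpha> \<in> shadow Q \<inter> Q"
  then obtain \<delta> where \<delta>: "\<delta> \<in> idx_hull Q - Q" "\<delta> \<le> \<alpha>" unfolding shadow_def by blast
  have "\<delta> \<le> \<alpha> + (1,0)" "\<delta> \<le> \<alpha> + (0,1)" using \<delta>(2) by (auto simp: less_eq_prod_def)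
  then show ?thesis using \<delta>(1) \<alpha> idx_hull_mem[of \<alpha> Q] unfolding shadow_def by blast
qed

definition admissible :: "plane set \<Rightarrow> ennreal \<Rightarrow> multi_index set \<Rightarrow> distribution \<Rightarrow> bool" where
  "admissible U p Q T \<longleftrightarrow> (\<forall>\<alpha>\<in>idx_hull Q. Lp_dnorm U p (wderiv U \<alpha> T) < \<infinity>)"

text \<open>\<open>s\<close> is an upper bound for all norms occurring in the seminorm that belongs to the hull of \<open>Q\<close>.\<close>

definition semi_le :: "plane set \<Rightarrow> ennreal \<Rightarrow> multi_index set \<Rightarrow> distribution \<Rightarrow> real \<Rightarrow> bool" where
  "semi_le U p Q T s \<longleftrightarrow> 0 \<le> s \<and> (\<forall>\<delta>\<in>idx_hull Q - Q. Lp_dnorm U p (wderiv U \<delta> T) \<le> ennreal s)"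

definition moments_match ::
    "plane set \<Rightarrow> multi_index set \<Rightarrow> multi_index \<Rightarrow> distribution \<Rightarrow> (multi_index \<Rightarrow> real) \<Rightarrow> bool" where
  "moments_match U Q \<gamma> T c \<longleftrightarrow>
     (\<forall>\<alpha>\<in>Q. (\<Sum>\<beta>\<in>Q. c \<beta> * moment U \<gamma> \<alpha> \<beta>) = integral_over U (wderiv U \<alpha> T))"

text \<open>With \<open>\<delta>\<close> below \<open>\<alpha>\<close> and outside \<open>Q\<close>, the remaining \<open>\<alpha> - \<delta>\<close> derivatives are moved to the
  test function.\<close>

lemma shadow_pairing:
  assumes p: "1 \<le> p" and U: "reference_domain U" and \<phi>: "\<phi> \<in> test_funs U" and \<alpha>: "\<alpha> \<in> shadow Q"
  shows "\<exists>B\<ge>0. \<forall>T s. semi_le U p Q T s \<longrightarrow> \<bar>wderiv U \<alpha> T \<phi>\<bar> \<le> B * s"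
proof -
  have oU: "open U" using U unfolding reference_domain_def by auto
  obtain u where u: "u > 0" "emeasure lborel U = ennreal u" by (rule reference_domain_measure[OF U])
  obtain \<delta> where \<delta>: "\<delta> \<in> idx_hull Q - Q" "\<delta> \<le> \<alpha>" using \<alpha> unfolding shadow_def by blast
  let ?\<psi> = "pderivs (\<alpha> - \<delta>) \<phi>"
  have \<psi>: "?\<psi> \<in> test_funs U" by (rule test_funs_pderivs[OF \<phi>])
  obtain B where B: "B \<ge> 0" "\<And>x. \<bar>?\<psi> x\<bar> \<le> B" by (rule test_funs_bounded[OF \<psi>]) (rule that)
  have ad: "\<alpha> - \<delta> + \<delta> = \<alpha>" using \<delta>(2) by (cases \<alpha>; cases \<delta>) (auto simp: less_eq_prod_def)
  show ?thesis
  proof (rule exI[of _ "B * (1 + u)"], intro conjI allI impI)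
    show "0 \<le> B * (1 + u)" using B u by simp
    fix T s assume s: "semi_le U p Q T s"
    then have N: "Lp_dnorm U p (wderiv U \<delta> T) \<le> ennreal s" "0 \<le> s" using \<delta>(1) unfolding semi_le_def by auto
    have "Lp_dnorm U p (wderiv U \<delta> T) < \<infinity>" using N(1) by (rule order_le_less_trans) (simp add: ennreal_less_top)
    then obtain g where g: "dens U (wderiv U \<delta> T) g" using regular_dens[OF oU Lp_dnorm_regular] by blast
    have "wderiv U \<alpha> T \<phi> = wderiv U (\<alpha> - \<delta>) (wderiv U \<delta> T) \<phi>" by (simp add: wderiv_wderiv ad)
    also have "\<bar>\<dots>\<bar> = \<bar>wderiv U \<delta> T ?\<psi>\<bar>" using \<phi> by (simp add: wderiv_def[of U "\<alpha> - \<delta>"] abs_mult power_abs)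
    also have "wderiv U \<delta> T ?\<psi> = (\<integral>x. g x * ?\<psi> x \<partial>lborel)" by (rule dens_test[OF oU g \<psi>])
    also have "\<bar>\<dots>\<bar> \<le> B * (1 + u) * s"
      by (rule dens_pairing_le[OF p oU u(2) _ g N test_funs_measurable[OF \<psi>] B(2)]) (use u in simp)
    finally show "\<bar>wderiv U \<alpha> T \<phi>\<bar> \<le> B * (1 + u) * s" .
  qed
qed

text \<open>Descent, using the Poincare inequality whose weight is a test function \<open>\<phi>\<close> of integral 1:
  \<open>shadow_pairing\<close> bounds the weighted mean by the seminorm.\<close>

lemma shadow_estimate:
  assumes p: "1 \<le> p" and U: "reference_domain U" and Q: "finite Q"
  shows "\<exists>C\<ge>0. \<forall>T s. admissible U p Q T \<longrightarrow> semi_le U p Q T s \<longrightarrow>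
    (\<forall>\<alpha>\<in>shadow Q. Lp_dnorm U p (wderiv U \<alpha> T) \<le> ennreal (C * s))"
proof -
  have oU: "open U" "U \<noteq> {}" using U unfolding reference_domain_def by auto
  obtain \<phi> where \<phi>: "\<phi> \<in> test_funs U" "(\<integral>x. \<phi> x \<partial>lborel) = 1" by (rule unit_test_function[OF oU])
  obtain Cp where Cp: "Cp \<ge> 0" and poin: "\<And>T. Lp_dnorm U p T < \<infinity> \<Longrightarrow> Lp_dnorm U p (wderiv U (1,0) T) < \<infinity> \<Longrightarrow>
    Lp_dnorm U p (wderiv U (0,1) T) < \<infinity> \<Longrightarrow>
    Lp_dnorm U p T \<le> ennreal Cp * (Lp_dnorm U p (wderiv U (1,0) T) + Lp_dnorm U p (wderiv U (0,1) T) + ennreal \<bar>T \<phi>\<bar>)"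
    using distribution_poincare_test[OF p U \<phi>] by blast
  have fX: "finite (shadow Q)" unfolding shadow_def using finite_idx_hull[OF Q] by simp
  have "\<forall>\<alpha>\<in>shadow Q. \<exists>B. B \<ge> 0 \<and> (\<forall>T s. semi_le U p Q T s \<longrightarrow> \<bar>wderiv U \<alpha> T \<phi>\<bar> \<le> B * s)"
    using shadow_pairing[OF p U \<phi>(1)] by blast
  from bchoice[OF this] obtain B where B: "\<forall>\<alpha>\<in>shadow Q. B \<alpha> \<ge> 0 \<and> (\<forall>T s. semi_le U p Q T s \<longrightarrow> \<bar>wderiv U \<alpha> T \<phi>\<bar> \<le> B \<alpha> * s)" ..
  define B1 where "B1 = 1 + sum B (shadow Q)"
  have B1: "B \<alpha> \<le> B1" if "\<alpha> \<in> shadow Q" for \<alpha>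
    using member_le_sum[OF that, of B] B fX by (auto simp: B1_def)
  have B1': "B1 \<ge> 1" unfolding B1_def using B by (simp add: sum_nonneg)
  have C0: "Cp * B1 \<ge> 0" using Cp B1' by simp
  obtain C where C: "C \<ge> 0" and desc: "\<And>(N :: multi_index \<Rightarrow> ennreal) s. 0 \<le> s \<Longrightarrow>
    (\<forall>\<alpha>\<in>shadow Q \<inter> Q. N \<alpha> \<le> ennreal (Cp * B1) * (N (\<alpha> + (1,0)) + N (\<alpha> + (0,1)) + ennreal s)) \<Longrightarrow>
    (\<forall>\<delta>\<in>shadow Q - Q. N \<delta> \<le> ennreal s) \<Longrightarrow> (\<forall>\<alpha>\<in>shadow Q. N \<alpha> \<le> ennreal (C * s))"
    using descent_in_hull[OF Q fX shadow_step C0] by blast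
  show ?thesis
  proof (rule exI[of _ C], intro conjI allI impI C)
    fix T s assume T: "admissible U p Q T" and s: "semi_le U p Q T s"
    let ?N = "\<lambda>\<alpha>. Lp_dnorm U p (wderiv U \<alpha> T)"
    have s0: "0 \<le> s" using s by (simp add: semi_le_def)
    show "\<forall>\<alpha>\<in>shadow Q. ?N \<alpha> \<le> ennreal (C * s)"
    proof (rule desc[OF s0])
      show "\<forall>\<delta>\<in>shadow Q - Q. ?N \<delta> \<le> ennreal s" using s unfolding semi_le_def shadow_def by blast
      show "\<forall>\<alpha>\<in>shadow Q \<inter> Q. ?N \<alpha> \<le> ennreal (Cp * B1) * (?N (\<alpha> + (1,0)) + ?N (\<alpha> + (0,1)) + ennreal s)"
      proof
        fix \<alpha> assume \<alpha>: "\<alpha> \<in> shadow Q \<inter> Q"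
        have w: "wderiv U (1,0) (wderiv U \<alpha> T) = wderiv U (\<alpha> + (1,0)) T"
          "wderiv U (0,1) (wderiv U \<alpha> T) = wderiv U (\<alpha> + (0,1)) T"
          by (simp_all only: wderiv_wderiv add.commute)
        have fin: "?N \<alpha> < \<infinity>" "?N (\<alpha> + (1,0)) < \<infinity>" "?N (\<alpha> + (0,1)) < \<infinity>"
          using T idx_hull_mem[of \<alpha> Q] \<alpha> unfolding admissible_def by blast+
        have "?N \<alpha> \<le> ennreal Cp * (?N (\<alpha> + (1,0)) + ?N (\<alpha> + (0,1)) + ennreal \<bar>wderiv U \<alpha> T \<phi>\<bar>)"
          using poin[of "wderiv U \<alpha> T"] fin unfolding w by blast
        also have "\<dots> \<le> ennreal Cp * (ennreal B1 * ?N (\<alpha> + (1,0)) + ennreal B1 * ?N (\<alpha> + (0,1)) + ennreal B1 * ennreal s)"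
        proof (intro mult_left_mono add_mono)
          have one: "1 * x \<le> ennreal B1 * x" for x using B1' by (intro mult_right_mono) (simp_all flip: ennreal_1)
          show "?N (\<alpha> + (1,0)) \<le> ennreal B1 * ?N (\<alpha> + (1,0))" "?N (\<alpha> + (0,1)) \<le> ennreal B1 * ?N (\<alpha> + (0,1))"
            using one[of "?N (\<alpha> + (1,0))"] one[of "?N (\<alpha> + (0,1))"] by simp_all
          have "\<bar>wderiv U \<alpha> T \<phi>\<bar> \<le> B \<alpha> * s" using B \<alpha> s by blast
          also have "\<dots> \<le> B1 * s" using B1[of \<alpha>] \<alpha> s0 by (intro mult_right_mono) auto
          finally show "ennreal \<bar>wderiv U \<alpha> T \<phi>\<bar> \<le> ennreal B1 * ennreal s"
            using B1' s0 by (simp add: ennreal_mult[symmetric] ennreal_leI)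
        qed auto
        also have "\<dots> = ennreal (Cp * B1) * (?N (\<alpha> + (1,0)) + ?N (\<alpha> + (0,1)) + ennreal s)"
          using Cp B1' by (simp add: ennreal_mult distrib_left mult.assoc)
        finally show "?N \<alpha> \<le> ennreal (Cp * B1) * (?N (\<alpha> + (1,0)) + ?N (\<alpha> + (0,1)) + ennreal s)" .
      qed
    qed
  qed
qed

text \<open>The coefficient at \<open>\<beta>\<close> is bounded by the moments at indices above \<open>\<beta>\<close>. These indices are again in the
  shadow, where the derivatives are bounded by the seminorm.\<close>

lemma moment_coefficient_estimate:
  assumes p: "1 \<le> p" and U: "reference_domain U" and Q: "finite Q" and \<beta>: "\<beta> \<in> Q \<inter> shadow Q"
  shows "\<exists>C\<ge>0. \<forall>T s c. admissible U p Q T \<longrightarrow> semi_le U p Q T s \<longrightarrow>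
    moments_match U Q \<gamma> T c \<longrightarrow> \<bar>c \<beta>\<bar> \<le> C * s"
proof -
  have oU: "open U" using U unfolding reference_domain_def by auto
  obtain u where u: "u > 0" "emeasure lborel U = ennreal u" by (rule reference_domain_measure[OF U])
  obtain C1 where C1: "C1 \<ge> 0" "\<And>T s. admissible U p Q T \<Longrightarrow> semi_le U p Q T s \<Longrightarrow>
    \<forall>\<alpha>\<in>shadow Q. Lp_dnorm U p (wderiv U \<alpha> T) \<le> ennreal (C1 * s)"
    using shadow_estimate[OF p U Q] by blast
  obtain C2 where C2: "C2 \<ge> 0" "\<And>c m. (\<forall>\<alpha>\<in>Q. (\<Sum>\<beta>\<in>Q. c \<beta> * moment U \<gamma> \<alpha> \<beta>) = m \<alpha>) \<Longrightarrow>
    \<bar>c \<beta>\<bar> \<le> C2 * (\<Sum>\<alpha>\<in>{\<alpha>\<in>Q. \<beta> \<le> \<alpha>}. \<bar>m \<alpha>\<bar>)"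
    using triangular_bound[where K = "moment U \<gamma>" and \<beta> = \<beta>, OF Q moment_triangular moment_diagonal[OF U]] \<beta> by blast
  let ?n = "real (card {\<alpha>\<in>Q. \<beta> \<le> \<alpha>})"
  show ?thesis
  proof (rule exI[of _ "C2 * (?n * ((1 + u) * C1))"], intro conjI allI impI)
    show "0 \<le> C2 * (?n * ((1 + u) * C1))" using C1 C2 u by simp
    fix T s c assume T: "admissible U p Q T" and s: "semi_le U p Q T s"
      and eq: "moments_match U Q \<gamma> T c"
    have s0: "0 \<le> s" using s by (simp add: semi_le_def)
    have b: "\<bar>integral_over U (wderiv U \<alpha> T)\<bar> \<le> (1 + u) * C1 * s" if "\<alpha> \<in> {\<alpha>\<in>Q. \<beta> \<le> \<alpha>}" for \<alpha>
    proof -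
      have \<alpha>: "\<alpha> \<in> shadow Q"
        using that \<beta> idx_hull_mem(1)[of \<alpha> Q] unfolding shadow_def by (auto intro: order_trans)
      have N: "Lp_dnorm U p (wderiv U \<alpha> T) \<le> ennreal (C1 * s)" using C1(2)[OF T s] \<alpha> by blast
      then have "Lp_dnorm U p (wderiv U \<alpha> T) < \<infinity>" by (rule order_le_less_trans) (simp add: ennreal_less_top)
      then obtain g where g: "dens U (wderiv U \<alpha> T) g" using regular_dens[OF oU Lp_dnorm_regular] by blast
      have "\<bar>\<integral>x. g x * 1 \<partial>lborel\<bar> \<le> 1 * (1 + u) * (C1 * s)"
        by (rule dens_pairing_le[OF p oU u(2) _ g N]) (use u C1 s0 in auto)
      then show ?thesis using integral_over_dens[OF oU g] by (simp add: mult.assoc)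
    qed
    have "\<bar>c \<beta>\<bar> \<le> C2 * (\<Sum>\<alpha>\<in>{\<alpha>\<in>Q. \<beta> \<le> \<alpha>}. \<bar>integral_over U (wderiv U \<alpha> T)\<bar>)" by (rule C2(2)[OF eq[unfolded moments_match_def]])
    also have "\<dots> \<le> C2 * (?n * ((1 + u) * C1 * s))"
      using sum_bounded_above[of "{\<alpha>\<in>Q. \<beta> \<le> \<alpha>}" "\<lambda>\<alpha>. \<bar>integral_over U (wderiv U \<alpha> T)\<bar>", OF b] C2(1)
      by (intro mult_left_mono) auto
    finally show "\<bar>c \<beta>\<bar> \<le> C2 * (?n * ((1 + u) * C1)) * s" by (simp add: mult.assoc)
  qed
qed

lemma Lp_dnorm_wderiv_lincomb:
  assumes "open U" "1 \<le> p"
  shows "Lp_dnorm U p (wderiv U \<alpha> (a *\<^sub>R T + b *\<^sub>R T')) \<le>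
    2 * (ennreal \<bar>a\<bar> * Lp_dnorm U p (wderiv U \<alpha> T) + ennreal \<bar>b\<bar> * Lp_dnorm U p (wderiv U \<alpha> T'))"
  unfolding wderiv_lincomb by (rule Lp_dnorm_lincomb[OF assms])

text \<open>A monomial \<open>\<beta>\<close> survives the derivative \<open>\<delta>\<close> outside \<open>Q\<close> only if \<open>\<delta> \<le> \<beta>\<close>, that is, if
  \<open>\<beta>\<close> is in the shadow; so only coefficients bounded by the seminorm contribute.\<close>

lemma moment_remainder_semi:
  assumes p: "1 \<le> p" and U: "reference_domain U" and Q: "finite Q"
  shows "\<exists>C\<ge>0. \<forall>T s c. admissible U p Q T \<longrightarrow> semi_le U p Q T s \<longrightarrow>
    moments_match U Q \<gamma> T c \<longrightarrow>
    semi_le U p Q (T - Dw U \<gamma> (mpoly Q \<gamma> c)) (C * s)"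
proof -
  have U': "open U" "bounded U" using U unfolding reference_domain_def by auto
  have "\<forall>\<beta>\<in>Q \<inter> shadow Q. \<exists>C. C \<ge> 0 \<and> (\<forall>T s c. admissible U p Q T \<longrightarrow> semi_le U p Q T s \<longrightarrow>
    moments_match U Q \<gamma> T c \<longrightarrow> \<bar>c \<beta>\<bar> \<le> C * s)"
    using moment_coefficient_estimate[OF p U Q] by blast
  from bchoice[OF this] obtain C where C: "\<forall>\<beta>\<in>Q \<inter> shadow Q. C \<beta> \<ge> 0 \<and> (\<forall>T s c. admissible U p Q T \<longrightarrow> semi_le U p Q T s \<longrightarrow>
    moments_match U Q \<gamma> T c \<longrightarrow> \<bar>c \<beta>\<bar> \<le> C \<beta> * s)" ..
  let ?E = "\<lambda>\<delta> \<beta>. Lp_dnorm U p (dist_of U (pderivs (\<delta> + \<gamma>) (monom2 (\<beta> + \<gamma>))))"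
  define e where "e \<delta> \<beta> = enn2real (?E \<delta> \<beta>)" for \<delta> \<beta>
  have e: "?E \<delta> \<beta> = ennreal (e \<delta> \<beta>)" "e \<delta> \<beta> \<ge> 0" for \<delta> \<beta>
    using Lp_dnorm_finite_of_bounded[OF U' p smooth_continuous[OF smooth_pderivs[OF smooth_monom2]]]
    by (simp_all add: e_def)
  \<comment> \<open>The factor \<open>2 ^ card Q\<close> comes from iterating the triangle inequality with factor 2.\<close>
  define D where "D \<delta> = 2 ^ card Q * (\<Sum>\<beta>\<in>Q \<inter> shadow Q. C \<beta> * e \<delta> \<beta>)" for \<delta>
  have D: "D \<delta> \<ge> 0" for \<delta> unfolding D_def using C e(2) by (intro mult_nonneg_nonneg sum_nonneg) auto
  let ?H = "idx_hull Q - Q"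
  have fH: "finite ?H" using finite_idx_hull[OF Q] by simp
  define C' where "C' = 2 * (1 + sum D ?H)"
  have C': "C' \<ge> 0" unfolding C'_def using D by (simp add: sum_nonneg)
  show ?thesis
  proof (rule exI[of _ C'], intro conjI allI impI C')
    fix T s c assume T: "admissible U p Q T" and s: "semi_le U p Q T s"
      and eq: "moments_match U Q \<gamma> T c"
    have s0: "0 \<le> s" using s by (simp add: semi_le_def)
    have cb: "\<bar>c \<beta>\<bar> \<le> C \<beta> * s" if "\<beta> \<in> Q \<inter> shadow Q" for \<beta>
      using bspec[OF C that] T s eq by blast
    let ?q = "Dw U \<gamma> (mpoly Q \<gamma> c)"
    have q: "Lp_dnorm U p (wderiv U \<delta> ?q) \<le> ennreal (D \<delta> * s)" if \<delta>: "\<delta> \<in> ?H" for \<delta>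
    proof -
      have "Lp_dnorm U p (wderiv U \<delta> ?q) \<le> 2 ^ card Q * (\<Sum>\<beta>\<in>Q. ennreal \<bar>c \<beta>\<bar> * ?E \<delta> \<beta>)"
        unfolding wderiv_mpoly(2)[OF U' Q] by (rule Lp_dnorm_sum[OF U'(1) p Q])
      also have "(\<Sum>\<beta>\<in>Q. ennreal \<bar>c \<beta>\<bar> * ?E \<delta> \<beta>) = (\<Sum>\<beta>\<in>Q \<inter> shadow Q. ennreal \<bar>c \<beta>\<bar> * ?E \<delta> \<beta>)"
      proof (rule sum.mono_neutral_right[OF Q])
        show "\<forall>\<beta>\<in>Q - Q \<inter> shadow Q. ennreal \<bar>c \<beta>\<bar> * ?E \<delta> \<beta> = 0"
        proof
          fix \<beta> assume \<beta>: "\<beta> \<in> Q - Q \<inter> shadow Q"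
          then have "\<not> \<delta> \<le> \<beta>" using \<delta> idx_hull_mem(1)[of \<beta> Q] unfolding shadow_def by blast
          then have "dcoeff (\<delta> + \<gamma>) (\<beta> + \<gamma>) = 0" by (intro dcoeff_eq_0) (auto simp: less_eq_prod_def)
          then have "pderivs (\<delta> + \<gamma>) (monom2 (\<beta> + \<gamma>)) = 0" by (simp only: pderivs_monom2 scaleR_zero_left)
          moreover have "dist_of U 0 = 0" by (auto simp: dist_of_def fun_eq_iff)
          ultimately show "ennreal \<bar>c \<beta>\<bar> * ?E \<delta> \<beta> = 0" by (simp only: Lp_dnorm_zero[OF U'(1) p] mult_zero_right)
        qed
      qed auto
      also have "2 ^ card Q * \<dots> \<le> 2 ^ card Q * (\<Sum>\<beta>\<in>Q \<inter> shadow Q. ennreal (C \<beta> * e \<delta> \<beta> * s))"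
      proof (intro mult_left_mono sum_mono)
        fix \<beta> assume \<beta>: "\<beta> \<in> Q \<inter> shadow Q"
        have "ennreal \<bar>c \<beta>\<bar> * ?E \<delta> \<beta> = ennreal (\<bar>c \<beta>\<bar> * e \<delta> \<beta>)" using e by (simp add: ennreal_mult)
        also have "\<dots> \<le> ennreal (C \<beta> * s * e \<delta> \<beta>)" by (intro ennreal_leI mult_right_mono cb[OF \<beta>] e(2))
        finally show "ennreal \<bar>c \<beta>\<bar> * ?E \<delta> \<beta> \<le> ennreal (C \<beta> * e \<delta> \<beta> * s)" by (simp add: ac_simps)
      qed simp
      also have "(\<Sum>\<beta>\<in>Q \<inter> shadow Q. ennreal (C \<beta> * e \<delta> \<beta> * s)) = ennreal (\<Sum>\<beta>\<in>Q \<inter> shadow Q. C \<beta> * e \<delta> \<beta> * s)"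
        using C e(2) s0 by (intro sum_ennreal) auto
      also have "2 ^ card Q * \<dots> = ennreal (2 ^ card Q * (\<Sum>\<beta>\<in>Q \<inter> shadow Q. C \<beta> * e \<delta> \<beta> * s))"
        using ennreal_mult'[of "2 ^ card Q" "\<Sum>\<beta>\<in>Q \<inter> shadow Q. C \<beta> * e \<delta> \<beta> * s"] ennreal_power[of 2 "card Q"] by simp
      also have "\<dots> = ennreal (D \<delta> * s)" by (simp add: D_def sum_distrib_right mult.assoc)
      finally show ?thesis .
    qed
    have "Lp_dnorm U p (wderiv U \<delta> (T - ?q)) \<le> ennreal (C' * s)" if \<delta>: "\<delta> \<in> ?H" for \<delta>
    proof -
      have "T - ?q = 1 *\<^sub>R T + (-1) *\<^sub>R ?q" by simp
      then have "Lp_dnorm U p (wderiv U \<delta> (T - ?q)) \<le>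
        2 * (ennreal \<bar>1\<bar> * Lp_dnorm U p (wderiv U \<delta> T) + ennreal \<bar>-1\<bar> * Lp_dnorm U p (wderiv U \<delta> ?q))"
        by (simp only: Lp_dnorm_wderiv_lincomb[OF U'(1) p])
      also have "\<dots> \<le> 2 * (ennreal s + ennreal (D \<delta> * s))"
        using s \<delta> q[OF \<delta>] unfolding semi_le_def by (intro mult_left_mono add_mono) auto
      also have "\<dots> = ennreal (2 * (s + D \<delta> * s))"
        using s0 D[of \<delta>] ennreal_mult'[of 2 "s + D \<delta> * s"] by simp
      also have "\<dots> \<le> ennreal (C' * s)"
      proof (rule ennreal_leI)
        have "D \<delta> \<le> sum D ?H" using fH D \<delta> by (intro member_le_sum) auto
        then have "D \<delta> * s \<le> sum D ?H * s" using s0 by (rule mult_right_mono)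
        then show "2 * (s + D \<delta> * s) \<le> C' * s" by (simp add: C'_def algebra_simps)
      qed
      finally show ?thesis .
    qed
    then show "semi_le U p Q (T - ?q) (C' * s)"
      using C' s0 by (simp add: semi_le_def)
  qed
qed

lemma sum_ennreal_less_top:
  fixes f :: "'a \<Rightarrow> ennreal"
  shows "finite I \<Longrightarrow> (\<And>i. i \<in> I \<Longrightarrow> f i < top) \<Longrightarrow> sum f I < top"
  by (induction rule: finite_induct) auto

lemma admissible_diff_mpoly:
  assumes p: "1 \<le> p" and U: "open U" "bounded U" and Q: "finite Q" and T: "admissible U p Q T"
  shows "admissible U p Q (T - Dw U \<gamma> (mpoly Q \<gamma> c))"
  unfolding admissible_def
proof
  fix \<alpha> assume \<alpha>: "\<alpha> \<in> idx_hull Q"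
  let ?q = "Dw U \<gamma> (mpoly Q \<gamma> c)"
  let ?E = "\<lambda>\<beta>. Lp_dnorm U p (dist_of U (pderivs (\<alpha> + \<gamma>) (monom2 (\<beta> + \<gamma>))))"
  have E: "?E \<beta> < top" for \<beta>
    using Lp_dnorm_finite_of_bounded[OF U p smooth_continuous[OF smooth_pderivs[OF smooth_monom2]]] by simp
  have "Lp_dnorm U p (wderiv U \<alpha> ?q) \<le> 2 ^ card Q * (\<Sum>\<beta>\<in>Q. ennreal \<bar>c \<beta>\<bar> * ?E \<beta>)"
    unfolding wderiv_mpoly(2)[OF U Q] by (rule Lp_dnorm_sum[OF U(1) p Q])
  also have "\<dots> < top"
    using E by (simp add: ennreal_mult_less_top sum_ennreal_less_top[OF Q] power_less_top_ennreal)
  finally have q: "Lp_dnorm U p (wderiv U \<alpha> ?q) < top" .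
  have "T - ?q = 1 *\<^sub>R T + (-1) *\<^sub>R ?q" by simp
  then have "Lp_dnorm U p (wderiv U \<alpha> (T - ?q)) \<le>
    2 * (ennreal \<bar>1\<bar> * Lp_dnorm U p (wderiv U \<alpha> T) + ennreal \<bar>-1\<bar> * Lp_dnorm U p (wderiv U \<alpha> ?q))"
    by (simp only: Lp_dnorm_wderiv_lincomb[OF U(1) p])
  also have "\<dots> < top" using q T \<alpha> by (simp add: ennreal_mult_less_top admissible_def)
  finally show "Lp_dnorm U p (wderiv U \<alpha> (T - ?q)) < \<infinity>" by simp
qed

text \<open>A second descent, this time through the whole hull: the derivatives of the remainder with index in \<open>Q\<close>
  have mean 0 by the moment conditions.\<close>

lemma moment_remainder_estimate:
  assumes p: "1 \<le> p" and U: "reference_domain U" and Q: "finite Q"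
  shows "\<exists>C\<ge>0. \<forall>T s c. admissible U p Q T \<longrightarrow> semi_le U p Q T s \<longrightarrow>
    moments_match U Q \<gamma> T c \<longrightarrow>
    (\<forall>\<alpha>\<in>idx_hull Q. Lp_dnorm U p (wderiv U \<alpha> (T - Dw U \<gamma> (mpoly Q \<gamma> c))) \<le> ennreal (C * s))"
proof -
  have U': "open U" "bounded U" using U unfolding reference_domain_def by auto
  obtain C1 where C1: "C1 \<ge> 0" "\<And>T s c. admissible U p Q T \<Longrightarrow> semi_le U p Q T s \<Longrightarrow>
    moments_match U Q \<gamma> T c \<Longrightarrow>
    semi_le U p Q (T - Dw U \<gamma> (mpoly Q \<gamma> c)) (C1 * s)"
    using moment_remainder_semi[OF p U Q] by blast
  obtain Cp where Cp: "Cp \<ge> 0" and poin: "\<And>T. Lp_dnorm U p T < \<infinity> \<Longrightarrow> Lp_dnorm U p (wderiv U (1,0) T) < \<infinity> \<Longrightarrow>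
    Lp_dnorm U p (wderiv U (0,1) T) < \<infinity> \<Longrightarrow> integral_over U T = 0 \<Longrightarrow>
    Lp_dnorm U p T \<le> ennreal Cp * (Lp_dnorm U p (wderiv U (1,0) T) + Lp_dnorm U p (wderiv U (0,1) T))"
    using distribution_poincare_mean[OF p U] by blast
  have step: "\<alpha> + (1,0) \<in> idx_hull Q \<and> \<alpha> + (0,1) \<in> idx_hull Q" if "\<alpha> \<in> idx_hull Q \<inter> Q" for \<alpha>
    using that idx_hull_mem[of \<alpha> Q] by blast
  obtain C2 where C2: "C2 \<ge> 0" and desc: "\<And>(N :: multi_index \<Rightarrow> ennreal) s. 0 \<le> s \<Longrightarrow>
    (\<forall>\<alpha>\<in>idx_hull Q \<inter> Q. N \<alpha> \<le> ennreal Cp * (N (\<alpha> + (1,0)) + N (\<alpha> + (0,1)) + ennreal s)) \<Longrightarrow>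
    (\<forall>\<delta>\<in>idx_hull Q - Q. N \<delta> \<le> ennreal s) \<Longrightarrow> (\<forall>\<alpha>\<in>idx_hull Q. N \<alpha> \<le> ennreal (C2 * s))"
    using descent_in_hull[OF Q finite_idx_hull[OF Q] step Cp] by blast
  show ?thesis
  proof (rule exI[of _ "C2 * C1"], intro conjI allI impI)
    show "0 \<le> C2 * C1" using C1 C2 by simp
    fix T s c assume T: "admissible U p Q T" and s: "semi_le U p Q T s"
      and eq: "moments_match U Q \<gamma> T c"
    define v where "v = T - Dw U \<gamma> (mpoly Q \<gamma> c)"
    let ?N = "\<lambda>\<alpha>. Lp_dnorm U p (wderiv U \<alpha> v)"
    have v: "semi_le U p Q v (C1 * s)" unfolding v_def by (rule C1(2)[OF T s eq])
    have va: "admissible U p Q v" unfolding v_def by (rule admissible_diff_mpoly[OF p U' Q T])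
    have "\<forall>\<alpha>\<in>idx_hull Q. ?N \<alpha> \<le> ennreal (C2 * (C1 * s))"
    proof (rule desc)
      show "0 \<le> C1 * s" "\<forall>\<delta>\<in>idx_hull Q - Q. ?N \<delta> \<le> ennreal (C1 * s)" using v unfolding semi_le_def by auto
      show "\<forall>\<alpha>\<in>idx_hull Q \<inter> Q. ?N \<alpha> \<le> ennreal Cp * (?N (\<alpha> + (1,0)) + ?N (\<alpha> + (0,1)) + ennreal (C1 * s))"
      proof
        fix \<alpha> assume \<alpha>: "\<alpha> \<in> idx_hull Q \<inter> Q"
        have w: "wderiv U (1,0) (wderiv U \<alpha> v) = wderiv U (\<alpha> + (1,0)) v"
          "wderiv U (0,1) (wderiv U \<alpha> v) = wderiv U (\<alpha> + (0,1)) v"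
          by (simp_all only: wderiv_wderiv add.commute)
        have fin: "?N \<alpha> < \<infinity>" "?N (\<alpha> + (1,0)) < \<infinity>" "?N (\<alpha> + (0,1)) < \<infinity>"
          using va idx_hull_mem[of \<alpha> Q] \<alpha> unfolding admissible_def by blast+
        have "Lp_dnorm U p (wderiv U \<alpha> T) < \<infinity>" using T \<alpha> unfolding admissible_def by blast
        then have "integral_over U (wderiv U \<alpha> v) = 0"
          unfolding v_def using integral_over_diff_mpoly[OF U' Q Lp_dnorm_regular] eq \<alpha> by (simp add: moments_match_def)
        then have "?N \<alpha> \<le> ennreal Cp * (?N (\<alpha> + (1,0)) + ?N (\<alpha> + (0,1)))"
          using poin[of "wderiv U \<alpha> v"] fin unfolding w by blast
        also have "\<dots> \<le> ennreal Cp * (?N (\<alpha> + (1,0)) + ?N (\<alpha> + (0,1)) + ennreal (C1 * s))"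
          by (intro mult_left_mono) auto
        finally show "?N \<alpha> \<le> ennreal Cp * (?N (\<alpha> + (1,0)) + ?N (\<alpha> + (0,1)) + ennreal (C1 * s))" .
      qed
    qed
    then show "\<forall>\<alpha>\<in>idx_hull Q. Lp_dnorm U p (wderiv U \<alpha> (T - Dw U \<gamma> (mpoly Q \<gamma> c))) \<le> ennreal (C2 * C1 * s)"
      unfolding v_def by (simp add: mult.assoc)
  qed
qed


section \<open>Classes of continuously differentiable functions\<close>

text \<open>On an open set the classes depend only on the values in that set, although derivatives are defined as
  functions on the whole plane.\<close>

lemma Ck_cong:
  assumes U: "open U"
  shows "f \<in> Ck k U \<Longrightarrow> (\<And>x. x \<in> U \<Longrightarrow> f x = g x) \<Longrightarrow> g \<in> Ck k U"
proof (induction k arbitrary: f g)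
  case 0
  then show ?case using continuous_on_cong[of U U f g] by simp
next
  case (Suc k)
  have d: "(g has_derivative D) (at x)" if "x \<in> U" "(f has_derivative D) (at x)" for x D
    using has_derivative_transform_within_open[OF that(2) U that(1)] Suc.prems(2) by blast
  have f: "f differentiable_on U" "pd (1,0) f \<in> Ck k U" "pd (0,1) f \<in> Ck k U" using Suc.prems(1) by simp_all
  have df: "f differentiable (at x)" if "x \<in> U" for x
    using f(1) that unfolding differentiable_on_eq_differentiable_at[OF U] by blast
  have pd: "pd e f x = pd e g x" if x: "x \<in> U" for e x
  proof -
    obtain D where D: "(f has_derivative D) (at x)" using df[OF x] unfolding differentiable_def by blast
    show ?thesis using pd_eq[OF D] pd_eq[OF d[OF x D]] by simp
  qed
  have "g differentiable_on U"
    unfolding differentiable_on_eq_differentiable_at[OF U] using df d unfolding differentiable_def by blast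
  moreover have "pd (1,0) g \<in> Ck k U" by (rule Suc.IH[OF f(2) pd])
  moreover have "pd (0,1) g \<in> Ck k U" by (rule Suc.IH[OF f(3) pd])
  ultimately show ?case by simp
qed

lemma Ck_lincomb:
  assumes U: "open U"
  shows "f \<in> Ck k U \<Longrightarrow> g \<in> Ck k U \<Longrightarrow> a *\<^sub>R f + b *\<^sub>R g \<in> Ck k U"
proof (induction k arbitrary: f g)
  case 0
  then have "continuous_on U (\<lambda>x. a *\<^sub>R f x + b *\<^sub>R g x)" by (auto intro!: continuous_intros)
  then show ?case by (simp add: plus_fun_def scaleR_fun_def)
next
  case (Suc k)
  have f: "f differentiable_on U" "pd (1,0) f \<in> Ck k U" "pd (0,1) f \<in> Ck k U" using Suc.prems(1) by simp_all
  have g: "g differentiable_on U" "pd (1,0) g \<in> Ck k U" "pd (0,1) g \<in> Ck k U" using Suc.prems(2) by simp_all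
  have df: "f differentiable (at x)" "g differentiable (at x)" if "x \<in> U" for x
    using f(1) g(1) that unfolding differentiable_on_eq_differentiable_at[OF U] by blast+
  have "(a *\<^sub>R f + b *\<^sub>R g) differentiable (at x)" if "x \<in> U" for x
    using df[OF that] by (intro differentiable_add_fun differentiable_scaleR_fun)
  then have 1: "(a *\<^sub>R f + b *\<^sub>R g) differentiable_on U"
    unfolding differentiable_on_eq_differentiable_at[OF U] by blast
  have pd: "(a *\<^sub>R pd e f + b *\<^sub>R pd e g) x = pd e (a *\<^sub>R f + b *\<^sub>R g) x" if "x \<in> U" for e x
    using df[OF that] by (simp add: pd_add pd_scaleR differentiable_scaleR_fun scaleR_fun_def[of _ "pd e _"])
  have "pd (1,0) (a *\<^sub>R f + b *\<^sub>R g) \<in> Ck k U" "pd (0,1) (a *\<^sub>R f + b *\<^sub>R g) \<in> Ck k U"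
    by (rule Ck_cong[OF U Suc.IH[OF f(2) g(2)] pd], assumption)
       (rule Ck_cong[OF U Suc.IH[OF f(3) g(3)] pd], assumption)
  then show ?case using 1 unfolding Ck.simps mem_Collect_eq by blast
qed

section \<open>Unisolvent functionals\<close>

text \<open>Induction on the number of functionals: restricted to the kernel of one functional, the others still
  separate. The elements \<open>t i\<close> then bound every norm by the numbers \<open>F i x\<close>, which is the needed form
  of the equivalence of norms on a finite-dimensional space.\<close>

lemma separating_functionals_dual_system:
  fixes F :: "'i \<Rightarrow> 'a::real_vector \<Rightarrow> real"
  assumes "finite J"
  shows "subspace W \<Longrightarrow> (\<And>i. i \<in> J \<Longrightarrow> lin_on W (F i)) \<Longrightarrow>
    (\<And>x. x \<in> W \<Longrightarrow> (\<And>i. i \<in> J \<Longrightarrow> F i x = 0) \<Longrightarrow> x = 0) \<Longrightarrow>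
    \<exists>t. (\<forall>i\<in>J. t i \<in> W) \<and> (\<forall>x\<in>W. x = (\<Sum>i\<in>J. F i x *\<^sub>R t i))"
  using assms
proof (induction J arbitrary: W rule: finite_induct)
  case empty
  then have "\<forall>x\<in>W. x = 0" by blast
  then show ?case by simp
next
  case (insert k J)
  have lin: "F i (a *\<^sub>R x + b *\<^sub>R y) = a * F i x + b * F i y" if "i \<in> insert k J" "x \<in> W" "y \<in> W" for i x y a b
    using insert.prems(2)[OF that(1)] that(2,3) unfolding lin_on_def by simp
  have comb: "a *\<^sub>R x + b *\<^sub>R y \<in> W" if "x \<in> W" "y \<in> W" for x y a b
    using insert.prems(1) that by (intro subspace_add subspace_scale)
  let ?W0 = "{x\<in>W. F k x = 0}"
  have W0: "subspace ?W0"
  proof (rule subspaceI)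
    have "0 \<in> W" using insert.prems(1) by (rule subspace_0)
    then show "0 \<in> ?W0" using lin[of k 0 0 0 0] by simp
    fix x y assume "x \<in> ?W0" "y \<in> ?W0"
    then show "x + y \<in> ?W0" using lin[of k x y 1 1] comb[of x y 1 1] by simp
  next
    fix c x assume "x \<in> ?W0"
    then show "c *\<^sub>R x \<in> ?W0" using lin[of k x x c 0] comb[of x x c 0] by simp
  qed
  have "\<exists>t. (\<forall>i\<in>J. t i \<in> ?W0) \<and> (\<forall>x\<in>?W0. x = (\<Sum>i\<in>J. F i x *\<^sub>R t i))"
  proof (rule insert.IH[OF W0])
    show "lin_on ?W0 (F i)" if "i \<in> J" for i using lin[of i] that unfolding lin_on_def by simp
    show "x = 0" if "x \<in> ?W0" "\<And>i. i \<in> J \<Longrightarrow> F i x = 0" for x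
      using insert.prems(3)[of x] that by blast
  qed
  then obtain t where t: "\<forall>i\<in>J. t i \<in> ?W0" "\<forall>x\<in>?W0. x = (\<Sum>i\<in>J. F i x *\<^sub>R t i)" by blast
  show ?case
  proof (cases "\<exists>x\<in>W. F k x \<noteq> 0")
    case False
    have "x = (\<Sum>i\<in>insert k J. F i x *\<^sub>R (t(k := 0)) i)" if "x \<in> W" for x
    proof -
      have "(\<Sum>i\<in>insert k J. F i x *\<^sub>R (t(k := 0)) i) = (\<Sum>i\<in>J. F i x *\<^sub>R t i)"
        using insert.hyps by (subst sum.insert) (auto intro!: sum.cong)
      then show ?thesis using t(2) that False by auto
    qed
    moreover have "\<forall>i\<in>insert k J. (t(k := 0)) i \<in> W" using t(1) subspace_0[OF insert.prems(1)] by auto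
    ultimately show ?thesis by blast
  next
    case True
    then obtain e0 where e0: "e0 \<in> W" "F k e0 \<noteq> 0" by blast
    define e where "e = (1 / F k e0) *\<^sub>R e0"
    have e: "e \<in> W" "F k e = 1"
      using comb[OF e0(1) e0(1), of "1 / F k e0" 0] lin[of k e0 e0 "1 / F k e0" 0] e0 by (simp_all add: e_def)
    \<comment> \<open>The part of \<open>e\<close> that the elements \<open>t i\<close> with \<open>i \<in> J\<close> already represent is removed.\<close>
    define tk where "tk = e - (\<Sum>i\<in>J. F i e *\<^sub>R t i)"
    have tk: "tk \<in> W"
      unfolding tk_def using e(1) t(1) insert.prems(1)
      by (intro subspace_diff subspace_sum subspace_scale) auto
    have "x = (\<Sum>i\<in>insert k J. F i x *\<^sub>R (t(k := tk)) i)" if x: "x \<in> W" for x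
    proof -
      let ?y = "1 *\<^sub>R x + (- F k x) *\<^sub>R e"
      have y: "?y \<in> ?W0" using comb[OF x e(1), of 1 "- F k x"] lin[of k x e 1 "- F k x"] x e by simp
      have "?y = (\<Sum>i\<in>J. F i ?y *\<^sub>R t i)" using t(2) y by blast
      also have "\<dots> = (\<Sum>i\<in>J. F i x *\<^sub>R t i - F k x *\<^sub>R (F i e *\<^sub>R t i))"
        using lin[of _ x e 1 "- F k x"] x e by (intro sum.cong) (simp_all add: scaleR_left_diff_distrib)
      also have "\<dots> = (\<Sum>i\<in>J. F i x *\<^sub>R t i) - F k x *\<^sub>R (\<Sum>i\<in>J. F i e *\<^sub>R t i)"
        by (simp add: sum_subtractf scaleR_sum_right)
      finally have "x = (\<Sum>i\<in>J. F i x *\<^sub>R t i) + F k x *\<^sub>R tk"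
        by (simp add: tk_def scaleR_right_diff_distrib algebra_simps)
      also have "\<dots> = (\<Sum>i\<in>insert k J. F i x *\<^sub>R (t(k := tk)) i)"
      proof -
        have "(\<Sum>i\<in>J. F i x *\<^sub>R t i) = (\<Sum>i\<in>J. F i x *\<^sub>R (t(k := tk)) i)"
          using insert.hyps by (intro sum.cong) auto
        then show ?thesis using insert.hyps by (simp add: add.commute)
      qed
      finally show ?thesis .
    qed
    moreover have "\<forall>i\<in>insert k J. (t(k := tk)) i \<in> W" using t(1) tk by auto
    ultimately show ?thesis by blast
  qed
qed

section \<open>The interpolation error estimate\<close>

definition sum_norm :: "plane set \<Rightarrow> ennreal \<Rightarrow> multi_index set \<Rightarrow> distribution \<Rightarrow> ennreal" where
  "sum_norm U p P T = (\<Sum>\<alpha>\<in>P. Lp_dnorm U p (wderiv U \<alpha> T))"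

lemma sum_norm_lincomb:
  assumes "open U" "1 \<le> p"
  shows "sum_norm U p P (a *\<^sub>R T + b *\<^sub>R T') \<le> 2 * (ennreal \<bar>a\<bar> * sum_norm U p P T + ennreal \<bar>b\<bar> * sum_norm U p P T')"
proof -
  have "sum_norm U p P (a *\<^sub>R T + b *\<^sub>R T') \<le> (\<Sum>\<alpha>\<in>P. 2 * (ennreal \<bar>a\<bar> * Lp_dnorm U p (wderiv U \<alpha> T)
      + ennreal \<bar>b\<bar> * Lp_dnorm U p (wderiv U \<alpha> T')))"
    unfolding sum_norm_def by (intro sum_mono Lp_dnorm_wderiv_lincomb assms)
  then show ?thesis by (simp add: sum_norm_def sum_distrib_left sum.distrib)
qed

lemma sum_norm_le_sob_norm:
  assumes "finite P" "1 \<le> p"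
  shows "sum_norm U p P T \<le> of_nat (card P) * sob_norm U p P T"
  unfolding sum_norm_def using sum_bounded_above[of P "\<lambda>\<alpha>. Lp_dnorm U p (wderiv U \<alpha> T)" "sob_norm U p P T"]
    Lp_dnorm_le_sob_norm[OF assms(1) _ assms(2)] by simp

lemma Dw_lincomb:
  assumes "open U" "u \<in> L1 U" "v \<in> L1 U"
  shows "a *\<^sub>R u + b *\<^sub>R v \<in> L1 U" "Dw U \<alpha> (a *\<^sub>R u + b *\<^sub>R v) = a *\<^sub>R Dw U \<alpha> u + b *\<^sub>R Dw U \<alpha> v"
proof -
  have eq: "a *\<^sub>R u + b *\<^sub>R v = (\<lambda>x. a * u x + b * v x)" by (simp add: fun_eq_iff scaleR_fun_def)
  show "a *\<^sub>R u + b *\<^sub>R v \<in> L1 U"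
    unfolding eq using assms(2,3) by (auto simp: L1_def intro!: Bochner_Integration.integrable_add)
  show "Dw U \<alpha> (a *\<^sub>R u + b *\<^sub>R v) = a *\<^sub>R Dw U \<alpha> u + b *\<^sub>R Dw U \<alpha> v"
    unfolding eq Dw_def dist_of_add[OF assms] wderiv_lincomb ..
qed

text \<open>In terms of coefficients, the moment conditions are a linear system for the moment matrix.\<close>

lemma moment_poly_iff:
  assumes U: "reference_domain U" and p: "1 \<le> p" and Q: "finite Q" and u: "u \<in> L1 U"
    and T: "admissible U p Q (Dw U \<gamma> u)"
  shows "moment_poly U Q \<gamma> u q \<longleftrightarrow> (\<exists>c. q = mpoly Q \<gamma> c \<and>
    moments_match U Q \<gamma> (Dw U \<gamma> u) c)"
proof -
  have U': "open U" "bounded U" using U unfolding reference_domain_def by auto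
  have diff: "integral_over U (Dw U (\<alpha> + \<gamma>) (u - mpoly Q \<gamma> c))
      = integral_over U (wderiv U \<alpha> (Dw U \<gamma> u)) - (\<Sum>\<beta>\<in>Q. c \<beta> * moment U \<gamma> \<alpha> \<beta>)" if "\<alpha> \<in> Q" for \<alpha> c
  proof -
    have d: "Dw U (\<alpha> + \<gamma>) v = wderiv U \<alpha> (Dw U \<gamma> v)" for v by (simp only: Dw_def wderiv_wderiv)
    have "u - mpoly Q \<gamma> c = 1 *\<^sub>R u + (-1) *\<^sub>R mpoly Q \<gamma> c" by simp
    then have "Dw U \<gamma> (u - mpoly Q \<gamma> c) = 1 *\<^sub>R Dw U \<gamma> u + (-1) *\<^sub>R Dw U \<gamma> (mpoly Q \<gamma> c)"
      by (simp only: Dw_lincomb(2)[OF U'(1) u wderiv_mpoly(1)[OF U' Q]])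
    also have "\<dots> = Dw U \<gamma> u - Dw U \<gamma> (mpoly Q \<gamma> c)" by simp
    finally have e: "Dw U \<gamma> (u - mpoly Q \<gamma> c) = Dw U \<gamma> u - Dw U \<gamma> (mpoly Q \<gamma> c)" .
    have "is_regular U (wderiv U \<alpha> (Dw U \<gamma> u))"
      using T idx_hull_mem(1)[OF that] unfolding admissible_def by (intro Lp_dnorm_regular) blast
    then show ?thesis unfolding d e by (rule integral_over_diff_mpoly[OF U' Q])
  qed
  have "(\<forall>\<alpha>\<in>Q. integral_over U (Dw U (\<alpha> + \<gamma>) (u - mpoly Q \<gamma> c)) = 0) \<longleftrightarrow>
    moments_match U Q \<gamma> (Dw U \<gamma> u) c" for c
    unfolding moments_match_def by (intro ball_cong refl) (simp only: diff, linarith)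
  then show ?thesis
    unfolding moment_poly_def polys_eq_mpoly[OF Q] by blast
qed

lemma moment_poly_unique_existence:
  assumes U: "reference_domain U" and p: "1 \<le> p" and Q: "finite Q" and u: "u \<in> L1 U"
    and T: "admissible U p Q (Dw U \<gamma> u)"
  shows "\<exists>!q. moment_poly U Q \<gamma> u q"
proof -
  note iff = moment_poly_iff[OF assms, unfolded moments_match_def]
  let ?K = "moment U \<gamma>" and ?m = "\<lambda>\<alpha>. integral_over U (wderiv U \<alpha> (Dw U \<gamma> u))"
  obtain c where c: "\<forall>\<alpha>\<in>Q. (\<Sum>\<beta>\<in>Q. c \<beta> * ?K \<alpha> \<beta>) = ?m \<alpha>"
    using triangular_solvable[of Q ?K ?m, OF Q moment_triangular moment_diagonal[OF U]] by blast
  show ?thesis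
  proof (rule ex1I)
    show "moment_poly U Q \<gamma> u (mpoly Q \<gamma> c)" using iff c by blast
    fix q assume "moment_poly U Q \<gamma> u q"
    then obtain d where d: "q = mpoly Q \<gamma> d" "\<forall>\<alpha>\<in>Q. (\<Sum>\<beta>\<in>Q. d \<beta> * ?K \<alpha> \<beta>) = ?m \<alpha>" using iff by blast
    have "d \<beta> = c \<beta>" if \<beta>: "\<beta> \<in> Q" for \<beta>
    proof -
      have "\<forall>\<alpha>\<in>Q. (\<Sum>\<beta>\<in>Q. (d \<beta> - c \<beta>) * ?K \<alpha> \<beta>) = (\<lambda>_. 0) \<alpha>"
        using c d(2) by (simp add: left_diff_distrib sum_subtractf)
      then have "\<bar>d \<beta> - c \<beta>\<bar> \<le> 0"
        using triangular_bound[where K = ?K and \<beta> = \<beta>, OF Q moment_triangular moment_diagonal[OF U] \<beta>] by fastforce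
      then show ?thesis by simp
    qed
    then show "q = mpoly Q \<gamma> c" unfolding d(1) mpoly_def by (intro sum.cong) auto
  qed
qed

text \<open>In the application \<open>s\<close> is \<open>I (u - q)\<close> and \<open>w\<close> is a density of \<open>D\<^sup>\<gamma> (u - q)\<close>, on which the functionals
  agree by the interpolation condition.\<close>

lemma interpolated_part_estimate:
  fixes F :: "nat \<Rightarrow> distribution \<Rightarrow> real"
  assumes U: "open U" and p: "1 \<le> p" and P: "finite P" and H: "finite H" and J: "finite J"
    and S: "subspace S" "S \<subseteq> sh_space U p P \<gamma>"
    and lin: "\<forall>i\<in>J. lin_on (sum_space U p H (Dw U \<gamma> ` S)) (F i)"
    and bd: "\<forall>i\<in>J. bounded_on_sob U p H (F i)"
    and sep: "\<forall>s\<in>S. (\<forall>i\<in>J. F i (Dw U \<gamma> s) = 0) \<longrightarrow> Dw U \<gamma> s = 0"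
  shows "\<exists>D\<ge>0. \<forall>s\<in>S. \<forall>w\<in>sob_space U p H. (\<forall>i\<in>J. F i (Dw U \<gamma> s) = F i (dist_of U w)) \<longrightarrow>
    sum_norm U p P (Dw U \<gamma> s) \<le> ennreal D * sob_norm U p H (dist_of U w)"
proof -
  let ?W = "Dw U \<gamma> ` S"
  have SL: "s \<in> L1 U" if "s \<in> S" for s using S(2) that by (auto simp: sh_space_def)
  have W: "subspace ?W"
  proof (rule subspaceI)
    have "Dw U \<gamma> (0 *\<^sub>R 0 + 0 *\<^sub>R 0) = 0 *\<^sub>R Dw U \<gamma> 0 + 0 *\<^sub>R Dw U \<gamma> 0"
      by (intro Dw_lincomb(2)[OF U] SL subspace_0[OF S(1)])
    then have "Dw U \<gamma> 0 = 0" by (simp only: scaleR_zero_left add_0)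
    then show "0 \<in> ?W" using subspace_0[OF S(1)] by (metis imageI)
  next
    fix x y assume "x \<in> ?W" "y \<in> ?W"
    then obtain s t where st: "s \<in> S" "t \<in> S" "x = Dw U \<gamma> s" "y = Dw U \<gamma> t" by blast
    have "Dw U \<gamma> (1 *\<^sub>R s + 1 *\<^sub>R t) = 1 *\<^sub>R x + 1 *\<^sub>R y"
      unfolding st by (rule Dw_lincomb(2)[OF U SL[OF st(1)] SL[OF st(2)]])
    then have "x + y = Dw U \<gamma> (s + t)" by (simp only: scaleR_one)
    then show "x + y \<in> ?W" using subspace_add[OF S(1) st(1,2)] by (metis imageI)
  next
    fix c x assume "x \<in> ?W"
    then obtain s where s: "s \<in> S" "x = Dw U \<gamma> s" by blast
    have "Dw U \<gamma> (c *\<^sub>R s + 0 *\<^sub>R s) = c *\<^sub>R x + 0 *\<^sub>R x"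
      unfolding s by (rule Dw_lincomb(2)[OF U SL[OF s(1)] SL[OF s(1)]])
    then have "c *\<^sub>R x = Dw U \<gamma> (c *\<^sub>R s)" by (simp only: scaleR_zero_left add_0_right)
    then show "c *\<^sub>R x \<in> ?W" using subspace_scale[OF S(1) s(1)] by (metis imageI)
  qed
  have "?W \<subseteq> sum_space U p H ?W"
  proof
    fix T assume T: "T \<in> ?W"
    have d0: "dist_of U (\<lambda>_. 0) = 0" by (auto simp: dist_of_def fun_eq_iff)
    have w0: "wderiv U \<alpha> 0 = 0" for \<alpha> by (auto simp: wderiv_def fun_eq_iff)
    have "sob_norm U p H 0 \<le> (\<Sum>\<alpha>\<in>H. Lp_dnorm U p (wderiv U \<alpha> 0))" by (rule sob_norm_le_sum[OF H p])
    also have "\<dots> = 0" unfolding w0 Lp_dnorm_zero[OF U p] by simp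
    finally have "sob_norm U p H (dist_of U (\<lambda>_. 0)) < \<infinity>" unfolding d0 by simp
    then have "(\<lambda>_. 0) \<in> sob_space U p H" by (simp add: sob_space_def L1_def)
    moreover have "T = dist_of U (\<lambda>_. 0) + T" unfolding d0 by simp
    ultimately show "T \<in> sum_space U p H ?W" unfolding sum_space_def using T by blast
  qed
  then have linW: "lin_on ?W (F i)" if "i \<in> J" for i
    using lin that unfolding lin_on_def by blast
  have sepW: "x = 0" if x: "x \<in> ?W" "\<And>i. i \<in> J \<Longrightarrow> F i x = 0" for x
    using sep x by blast
  have "\<exists>t. (\<forall>i\<in>J. t i \<in> ?W) \<and> (\<forall>x\<in>?W. x = (\<Sum>i\<in>J. F i x *\<^sub>R t i))"
    by (rule separating_functionals_dual_system[OF J W]) (fact linW, fact sepW)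
  then obtain t where t': "(\<forall>i\<in>J. t i \<in> ?W) \<and> (\<forall>x\<in>?W. x = (\<Sum>i\<in>J. F i x *\<^sub>R t i))" ..
  note t = conjunct1[OF t'] conjunct2[OF t']
  have tfin: "Lp_dnorm U p (wderiv U \<alpha> (t i)) < top" if i: "i \<in> J" and \<alpha>: "\<alpha> \<in> P" for i \<alpha>
  proof -
    have "t i \<in> ?W" using t(1) i by (rule bspec)
    then obtain s where s: "t i = Dw U \<gamma> s" "s \<in> S" by (rule imageE)
    then have "sob_norm U p P (t i) < \<infinity>" using S(2) by (auto simp: sh_space_def sh_norm_def)
    then show ?thesis using Lp_dnorm_le_sob_norm[OF P \<alpha> p, of U "t i"] by (simp add: order_le_less_trans)
  qed
  define b where "b i = enn2real (\<Sum>\<alpha>\<in>P. 2 ^ card J * Lp_dnorm U p (wderiv U \<alpha> (t i)))" for i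
  have b: "(\<Sum>\<alpha>\<in>P. 2 ^ card J * Lp_dnorm U p (wderiv U \<alpha> (t i))) = ennreal (b i)" "b i \<ge> 0" if "i \<in> J" for i
  proof -
    have "(\<Sum>\<alpha>\<in>P. 2 ^ card J * Lp_dnorm U p (wderiv U \<alpha> (t i))) < top"
      using tfin[OF that] by (intro sum_ennreal_less_top[OF P]) (simp add: ennreal_mult_less_top power_less_top_ennreal)
    then show "(\<Sum>\<alpha>\<in>P. 2 ^ card J * Lp_dnorm U p (wderiv U \<alpha> (t i))) = ennreal (b i)" "b i \<ge> 0"
      unfolding b_def by simp_all
  qed
  have "\<forall>i\<in>J. \<exists>K. \<forall>w\<in>sob_space U p H. ennreal \<bar>F i (dist_of U w)\<bar> \<le> ennreal K * sob_norm U p H (dist_of U w)"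
    using bd unfolding bounded_on_sob_def by blast
  from bchoice[OF this] obtain K where K: "\<forall>i\<in>J. \<forall>w\<in>sob_space U p H.
    ennreal \<bar>F i (dist_of U w)\<bar> \<le> ennreal (K i) * sob_norm U p H (dist_of U w)" ..
  show ?thesis
  proof (rule exI[of _ "\<Sum>i\<in>J. \<bar>K i\<bar> * b i"], intro conjI ballI impI)
    show "0 \<le> (\<Sum>i\<in>J. \<bar>K i\<bar> * b i)" using b(2) by (intro sum_nonneg) auto
    fix s w assume s: "s \<in> S" and w: "w \<in> sob_space U p H" and eq: "\<forall>i\<in>J. F i (Dw U \<gamma> s) = F i (dist_of U w)"
    let ?d = "Dw U \<gamma> s" and ?n = "sob_norm U p H (dist_of U w)"
    have d: "?d = (\<Sum>i\<in>J. F i ?d *\<^sub>R t i)" by (rule bspec[OF t(2) imageI[OF s]])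
    have "sum_norm U p P ?d \<le> (\<Sum>\<alpha>\<in>P. 2 ^ card J * (\<Sum>i\<in>J. ennreal \<bar>F i ?d\<bar> * Lp_dnorm U p (wderiv U \<alpha> (t i))))"
      unfolding sum_norm_def
    proof (rule sum_mono)
      fix \<alpha>
      have "wderiv U \<alpha> ?d = (\<Sum>i\<in>J. F i ?d *\<^sub>R wderiv U \<alpha> (t i))"
        using arg_cong[OF d, of "wderiv U \<alpha>"] unfolding wderiv_sum[OF J] .
      then show "Lp_dnorm U p (wderiv U \<alpha> ?d) \<le> 2 ^ card J * (\<Sum>i\<in>J. ennreal \<bar>F i ?d\<bar> * Lp_dnorm U p (wderiv U \<alpha> (t i)))"
        using Lp_dnorm_sum[OF U p J, of "\<lambda>i. F i ?d" "\<lambda>i. wderiv U \<alpha> (t i)"] by simp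
    qed
    also have "\<dots> = (\<Sum>\<alpha>\<in>P. \<Sum>i\<in>J. ennreal \<bar>F i ?d\<bar> * (2 ^ card J * Lp_dnorm U p (wderiv U \<alpha> (t i))))"
      by (simp add: sum_distrib_left ac_simps)
    also have "\<dots> = (\<Sum>i\<in>J. ennreal \<bar>F i ?d\<bar> * (\<Sum>\<alpha>\<in>P. 2 ^ card J * Lp_dnorm U p (wderiv U \<alpha> (t i))))"
      by (subst sum.swap) (simp add: sum_distrib_left)
    also have "\<dots> \<le> (\<Sum>i\<in>J. ennreal (\<bar>K i\<bar> * b i) * ?n)"
    proof (rule sum_mono)
      fix i assume i: "i \<in> J"
      have "ennreal \<bar>F i ?d\<bar> \<le> ennreal (K i) * ?n" using K eq i w by simp
      also have "\<dots> \<le> ennreal \<bar>K i\<bar> * ?n" by (intro mult_right_mono ennreal_leI) auto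
      finally have "ennreal \<bar>F i ?d\<bar> * ennreal (b i) \<le> (ennreal \<bar>K i\<bar> * ?n) * ennreal (b i)" by (rule mult_right_mono) simp
      also have "\<dots> = ennreal (\<bar>K i\<bar> * b i) * ?n" using b(2)[OF i] by (simp add: ennreal_mult ac_simps)
      finally show "ennreal \<bar>F i ?d\<bar> * (\<Sum>\<alpha>\<in>P. 2 ^ card J * Lp_dnorm U p (wderiv U \<alpha> (t i))) \<le> ennreal (\<bar>K i\<bar> * b i) * ?n"
        unfolding b(1)[OF i] .
    qed
    also have "\<dots> = (\<Sum>i\<in>J. ennreal (\<bar>K i\<bar> * b i)) * ?n" by (simp add: sum_distrib_right)
    also have "(\<Sum>i\<in>J. ennreal (\<bar>K i\<bar> * b i)) = ennreal (\<Sum>i\<in>J. \<bar>K i\<bar> * b i)"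
      using b(2) by (intro sum_ennreal) auto
    finally show "sum_norm U p P ?d \<le> ennreal (\<Sum>i\<in>J. \<bar>K i\<bar> * b i) * ?n" .
  qed
qed

theorem lemma3:
  fixes \<Lambda> :: "plane set" and M :: "plane set set" and S :: "(plane \<Rightarrow> real) set"
    and \<gamma> :: multi_index and p :: ennreal and \<mu> j :: nat and P Q :: "multi_index set"
    and I :: "(plane \<Rightarrow> real) \<Rightarrow> (plane \<Rightarrow> real)"
    and F :: "nat \<Rightarrow> distribution \<Rightarrow> real"
  assumes "reference_domain \<Lambda>"
    and "triangulates M \<Lambda>"
    and "finite_dim_subspace S"
    and "\<forall>s\<in>S. piecewise_poly M s"
    and "1 \<le> p"
    and "finite P" and "finite Q" and "0 \<in> Q" and "P \<subseteq> idx_hull Q"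
    and "S \<subseteq> sh_space \<Lambda> p P \<gamma>"
    and "\<forall>u\<in>Ck \<mu> \<Lambda>. I u \<in> S"
    and "lin_on (Ck \<mu> \<Lambda>) I"
    and "j = dim (Dw \<Lambda> \<gamma> ` S)"
    and "\<forall>i\<in>{1..j}. lin_on (sum_space \<Lambda> p (idx_hull Q) (Dw \<Lambda> \<gamma> ` S)) (F i)"
    and "\<forall>i\<in>{1..j}. bounded_on_sob \<Lambda> p (idx_hull Q) (F i)"
    and "\<forall>i\<in>{1..j}. \<forall>u \<in> Ck \<mu> \<Lambda> \<inter> sh_space \<Lambda> p (idx_hull Q) \<gamma>.
           F i (Dw \<Lambda> \<gamma> (I u)) = F i (Dw \<Lambda> \<gamma> u)"
    and "\<forall>s\<in>S. (\<forall>i\<in>{1..j}. F i (Dw \<Lambda> \<gamma> s) = 0) \<longrightarrow> Dw \<Lambda> \<gamma> s = 0"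
  shows "\<exists>C::real. C \<ge> 0 \<and> (\<forall>u \<in> Ck \<mu> \<Lambda> \<inter> sh_space \<Lambda> p (idx_hull Q) \<gamma>.
           (\<exists>!q. moment_poly \<Lambda> Q \<gamma> u q) \<and>
           (\<forall>q. moment_poly \<Lambda> Q \<gamma> u q \<longrightarrow>
              sh_norm \<Lambda> p P \<gamma> (u - I u)
                \<le> ennreal C * (sh_seminorm \<Lambda> p Q \<gamma> u + sh_norm \<Lambda> p P \<gamma> (q - I q))))"
proof -
  let ?H = "idx_hull Q" and ?D = "Dw \<Lambda> \<gamma>"
  note p = \<open>1 \<le> p\<close> and Q = \<open>finite Q\<close> and P = \<open>finite P\<close>
  have U: "open \<Lambda>" "bounded \<Lambda>" using assms(1) unfolding reference_domain_def by auto
  have H: "finite ?H" by (rule finite_idx_hull[OF Q])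
  have S: "subspace S" using assms(3) unfolding finite_dim_subspace_def by blast
  have SL: "s \<in> L1 \<Lambda>" if "s \<in> S" for s using assms(10) that by (auto simp: sh_space_def)
  obtain C0 where C0: "C0 \<ge> 0" and rem: "\<And>T s c. admissible \<Lambda> p Q T \<Longrightarrow> semi_le \<Lambda> p Q T s \<Longrightarrow>
    moments_match \<Lambda> Q \<gamma> T c \<Longrightarrow>
    (\<forall>\<alpha>\<in>?H. Lp_dnorm \<Lambda> p (wderiv \<Lambda> \<alpha> (T - ?D (mpoly Q \<gamma> c))) \<le> ennreal (C0 * s))"
    using moment_remainder_estimate[OF p assms(1) Q] by blast
  obtain D where D: "D \<ge> 0" and interp: "\<And>s w. s \<in> S \<Longrightarrow> w \<in> sob_space \<Lambda> p ?H \<Longrightarrow>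
    (\<forall>i\<in>{1..j}. F i (?D s) = F i (dist_of \<Lambda> w)) \<Longrightarrow>
    sum_norm \<Lambda> p P (?D s) \<le> ennreal D * sob_norm \<Lambda> p ?H (dist_of \<Lambda> w)"
    using interpolated_part_estimate[OF U(1) p P H _ S assms(10,14,15,17)] by blast
  define nP where "nP = real (card P)"
  define nH where "nH = real (card ?H)"
  \<comment> \<open>The three summands belong to \<open>u - q\<close>, \<open>q - I q\<close> and \<open>I (u - q)\<close>; the factors 2 and 4 come from the triangle inequality.\<close>
  define C where "C = 2 * nP * C0 + 4 * nP + 4 * D * nH * C0"
  have n: "nP \<ge> 0" "nH \<ge> 0" by (simp_all add: nP_def nH_def)
  have C: "C \<ge> 0" using n C0 D by (simp add: C_def)
  show ?thesis
  proof (rule exI[of _ C], intro conjI ballI allI impI C)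
    fix u assume u: "u \<in> Ck \<mu> \<Lambda> \<inter> sh_space \<Lambda> p ?H \<gamma>"
    then have uL: "u \<in> L1 \<Lambda>" and un: "sob_norm \<Lambda> p ?H (?D u) < \<infinity>" and uC: "u \<in> Ck \<mu> \<Lambda>"
      by (auto simp: sh_space_def sh_norm_def)
    have adm: "admissible \<Lambda> p Q (?D u)"
      unfolding admissible_def using Lp_dnorm_le_sob_norm[OF H _ p, of _ \<Lambda> "?D u"] un by (blast intro: order_le_less_trans)
    show "\<exists>!q. moment_poly \<Lambda> Q \<gamma> u q" by (rule moment_poly_unique_existence[OF assms(1) p Q uL adm])
    fix q assume "moment_poly \<Lambda> Q \<gamma> u q"
    then obtain c where c: "q = mpoly Q \<gamma> c"
      "moments_match \<Lambda> Q \<gamma> (?D u) c"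
      using moment_poly_iff[OF assms(1) p Q uL adm] by blast
    have qL: "q \<in> L1 \<Lambda>" unfolding c(1) by (rule wderiv_mpoly(1)[OF U Q])
    have qC: "q \<in> Ck \<mu> \<Lambda>" unfolding c(1) by (rule mpoly_Ck)
    have fin: "sh_seminorm \<Lambda> p Q \<gamma> u < \<infinity>"
    proof -
      have "sh_seminorm \<Lambda> p Q \<gamma> u \<le> (\<Sum>\<alpha>\<in>?H - Q. Lp_dnorm \<Lambda> p (wderiv \<Lambda> \<alpha> (?D u)))"
        unfolding sh_seminorm_def sob_seminorm_def using H by (intro sob_norm_le_sum[OF _ p]) simp
      also have "\<dots> < top" using adm H unfolding admissible_def by (intro sum_ennreal_less_top) auto
      finally show ?thesis by simp
    qed
    obtain s where s: "s \<ge> 0" "sh_seminorm \<Lambda> p Q \<gamma> u = ennreal s" by (rule ennreal_lt_top_le[OF fin])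
    have semi: "semi_le \<Lambda> p Q (?D u) s"
      unfolding semi_le_def
    proof (intro conjI ballI s(1))
      fix \<delta> assume "\<delta> \<in> ?H - Q"
      then show "Lp_dnorm \<Lambda> p (wderiv \<Lambda> \<delta> (?D u)) \<le> ennreal s"
        using Lp_dnorm_le_sob_norm[of "?H - Q" \<delta> p \<Lambda> "?D u"] H p s(2)
        by (simp add: sh_seminorm_def sob_seminorm_def)
    qed
    let ?a = "?D (u - q)" and ?b = "?D (q - I q)" and ?d = "?D (I (u - q))"
    have uq: "u - q = 1 *\<^sub>R u + (-1) *\<^sub>R q" by simp
    have uqL: "u - q \<in> L1 \<Lambda>" unfolding uq by (rule Dw_lincomb(1)[OF U(1) uL qL])
    have uqC: "u - q \<in> Ck \<mu> \<Lambda>" unfolding uq by (rule Ck_lincomb[OF U(1) uC qC])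
    have a: "?a = ?D u - ?D (mpoly Q \<gamma> c)"
      unfolding uq Dw_lincomb(2)[OF U(1) uL qL] unfolding c(1) by simp
    have aN: "Lp_dnorm \<Lambda> p (wderiv \<Lambda> \<alpha> ?a) \<le> ennreal (C0 * s)" if "\<alpha> \<in> ?H" for \<alpha>
      using rem[OF adm semi c(2)] that unfolding a by blast
    have aX: "sum_norm \<Lambda> p X ?a \<le> ennreal (real (card X) * (C0 * s))" if "X \<subseteq> ?H" for X
    proof -
      have "sum_norm \<Lambda> p X ?a \<le> of_nat (card X) * ennreal (C0 * s)"
        unfolding sum_norm_def using that aN by (intro sum_bounded_above) blast
      then show ?thesis using C0 s(1) by (simp add: ennreal_mult ennreal_of_nat_eq_real_of_nat)
    qed
    have sobH: "sob_norm \<Lambda> p ?H ?a \<le> ennreal (nH * (C0 * s))"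
      using sob_norm_le_sum[OF H p, of \<Lambda> ?a] aX[of ?H] unfolding sum_norm_def nH_def by simp
    then have sobH_fin: "sob_norm \<Lambda> p ?H ?a < \<infinity>" by (rule order_le_less_trans) (simp add: ennreal_less_top)
    have uqS: "u - q \<in> Ck \<mu> \<Lambda> \<inter> sh_space \<Lambda> p ?H \<gamma>"
      using uqC uqL sobH_fin by (simp add: sh_space_def sh_norm_def)
    \<comment> \<open>As \<open>0 \<in> Q\<close>, the remainder itself is given by an integrable function \<open>w\<close>, to which the functionals apply.\<close>
    have "wderiv \<Lambda> 0 ?a = ?a" by (simp only: Dw_def wderiv_wderiv add_0_left)
    moreover have "Lp_dnorm \<Lambda> p (wderiv \<Lambda> 0 ?a) < \<infinity>"
      using aN[OF idx_hull_mem(1)[OF \<open>0 \<in> Q\<close>]] by (rule order_le_less_trans) (simp add: ennreal_less_top)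
    ultimately obtain w where w: "dens \<Lambda> ?a w" using regular_dens[OF U(1) Lp_dnorm_regular] by metis
    then have wa: "dist_of \<Lambda> w = ?a" "w \<in> sob_space \<Lambda> p ?H"
      using sobH_fin integrable_imp_L1[OF U(1)] by (auto simp: dens_def sob_space_def)
    have IuqS: "I (u - q) \<in> S" using assms(11) uqC by blast
    have "sum_norm \<Lambda> p P ?d \<le> ennreal D * sob_norm \<Lambda> p ?H (dist_of \<Lambda> w)"
      by (rule interp[OF IuqS wa(2)]) (use assms(16) uqS wa(1) in auto)
    also have "\<dots> \<le> ennreal D * ennreal (nH * (C0 * s))" unfolding wa(1) by (intro mult_left_mono sobH) simp
    also have "\<dots> = ennreal (D * nH * C0 * s)" using D n C0 s(1) by (simp add: ennreal_mult[symmetric] mult.assoc)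
    finally have dN: "sum_norm \<Lambda> p P ?d \<le> ennreal (D * nH * C0 * s)" .
    have bN: "sum_norm \<Lambda> p P ?b \<le> ennreal nP * sh_norm \<Lambda> p P \<gamma> (q - I q)"
      using sum_norm_le_sob_norm[OF P p, of \<Lambda> ?b] by (simp add: sh_norm_def nP_def ennreal_of_nat_eq_real_of_nat)
    have Iu: "I (u - q) = 1 *\<^sub>R I u + (-1) *\<^sub>R I q"
      unfolding uq using assms(12) uC qC unfolding lin_on_def by blast
    have "u - I u = 1 *\<^sub>R (u - q) + 1 *\<^sub>R (1 *\<^sub>R (q - I q) + (-1) *\<^sub>R I (u - q))"
      unfolding Iu by simp
    moreover have qIL: "q - I q \<in> L1 \<Lambda>"
      using Dw_lincomb(1)[OF U(1) qL SL, of "I q" 1 "-1"] assms(11) qC by simp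
    ultimately have split: "?D (u - I u) = 1 *\<^sub>R ?a + 1 *\<^sub>R (1 *\<^sub>R ?b + (-1) *\<^sub>R ?d)"
      by (simp only: Dw_lincomb[OF U(1)] uqL SL[OF IuqS])
    have "sh_norm \<Lambda> p P \<gamma> (u - I u) \<le> sum_norm \<Lambda> p P (?D (u - I u))"
      unfolding sh_norm_def sum_norm_def by (rule sob_norm_le_sum[OF P p])
    also have "\<dots> \<le> 2 * (ennreal \<bar>1\<bar> * sum_norm \<Lambda> p P ?a + ennreal \<bar>1\<bar> * sum_norm \<Lambda> p P (1 *\<^sub>R ?b + (-1) *\<^sub>R ?d))"
      unfolding split by (rule sum_norm_lincomb[OF U(1) p])
    also have "\<dots> \<le> 2 * (ennreal \<bar>1\<bar> * sum_norm \<Lambda> p P ?a + ennreal \<bar>1\<bar> * (2 * (ennreal \<bar>1\<bar> * sum_norm \<Lambda> p P ?b + ennreal \<bar>-1\<bar> * sum_norm \<Lambda> p P ?d)))"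
      by (intro mult_left_mono add_mono order_refl sum_norm_lincomb[OF U(1) p]) auto
    also have "\<dots> = 2 * sum_norm \<Lambda> p P ?a + 4 * sum_norm \<Lambda> p P ?b + 4 * sum_norm \<Lambda> p P ?d"
      by (simp add: distrib_left mult.assoc[symmetric] add.assoc)
    also have "\<dots> \<le> 2 * ennreal (nP * (C0 * s)) + 4 * (ennreal nP * sh_norm \<Lambda> p P \<gamma> (q - I q)) + 4 * ennreal (D * nH * C0 * s)"
      using aX[OF assms(9)] bN dN unfolding nP_def by (intro add_mono mult_left_mono) auto
    also have "\<dots> = ennreal (2 * nP * C0 + 4 * D * nH * C0) * ennreal s + ennreal (4 * nP) * sh_norm \<Lambda> p P \<gamma> (q - I q)"
    proof -
      have "2 * ennreal (nP * (C0 * s)) + 4 * ennreal (D * nH * C0 * s) = ennreal (2 * (nP * (C0 * s)) + 4 * (D * nH * C0 * s))"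
        using n C0 s(1) D by (simp add: ennreal_mult')
      also have "\<dots> = ennreal (2 * nP * C0 + 4 * D * nH * C0) * ennreal s"
        using n C0 s(1) D by (subst ennreal_mult[symmetric]) (simp_all add: algebra_simps)
      finally show ?thesis using n by (simp add: ennreal_mult' ac_simps)
    qed
    also have "\<dots> \<le> ennreal C * ennreal s + ennreal C * sh_norm \<Lambda> p P \<gamma> (q - I q)"
      using n C0 D by (intro add_mono mult_right_mono ennreal_leI) (simp_all add: C_def)
    also have "\<dots> = ennreal C * (sh_seminorm \<Lambda> p Q \<gamma> u + sh_norm \<Lambda> p P \<gamma> (q - I q))"
      unfolding s(2) by (rule distrib_left[symmetric])
    finally show "sh_norm \<Lambda> p P \<gamma> (u - I u) \<le> ennreal C * (sh_seminorm \<Lambda> p Q \<gamma> u + sh_norm \<Lambda> p P \<gamma> (q - I q))" .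
  qed
qed

end
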